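(* For $n\times n$ real matrices, there is an $(O(n\log n),2)$-sketching family for the $1\to p$ norm when $p\in[1,2]$, and an $(O(n^{2-2/p}\log^2 n),2)$-sketching family for the $1\to p$ norm when $p\in(2,\infty]$.
   Context: For $A\in\mathbb{R}^{n\times d}$, $\|A\|_{q\to p}=\sup_{x\ne0}\frac{\|Ax\|_p}{\|x\|_q}$. A $(k,\alpha)$-sketching family for the $q\to p$ norm is a pair $(\mathcal{S},f)$ where $\mathcal{S}$ is a distribution over linear maps $L:\mathbb{R}^{n\times d}\to\mathbb{R}^k$ and $f:\mathbb{R}^k\to\mathbb{R}$, such that for every $A$, $\Pr_{L\sim\mathcal{S}}\big[f(L(A))\in(\tfrac1\alpha\|A\|_{q\to p},\,\alpha\|A\|_{q\to p})\big]\ge \frac56$.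
   Formalization: For A = 0 the open interval (‖A‖/α, α‖A‖) is empty, so no sketching family could exist as literally defined; for A = 0 the requirement is replaced by f(L(A)) = 0 with probability at least 5/6. Nonzero A are treated as stated. *)

theory Defs
  imports "HOL-Probability.Probability" "HOL-Library.Landau_Symbols" "Jordan_Normal_Form.Matrix"
begin

definition lp_norm :: "ereal \<Rightarrow> real vec \<Rightarrow> real" where
  "lp_norm p v =
     (if p = \<infinity> then Max (insert 0 ((\<lambda>i. \<bar>vec_index v i\<bar>) ` {..<dim_vec v}))
      else (\<Sum>i<dim_vec v. \<bar>vec_index v i\<bar> powr real_of_ereal p) powr (1 / real_of_ereal p))"

text \<open>
  The supremum is over a bounded set whenever \<open>p, q \<ge> 1\<close>, and over a nonempty set
  whenever \<open>A\<close> has at least one column; outside these cases the value is not meaningful.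
\<close>

definition op_norm :: "ereal \<Rightarrow> ereal \<Rightarrow> real mat \<Rightarrow> real" where
  "op_norm q p A =
     (SUP x \<in> {x \<in> carrier_vec (dim_col A). x \<noteq> 0\<^sub>v (dim_col A)}.
        lp_norm p (A *\<^sub>v x) / lp_norm q x)"

text \<open>
  Linear maps from real \<open>n \<times> d\<close> matrices to real \<open>k\<close>-vectors, as extensional
  functions on the carrier, so that distinct elements are distinct as maps.
\<close>

definition sketch_maps :: "nat \<Rightarrow> nat \<Rightarrow> nat \<Rightarrow> (real mat \<Rightarrow> real vec) set" where
  "sketch_maps n d k =
     {L \<in> carrier_mat n d \<rightarrow>\<^sub>E carrier_vec k.
        (\<forall>A\<in>carrier_mat n d. \<forall>B\<in>carrier_mat n d. L (A + B) = L A + L B) \<and>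
        (\<forall>c. \<forall>A\<in>carrier_mat n d. L (c \<cdot>\<^sub>m A) = c \<cdot>\<^sub>v L A)}"

text \<open>
  The sigma-algebra generated by all coordinates of all evaluations; it is the Borel
  sigma-algebra of the finite-dimensional space of linear maps.
\<close>

definition sketch_algebra :: "nat \<Rightarrow> nat \<Rightarrow> nat \<Rightarrow> (real mat \<Rightarrow> real vec) measure" where
  "sketch_algebra n d k =
     sigma (sketch_maps n d k)
       {{L \<in> sketch_maps n d k. vec_index (L A) i \<in> U} | A i U.
          A \<in> carrier_mat n d \<and> i < k \<and> U \<in> sets borel}"

text \<open>
  For \<open>A = 0\<close> the open interval with endpoints \<open>N / \<alpha>\<close> and \<open>\<alpha> * N\<close> is empty, so
  no family could meet the requirement literally; there the estimate has to be exactly \<open>0\<close>.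
\<close>

definition good_estimate :: "real \<Rightarrow> real \<Rightarrow> real \<Rightarrow> bool" where
  "good_estimate \<alpha> N y \<longleftrightarrow> (if N = 0 then y = 0 else y \<in> {1 / \<alpha> * N <..< \<alpha> * N})"

text \<open>
  The estimator \<open>f\<close> is not required to be measurable, but each event below is: a
  non-measurable set has \<open>measure\<close> 0, which is less than 5/6.
\<close>

definition sketching_family ::
    "nat \<Rightarrow> nat \<Rightarrow> ereal \<Rightarrow> ereal \<Rightarrow> nat \<Rightarrow> real \<Rightarrow>
     (real mat \<Rightarrow> real vec) measure \<Rightarrow> (real vec \<Rightarrow> real) \<Rightarrow> bool" where
  "sketching_family n d q p k \<alpha> S f \<longleftrightarrow>
     prob_space S \<and> sets S = sets (sketch_algebra n d k) \<and>
     (\<forall>A\<in>carrier_mat n d.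
        measure S {L \<in> space S. good_estimate \<alpha> (op_norm q p A) (f (L A))} \<ge> 5 / 6)"

end

theory Submission
  imports Defs "HOL-Real_Asymp.Real_Asymp"
begin

text \<open>
  By convexity the norm of \<open>A\<close> is the largest \<open>p\<close>-norm of a column, so it suffices to estimate one
  column \<open>x\<close> up to a factor 2 with failure probability \<open>O(1/n)\<close>. An order statistic of \<open>O(log n)\<close>
  independent copies of a statistic \<open>G\<close> does this as soon as \<open>P(G \<ge> 2 t \<parallel>x\<parallel>)\<close> stays below
  \<open>P(G > t \<parallel>x\<parallel> / 2)\<close> by a constant.

  For \<open>p = 2\<close> take \<open>G = \<bar>\<Sum> \<sigma>\<^sub>i x\<^sub>i\<bar>\<close> with random signs. Otherwise multiply the coordinates by independent
  weights \<open>w\<^sub>i\<close> with tail \<open>s powr - p\<close>; then \<open>max \<bar>w\<^sub>i x\<^sub>i\<bar>\<close> exceeds \<open>s \<parallel>x\<parallel>\<close> with probability about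
  \<open>s powr - p\<close>. For \<open>p < 2\<close> and large \<open>t\<close> the single row \<open>\<Sum> \<sigma>\<^sub>i w\<^sub>i x\<^sub>i\<close> is dominated by its largest term.
  For \<open>2 < p < \<infinity>\<close> the vector \<open>w x\<close> has squared Euclidean norm \<open>O(n powr (1 - 2 / p))\<close> times \<open>\<parallel>x\<parallel>\<close> squared,
  so a count sketch with that many buckets and \<open>O(log n)\<close> repetitions recovers the largest entry. For \<open>p = \<infinity>\<close> the bound leaves room for reading all entries.
\<close>

text \<open>Every random object is discrete. The support of the seed is then countable, so one
  number can code the seed, and no measurability question arises on the seed space. The price is
  weights that are powers of two and follow the ideal tail only up to a factor 2. The target leaves
  a ratio 4 between \<open>2 * t\<close> and \<open>t / 2\<close>; an error of \<open>t / 8\<close>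
  on either side shrinks it to 3, the rounding to 3 / 2, and this last factor is what the
  amplification feeds on.

  The gap depends on \<open>p\<close> alone, so logarithmically many repetitions serve all columns.
  The truncated second moment of the weights is governed by the truncation level for
  \<open>p < 2\<close> and bounded for \<open>p > 2\<close>. At \<open>p = 2\<close> it grows
  logarithmically and neither argument applies, but there the norm is itself the second moment of a
  sum with random signs. Above 2 the second logarithm pays for reading all coordinates of a column
  correctly at once.\<close>

unbundle no vec_syntax

subsection \<open>The 1-to-p norm as the largest column norm\<close>

text \<open>The point 0 must belong to the domain because matrix entries may vanish. If one argument
  is 0, convexity reduces to \<open>s powr p \<le> s\<close> for \<open>s\<close> strictly between 0
  and 1.\<close>

lemma convex_on_powr_nonneg:
  fixes p :: real
  assumes "1 \<le> p"
  shows "convex_on {0..} (\<lambda>x. x powr p)"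
proof (rule convex_onI)
  fix t x y :: real
  assume t: "0 < t" "t < 1" and xy: "x \<in> {0..}" "y \<in> {0..}"
  have le: "s powr p \<le> s" if "0 < s" "s < 1" for s :: real
    using powr_mono'[of 1 p s] that assms by simp
  consider "x = 0" | "y = 0" | "0 < x" "0 < y" using xy by force
  then show "((1 - t) *\<^sub>R x + t *\<^sub>R y) powr p \<le> (1 - t) * x powr p + t * y powr p"
  proof cases
    case 1
    then show ?thesis using le[of t] t xy assms
      by (simp add: powr_mult mult_right_mono)
  next
    case 2
    then show ?thesis using le[of "1 - t"] t xy assms
      by (simp add: powr_mult mult_right_mono)
  next
    case 3
    then show ?thesis
      using convex_onD[OF powr_convex[OF assms], of t x y] t by simp
  qed
qed simp

lemma lp_norm_finite:
  "lp_norm (ereal p) v = (\<Sum>i<dim_vec v. \<bar>v $ i\<bar> powr p) powr (1 / p)"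
  by (simp add: lp_norm_def)

lemma lp_norm_infinity:
  "lp_norm \<infinity> v = Max (insert 0 ((\<lambda>i. \<bar>v $ i\<bar>) ` {..<dim_vec v}))"
  by (simp add: lp_norm_def)

lemma lp_norm_one: "lp_norm 1 v = (\<Sum>i<dim_vec v. \<bar>v $ i\<bar>)"
  using lp_norm_finite[of 1 v] by (simp add: one_ereal_def sum_nonneg)

lemma lp_norm_nonneg: "0 \<le> lp_norm p v"
  by (simp add: lp_norm_def)

lemma lp_norm_finite_le_iff:
  assumes "0 < p" "0 \<le> c"
  shows "lp_norm (ereal p) v \<le> c \<longleftrightarrow> (\<Sum>i<dim_vec v. \<bar>v $ i\<bar> powr p) \<le> c powr p"
proof -
  let ?s = "\<Sum>i<dim_vec v. \<bar>v $ i\<bar> powr p"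
  have s: "0 \<le> ?s" by (simp add: sum_nonneg)
  have "?s powr (1 / p) \<le> c \<longleftrightarrow> (?s powr (1 / p)) powr p \<le> c powr p"
    using assms powr_mono2[of p "?s powr (1 / p)" c] powr_less_mono2[of p c "?s powr (1 / p)"]
    by fastforce
  also have "(?s powr (1 / p)) powr p = ?s" using s assms by (simp add: powr_powr)
  finally show ?thesis by (simp add: lp_norm_finite)
qed

lemma lp_norm_infinity_le_iff:
  assumes "0 \<le> c"
  shows "lp_norm \<infinity> v \<le> c \<longleftrightarrow> (\<forall>i<dim_vec v. \<bar>v $ i\<bar> \<le> c)"
  using assms by (auto simp: lp_norm_infinity)

lemma lp_norm_zero:
  assumes "1 \<le> p"
  shows "lp_norm p (0\<^sub>v n) = 0"
proof -
  have "Max (insert (0::real) ((\<lambda>i. 0) ` {..<n})) = 0"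
    by (rule Max_eqI) auto
  moreover have "real_of_ereal p \<noteq> 0" if "p \<noteq> \<infinity>"
    using assms that by (cases p) auto
  ultimately show ?thesis by (simp add: lp_norm_def)
qed

lemma lp_norm_smult:
  assumes "1 \<le> p"
  shows "lp_norm p (c \<cdot>\<^sub>v v) = \<bar>c\<bar> * lp_norm p v"
proof (cases p)
  case (real r)
  then have r: "r \<ge> 1" using assms by simp
  have "(\<Sum>i<dim_vec v. \<bar>(c \<cdot>\<^sub>v v) $ i\<bar> powr r) = \<bar>c\<bar> powr r * (\<Sum>i<dim_vec v. \<bar>v $ i\<bar> powr r)"
    by (simp add: sum_distrib_left abs_mult powr_mult)
  then show ?thesis
    using r by (simp add: real lp_norm_finite powr_mult sum_nonneg powr_powr)
next
  case PInf
  have "(\<lambda>i. \<bar>(c \<cdot>\<^sub>v v) $ i\<bar>) ` {..<dim_vec v} = (\<lambda>x. \<bar>c\<bar> * x) ` (\<lambda>i. \<bar>v $ i\<bar>) ` {..<dim_vec v}"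
    unfolding image_image by (rule image_cong) (auto simp: abs_mult)
  then have "insert 0 ((\<lambda>i. \<bar>(c \<cdot>\<^sub>v v) $ i\<bar>) ` {..<dim_vec v})
      = (\<lambda>x. \<bar>c\<bar> * x) ` insert 0 ((\<lambda>i. \<bar>v $ i\<bar>) ` {..<dim_vec v})"
    by simp
  moreover have "mono (\<lambda>x. \<bar>c\<bar> * x :: real)" by (simp add: mono_def mult_left_mono)
  ultimately show ?thesis
    using mono_Max_commute[of "\<lambda>x. \<bar>c\<bar> * x" "insert 0 ((\<lambda>i. \<bar>v $ i\<bar>) ` {..<dim_vec v})"]
    by (simp add: PInf lp_norm_infinity)
qed (use assms in auto)

lemma lp_norm_eq_0D:
  assumes "1 \<le> p" "lp_norm p v = 0" "i < dim_vec v"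
  shows "v $ i = 0"
proof (cases p)
  case (real r)
  then have "(\<Sum>i<dim_vec v. \<bar>v $ i\<bar> powr r) \<le> 0 powr r"
    using lp_norm_finite_le_iff[of r 0 v] assms by simp
  then have "(\<Sum>i<dim_vec v. \<bar>v $ i\<bar> powr r) = 0"
    using real assms by (simp add: order_antisym sum_nonneg)
  then show ?thesis using assms(3) by (simp add: sum_nonneg_eq_0_iff)
next
  case PInf
  then show ?thesis using lp_norm_infinity_le_iff[of 0 v] assms by simp
qed (use assms in auto)

lemma mult_mat_vec_index:
  assumes "A \<in> carrier_mat n d" "x \<in> carrier_vec d" "i < n"
  shows "(A *\<^sub>v x) $ i = (\<Sum>j<d. A $$ (i, j) * x $ j)"
  using assms by (auto simp: scalar_prod_def atLeast0LessThan intro!: sum.cong)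

text \<open>Jensen's inequality for the convex combination of the columns with weights
  \<open>\<bar>x $ j\<bar> / lp_norm 1 x\<close>; the triangle inequality for \<open>lp_norm p\<close> is not needed.\<close>

lemma lp_norm_mult_mat_vec_le:
  assumes p: "1 \<le> p" and A: "A \<in> carrier_mat n d" and x: "x \<in> carrier_vec d"
    and M: "0 \<le> M" "\<And>j. j < d \<Longrightarrow> lp_norm p (col A j) \<le> M"
  shows "lp_norm p (A *\<^sub>v x) \<le> M * lp_norm 1 x"
proof (cases "lp_norm 1 x = 0")
  case True
  then have "x $ j = 0" if "j < d" for j
    using lp_norm_eq_0D[of 1 x j] x that by simp
  then have "A *\<^sub>v x = 0\<^sub>v n"
    using A x by (intro eq_vecI) (auto simp: mult_mat_vec_index simp del: index_mult_mat_vec)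
  then show ?thesis using True lp_norm_zero[OF p] by simp
next
  case False
  define s where "s = lp_norm 1 x"
  have s: "0 < s" using False lp_norm_nonneg[of 1 x] by (simp add: s_def)
  define w where "w j = \<bar>x $ j\<bar> / s" for j
  have w0: "0 \<le> w j" for j using s by (simp add: w_def)
  have w1: "(\<Sum>j<d. w j) = 1"
    using x s by (simp add: w_def flip: sum_divide_distrib) (simp add: s_def lp_norm_one)
  have bound: "\<bar>(A *\<^sub>v x) $ i\<bar> \<le> s * (\<Sum>j<d. w j * \<bar>A $$ (i, j)\<bar>)" if "i < n" for i
  proof -
    have "\<bar>\<Sum>j<d. A $$ (i, j) * x $ j\<bar> \<le> (\<Sum>j<d. \<bar>A $$ (i, j) * x $ j\<bar>)"
      by (rule sum_abs)
    also have "\<dots> = s * (\<Sum>j<d. w j * \<bar>A $$ (i, j)\<bar>)"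
      using s by (auto simp: sum_distrib_left w_def abs_mult intro!: sum.cong)
    finally show ?thesis using mult_mat_vec_index[OF A x that] by simp
  qed
  have dim: "dim_vec (A *\<^sub>v x) = n" using A by simp
  have col: "col A j \<in> carrier_vec n" "\<And>i. i < n \<Longrightarrow> col A j $ i = A $$ (i, j)" if "j < d" for j
    using A that by auto
  show ?thesis
  proof (cases p)
    case (real r)
    then have r: "1 \<le> r" using p by simp
    have "(\<Sum>i<n. \<bar>(A *\<^sub>v x) $ i\<bar> powr r) \<le> (\<Sum>i<n. s powr r * (\<Sum>j<d. w j * \<bar>A $$ (i, j)\<bar> powr r))"
    proof (rule sum_mono)
      fix i assume i: "i \<in> {..<n}"
      have "\<bar>(A *\<^sub>v x) $ i\<bar> powr r \<le> (s * (\<Sum>j<d. w j * \<bar>A $$ (i, j)\<bar>)) powr r"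
        using bound[of i] i r by (intro powr_mono2) auto
      also have "\<dots> = s powr r * (\<Sum>j<d. w j * \<bar>A $$ (i, j)\<bar>) powr r"
        using s w0 by (simp add: powr_mult sum_nonneg)
      also have "(\<Sum>j<d. w j * \<bar>A $$ (i, j)\<bar>) powr r \<le> (\<Sum>j<d. w j * \<bar>A $$ (i, j)\<bar> powr r)"
      proof -
        have "{..<d} \<noteq> {}" using w1 by auto
        then show ?thesis
          using convex_on_sum[OF _ _ convex_on_powr_nonneg[OF r] w1, of "\<lambda>j. \<bar>A $$ (i, j)\<bar>"] w0
          by simp
      qed
      finally show "\<bar>(A *\<^sub>v x) $ i\<bar> powr r \<le> s powr r * (\<Sum>j<d. w j * \<bar>A $$ (i, j)\<bar> powr r)"
        by (simp add: mult_left_mono)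
    qed
    also have "\<dots> = s powr r * (\<Sum>j<d. w j * (\<Sum>i<n. \<bar>A $$ (i, j)\<bar> powr r))"
      unfolding sum_distrib_left[symmetric] by (subst sum.swap) (simp add: sum_distrib_left)
    also have "\<dots> \<le> s powr r * (\<Sum>j<d. w j * M powr r)"
    proof (intro mult_left_mono sum_mono)
      fix j assume "j \<in> {..<d}"
      then have "lp_norm (ereal r) (col A j) \<le> M" using M real by simp
      then show "(\<Sum>i<n. \<bar>A $$ (i, j)\<bar> powr r) \<le> M powr r"
        using lp_norm_finite_le_iff[of r M "col A j"] r M col(1)[of j] col(2)[of j] A \<open>j \<in> {..<d}\<close>
        by simp
    qed (use w0 in auto)
    also have "\<dots> = (M * s) powr r"
      using w1 M s by (simp add: powr_mult mult.commute flip: sum_distrib_right)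
    finally show ?thesis
      using lp_norm_finite_le_iff[of r "M * s" "A *\<^sub>v x"] real r M s A by (simp add: s_def)
  next
    case PInf
    have "\<bar>(A *\<^sub>v x) $ i\<bar> \<le> M * s" if i: "i < n" for i
    proof -
      have "(\<Sum>j<d. w j * \<bar>A $$ (i, j)\<bar>) \<le> (\<Sum>j<d. w j * M)"
      proof (intro sum_mono mult_left_mono)
        fix j assume "j \<in> {..<d}"
        then show "\<bar>A $$ (i, j)\<bar> \<le> M"
          using M(2)[of j] lp_norm_infinity_le_iff[OF M(1), of "col A j"] PInf col(2)[of j i] A i
          by simp
      qed (use w0 in auto)
      also have "\<dots> = M" using w1 by (simp flip: sum_distrib_right)
      finally have "s * (\<Sum>j<d. w j * \<bar>A $$ (i, j)\<bar>) \<le> M * s"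
        using s by (simp add: mult.commute)
      then show ?thesis using bound[OF i] by simp
    qed
    then show ?thesis
      using lp_norm_infinity_le_iff[of "M * s" "A *\<^sub>v x"] PInf M s A by (simp add: s_def)
  qed (use p in auto)
qed

text \<open>The unit vector of a column of largest norm attains the bound of
  \<open>lp_norm_mult_mat_vec_le\<close>, so the supremum is a maximum.\<close>

lemma op_norm_one:
  assumes p: "1 \<le> p" and A: "A \<in> carrier_mat n d" and d: "0 < d"
  shows "op_norm 1 p A = Max ((\<lambda>j. lp_norm p (col A j)) ` {..<d})"
proof -
  let ?M = "Max ((\<lambda>j. lp_norm p (col A j)) ` {..<d})"
  let ?X = "{x \<in> carrier_vec d. x \<noteq> 0\<^sub>v d} :: real vec set"
  have le: "lp_norm p (col A j) \<le> ?M" if "j < d" for j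
    using that by (intro Max_ge) auto
  have M0: "0 \<le> ?M" using le[OF d] lp_norm_nonneg[of p "col A 0"] by simp
  obtain j where j: "j < d" "lp_norm p (col A j) = ?M"
    using Max_in[of "(\<lambda>j. lp_norm p (col A j)) ` {..<d}"] d by fastforce
  have ub: "lp_norm p (A *\<^sub>v x) / lp_norm 1 x \<le> ?M" if "x \<in> ?X" for x
  proof (cases "lp_norm 1 x = 0")
    case False
    then have "0 < lp_norm 1 x" using lp_norm_nonneg[of 1 x] by simp
    then show ?thesis
      using lp_norm_mult_mat_vec_le[OF p A _ M0 le, of x] that by (simp add: divide_le_eq)
  qed (use M0 in simp)
  have unit: "unit_vec d j \<in> ?X"
    using j by (auto simp: unit_vec_nonzero)
  have "(\<Sum>i<d. \<bar>unit_vec d j $ i\<bar>) = (\<Sum>i<d. if i = j then 1 else 0 :: real)"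
    using j by (intro sum.cong) auto
  then have n1: "lp_norm 1 (unit_vec d j) = 1" using j by (simp add: lp_norm_one)
  have "A *\<^sub>v unit_vec d j = col A j"
    using A j by (intro eq_vecI)
      (auto simp: mult_mat_vec_index[OF A] if_distrib cong: if_cong simp del: index_mult_mat_vec)
  then have "?M = lp_norm p (A *\<^sub>v unit_vec d j) / lp_norm 1 (unit_vec d j)"
    using n1 j by simp
  then have "?M \<in> (\<lambda>x. lp_norm p (A *\<^sub>v x) / lp_norm 1 x) ` ?X"
    using unit by blast
  moreover have "dim_col A = d" using A by simp
  ultimately show ?thesis
    unfolding op_norm_def using ub by (intro cSup_eq_maximum) auto
qed

subsection \<open>Sketches whose decoder knows the seed\<close>

text \<open>The decoder may depend on the random seed: the sketch consists of the rows \<open>u\<close> together with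
  \<open>c * u\<close>, where \<open>c\<close> is a numerical code of the seed. The code can be read off unless \<open>u = 0\<close>, in
  which case every decoder returns \<open>0\<close>.\<close>

definition coded_rows :: "nat \<Rightarrow> real \<Rightarrow> (nat \<Rightarrow> real) \<Rightarrow> real vec" where
  "coded_rows k c u = vec (2 * k) (\<lambda>i. if i < k then u i else c * u (i - k))"

definition head_rows :: "nat \<Rightarrow> real vec \<Rightarrow> nat \<Rightarrow> real" where
  "head_rows k y i = (if i < k then y $ i else 0)"

text \<open>The search for the code is a series so that measurability is that of a limit of Borel
  functions. If some row is nonzero, at most one term survives; if all rows are 0, every code
  matches, and the terms vanish for decoders that send 0 to 0.\<close>

definition decode :: "nat \<Rightarrow> (nat \<Rightarrow> (nat \<Rightarrow> real) \<Rightarrow> real) \<Rightarrow> real vec \<Rightarrow> real" where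
  "decode k h y = (\<Sum>c. if \<forall>i\<in>{..<k}. y $ (k + i) = real c * y $ i then h c (head_rows k y) else 0)"

lemma decode_coded_rows:
  assumes h0: "\<And>c. h c (\<lambda>_. 0) = 0"
  shows "decode k h (coded_rows k (real c) u) = h c (\<lambda>i. if i < k then u i else 0)"
proof -
  let ?y = "coded_rows k (real c) u"
  have head: "head_rows k ?y = (\<lambda>i. if i < k then u i else 0)"
    by (auto simp: head_rows_def coded_rows_def)
  show ?thesis
  proof (cases "\<forall>i<k. u i = 0")
    case True
    then have 0: "(\<lambda>i. if i < k then u i else 0) = (\<lambda>_. 0)" by auto
    show ?thesis unfolding decode_def head 0 h0 by simp
  next
    case False
    then obtain i where i: "i < k" "u i \<noteq> 0" by auto
    have "(\<forall>i\<in>{..<k}. ?y $ (k + i) = real c' * ?y $ i) \<longleftrightarrow> c' = c" for c'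
    proof
      assume "\<forall>i\<in>{..<k}. ?y $ (k + i) = real c' * ?y $ i"
      then have "real c * u i = real c' * u i" using i by (auto simp: coded_rows_def)
      then show "c' = c" using i by simp
    qed (auto simp: coded_rows_def)
    then have "decode k h ?y = (\<Sum>c'. if c' = c then h c' (head_rows k ?y) else 0)"
      by (simp add: decode_def)
    also have "\<dots> = h c (head_rows k ?y)"
      by (subst suminf_finite[of "{c}"]) auto
    finally show ?thesis by (simp add: head)
  qed
qed

section \<open>Measurability of the decoder on the space of linear maps\<close>

lemma space_sketch_algebra: "space (sketch_algebra n d k) = sketch_maps n d k"
  unfolding sketch_algebra_def by (rule space_measure_of) auto

lemma measurable_sketch_coordinate:
  assumes "A \<in> carrier_mat n d" "i < k"
  shows "(\<lambda>L. vec_index (L A) i) \<in> borel_measurable (sketch_algebra n d k)"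
proof (rule measurableI)
  fix U :: "real set" assume U: "U \<in> sets borel"
  have "(\<lambda>L. vec_index (L A) i) -` U \<inter> space (sketch_algebra n d k)
      = {L \<in> sketch_maps n d k. vec_index (L A) i \<in> U}"
    by (auto simp: space_sketch_algebra)
  also have "\<dots> \<in> sets (sketch_algebra n d k)"
    unfolding sketch_algebra_def using assms U
    by (subst sets_measure_of) (auto intro!: sigma_sets.Basic)
  finally show "(\<lambda>L. vec_index (L A) i) -` U \<inter> space (sketch_algebra n d k)
      \<in> sets (sketch_algebra n d k)" .
qed simp

text \<open>The guarantee concerns an event in the space of maps, and a non-measurable event would
  have measure 0. The decoder reads finitely many coordinates of one evaluation \<open>L A\<close>,
  and these are measurable by construction of the sigma-algebra.\<close>

lemma measurable_decode:
  assumes A: "A \<in> carrier_mat n d"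
    and h: "\<And>c. h c \<in> borel_measurable (PiM UNIV (\<lambda>_. borel))"
  shows "(\<lambda>L. decode k h (L A)) \<in> borel_measurable (sketch_algebra n d (2 * k))"
proof -
  let ?M = "sketch_algebra n d (2 * k)"
  have 1: "(\<lambda>L. vec_index (L A) i) \<in> borel_measurable ?M" if "i < 2 * k" for i
    using measurable_sketch_coordinate[OF A that] .
  have 2: "(\<lambda>L. head_rows k (L A)) \<in> measurable ?M (PiM UNIV (\<lambda>_. borel))"
  proof (rule measurable_PiM_single')
    fix i :: nat
    show "(\<lambda>L. head_rows k (L A) i) \<in> borel_measurable ?M"
      using 1[of i] by (cases "i < k") (simp_all add: head_rows_def)
  qed auto
  have 3: "{L \<in> space ?M. \<forall>i\<in>{..<k}. vec_index (L A) (k + i) = real c * vec_index (L A) i} \<in> sets ?M" for c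
  proof (rule sets.sets_Collect_finite_All)
    fix i assume i: "i \<in> {..<k}"
    have "(\<lambda>L. vec_index (L A) (k + i)) \<in> borel_measurable ?M"
      by (rule 1) (use i in simp)
    moreover have "(\<lambda>L. real c * vec_index (L A) i) \<in> borel_measurable ?M"
      by (rule borel_measurable_times[OF borel_measurable_const 1]) (use i in simp)
    ultimately show "{L \<in> space ?M. vec_index (L A) (k + i) = real c * vec_index (L A) i} \<in> sets ?M"
      by (rule borel_measurable_eq)
  qed simp
  have 4: "(\<lambda>L. h c (head_rows k (L A))) \<in> borel_measurable ?M" for c
    by (rule measurable_compose[OF 2 h])
  show ?thesis
    unfolding decode_def
    by (rule borel_measurable_suminf, rule measurable_If[OF 4 _ 3]) simp
qed

definition sketch_of :: "nat \<Rightarrow> nat \<Rightarrow> nat \<Rightarrow> real \<Rightarrow> (nat \<Rightarrow> real mat \<Rightarrow> real) \<Rightarrow> real mat \<Rightarrow> real vec" where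
  "sketch_of n d k c \<rho> = restrict (\<lambda>A. coded_rows k c (\<lambda>i. \<rho> i A)) (carrier_mat n d)"

lemma sketch_of_in_sketch_maps:
  assumes "\<And>i A B. i < k \<Longrightarrow> A \<in> carrier_mat n d \<Longrightarrow> B \<in> carrier_mat n d \<Longrightarrow> \<rho> i (A + B) = \<rho> i A + \<rho> i B"
    and "\<And>i a A. i < k \<Longrightarrow> A \<in> carrier_mat n d \<Longrightarrow> \<rho> i (a \<cdot>\<^sub>m A) = a * \<rho> i A"
  shows "sketch_of n d k c \<rho> \<in> sketch_maps n d (2 * k)"
  using assms
  by (auto simp: sketch_of_def sketch_maps_def coded_rows_def algebra_simps intro!: eq_vecI)

text \<open>The distribution on maps is the image of \<open>Q\<close>, whose support is countable,
  so each seed has a natural number as its code. The factor 2 pays for the rows multiplied by that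
  code. The probability to be bounded now lives on a pmf, where every set is measurable.\<close>

lemma sketching_family_seeded:
  fixes Q :: "'s pmf" and \<rho> :: "'s \<Rightarrow> nat \<Rightarrow> real mat \<Rightarrow> real"
  assumes add: "\<And>s i A B. i < k \<Longrightarrow> A \<in> carrier_mat n d \<Longrightarrow> B \<in> carrier_mat n d \<Longrightarrow>
      \<rho> s i (A + B) = \<rho> s i A + \<rho> s i B"
    and smult: "\<And>s i a A. i < k \<Longrightarrow> A \<in> carrier_mat n d \<Longrightarrow> \<rho> s i (a \<cdot>\<^sub>m A) = a * \<rho> s i A"
    and h0: "\<And>s. h s (\<lambda>_. 0) = 0"
    and h: "\<And>s. h s \<in> borel_measurable (PiM UNIV (\<lambda>_. borel))"
    and good: "\<And>A. A \<in> carrier_mat n d \<Longrightarrow> measure_pmf.prob Q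
      {s. good_estimate \<alpha> (op_norm q p A) (h s (\<lambda>i. if i < k then \<rho> s i A else 0))} \<ge> 5 / 6"
  shows "\<exists>S f. sketching_family n d q p (2 * k) \<alpha> S f"
proof -
  define code where "code = to_nat_on (set_pmf Q)"
  define seed where "seed = from_nat_into (set_pmf Q)"
  have seed: "seed (code s) = s" if "s \<in> set_pmf Q" for s
    using that by (simp add: seed_def code_def countable_set_pmf)
  define M where "M = sketch_algebra n d (2 * k)"
  define L where "L s = sketch_of n d k (real (code s)) (\<rho> s)" for s
  define f where "f = decode k (\<lambda>c. h (seed c))"
  define S where "S = distr (measure_pmf Q) M L"
  have L: "L s \<in> space M" for s
    unfolding L_def M_def space_sketch_algebra using add smult by (intro sketch_of_in_sketch_maps) auto
  then have Lm: "L \<in> measurable (measure_pmf Q) M"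
    by (auto simp: measurable_def)
  have "measure S {x \<in> space S. good_estimate \<alpha> (op_norm q p A) (f (x A))} \<ge> 5 / 6"
    if A: "A \<in> carrier_mat n d" for A
  proof -
    let ?N = "op_norm q p A"
    have fm: "(\<lambda>x. f (x A)) \<in> borel_measurable M"
      unfolding f_def M_def using A h by (intro measurable_decode) auto
    have "{y. good_estimate \<alpha> ?N y} = (if ?N = 0 then {0} else {1 / \<alpha> * ?N <..< \<alpha> * ?N})"
      by (auto simp: good_estimate_def)
    then have "{y. good_estimate \<alpha> ?N y} \<in> sets borel" by simp
    from measurable_sets[OF fm this]
    have "{x \<in> space M. good_estimate \<alpha> ?N (f (x A))} \<in> sets M"
      by (simp add: vimage_def Int_def conj_commute)
    then have "measure S {x \<in> space S. good_estimate \<alpha> ?N (f (x A))}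
        = measure_pmf.prob Q {s. good_estimate \<alpha> ?N (f (L s A))}"
      unfolding S_def using L by (subst measure_distr[OF Lm]) (auto intro!: arg_cong2[where f=measure])
    also have "\<dots> = measure_pmf.prob Q
        {s. good_estimate \<alpha> ?N (h s (\<lambda>i. if i < k then \<rho> s i A else 0))}"
      \<comment> \<open>\<open>seed\<close> inverts \<open>code\<close> on the support of
        \<open>Q\<close> only, hence the comparison almost everywhere.\<close>
      using A seed by (intro measure_pmf.finite_measure_eq_AE)
        (auto simp: AE_measure_pmf_iff f_def L_def sketch_of_def decode_coded_rows h0)
    finally show ?thesis using good[OF A] by simp
  qed
  moreover have "prob_space S"
    unfolding S_def by (rule measure_pmf.prob_space_distr[OF Lm])
  moreover have "sets S = sets (sketch_algebra n d (2 * k))"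
    by (simp add: S_def M_def)
  ultimately show ?thesis unfolding sketching_family_def by blast
qed

subsection \<open>Amplification by order statistics\<close>

text \<open>The \<open>c\<close>-th largest of \<open>v 0, \<dots>, v (m - 1)\<close>, in a form that is visibly Borel in \<open>v\<close>.\<close>

definition kth_largest :: "nat \<Rightarrow> nat \<Rightarrow> (nat \<Rightarrow> real) \<Rightarrow> real" where
  "kth_largest m c v = Max ((\<lambda>I. Min (v ` I)) ` {I. I \<subseteq> {..<m} \<and> c \<le> card I})"

lemma kth_largest_ge_iff:
  assumes c: "1 \<le> c" "c \<le> m"
  shows "a \<le> kth_largest m c v \<longleftrightarrow> c \<le> card {r. r < m \<and> a \<le> v r}"
proof -
  let ?F = "{I. I \<subseteq> {..<m} \<and> c \<le> card I}"
  have fin: "finite ?F" by (rule finite_subset[of _ "Pow {..<m}"]) auto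
  have ne: "{..<m} \<in> ?F" using c by simp
  have I: "finite I" "I \<noteq> {}" if "I \<in> ?F" for I
    using that c finite_subset[of I "{..<m}"] by auto
  have "a \<le> kth_largest m c v \<longleftrightarrow> (\<exists>I\<in>?F. a \<le> Min (v ` I))"
    unfolding kth_largest_def using fin ne by (subst Max_ge_iff) auto
  also have "\<dots> \<longleftrightarrow> (\<exists>I\<in>?F. \<forall>r\<in>I. a \<le> v r)"
    using I by (intro bex_cong refl) (subst Min_ge_iff, auto)
  also have "\<dots> \<longleftrightarrow> c \<le> card {r. r < m \<and> a \<le> v r}"
  proof
    assume "\<exists>I\<in>?F. \<forall>r\<in>I. a \<le> v r"
    then obtain I where "I \<subseteq> {..<m}" "c \<le> card I" "\<forall>r\<in>I. a \<le> v r" by blast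
    moreover from this have "card I \<le> card {r. r < m \<and> a \<le> v r}"
      by (intro card_mono) auto
    ultimately show "c \<le> card {r. r < m \<and> a \<le> v r}" by simp
  next
    assume "c \<le> card {r. r < m \<and> a \<le> v r}"
    then show "\<exists>I\<in>?F. \<forall>r\<in>I. a \<le> v r"
      by (intro bexI[of _ "{r. r < m \<and> a \<le> v r}"]) auto
  qed
  finally show ?thesis .
qed

text \<open>The estimate must lie in an open interval: the weak form excludes its upper end, this
  strict form passes its lower end. The least value above \<open>a\<close> turns the strict count
  into a weak one.\<close>

lemma kth_largest_gt_iff:
  assumes c: "1 \<le> c" "c \<le> m"
  shows "a < kth_largest m c v \<longleftrightarrow> c \<le> card {r. r < m \<and> a < v r}"
proof
  assume a: "a < kth_largest m c v"
  then have "c \<le> card {r. r < m \<and> kth_largest m c v \<le> v r}"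
    using kth_largest_ge_iff[OF c, of "kth_largest m c v" v] by blast
  also have "\<dots> \<le> card {r. r < m \<and> a < v r}"
    using a by (intro card_mono) auto
  finally show "c \<le> card {r. r < m \<and> a < v r}" .
next
  let ?S = "{r. r < m \<and> a < v r}"
  assume S: "c \<le> card ?S"
  have "?S \<noteq> {}"
  proof
    assume "?S = {}"
    then have "card ?S = 0" by (simp only: card.empty)
    then show False using S c by linarith
  qed
  then have ne: "v ` ?S \<noteq> {}" by blast
  let ?b = "Min (v ` ?S)"
  have "?b \<in> v ` ?S" using ne by (intro Min_in) auto
  then have "a < ?b" by auto
  moreover have "card ?S \<le> card {r. r < m \<and> ?b \<le> v r}"
    by (intro card_mono) auto
  then have "?b \<le> kth_largest m c v"
    using kth_largest_ge_iff[OF c] S by simp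
  ultimately show "a < kth_largest m c v" by simp
qed

lemma kth_largest_scale:
  assumes c: "1 \<le> c" "c \<le> m" and a: "0 \<le> a"
  shows "kth_largest m c (\<lambda>r. a * v r) = a * kth_largest m c v"
proof (cases "a = 0")
  case True
  have "b \<le> kth_largest m c (\<lambda>r. 0) \<longleftrightarrow> b \<le> 0" for b
    using c by (cases "b \<le> 0") (simp_all add: kth_largest_ge_iff)
  then have "kth_largest m c (\<lambda>r. 0) = 0" by (meson order_antisym order_refl)
  then show ?thesis using True by simp
next
  case False
  with a have a: "0 < a" by simp
  have "b \<le> kth_largest m c (\<lambda>r. a * v r) \<longleftrightarrow> b \<le> a * kth_largest m c v" for b
  proof -
    have "b \<le> a * x \<longleftrightarrow> b / a \<le> x" for x using a by (simp add: divide_le_eq mult.commute)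
    then show ?thesis using c by (simp add: kth_largest_ge_iff)
  qed
  then show ?thesis by (meson order_antisym order_refl)
qed

lemma borel_measurable_kth_largest:
  assumes "\<And>r. (\<lambda>x. v x r) \<in> borel_measurable M"
  shows "(\<lambda>x. kth_largest m c (v x)) \<in> borel_measurable M"
proof -
  let ?F = "{I. I \<subseteq> {..<m} \<and> c \<le> card I}"
  have "finite ?F" by (rule finite_subset[of _ "Pow {..<m}"]) auto
  moreover have "(\<lambda>x. Min ((\<lambda>r. v x r) ` I)) \<in> borel_measurable M" if "I \<in> ?F" for I
    using that assms finite_subset[of I "{..<m}"] by (intro borel_measurable_Min) auto
  ultimately have "(\<lambda>x. Max ((\<lambda>I. Min ((\<lambda>r. v x r) ` I)) ` ?F)) \<in> borel_measurable M"
    by (intro borel_measurable_Max)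
  then show ?thesis by (simp add: kth_largest_def)
qed

section \<open>Hoeffding bounds for the number of successful repetitions\<close>

lemma map_card_Pi_pmf:
  "map_pmf (\<lambda>s. card {r. r < m \<and> P (s r)}) (Pi_pmf {..<m} d (\<lambda>_. Q))
    = binomial_pmf m (measure_pmf.prob Q {s. P s})"
proof -
  let ?p = "measure_pmf.prob Q {s. P s}"
  have b: "map_pmf P Q = bernoulli_pmf ?p"
  proof (rule pmf_eqI)
    fix b :: bool
    have t: "pmf (map_pmf P Q) True = ?p"
      by (auto simp: pmf_map vimage_def)
    have "pmf (map_pmf P Q) False = measure_pmf.prob Q (UNIV - {s. P s})"
      by (auto simp: pmf_map vimage_def intro!: arg_cong2[where f=measure])
    also have "\<dots> = 1 - ?p"
      by (subst measure_pmf.prob_compl[symmetric]) auto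
    finally show "pmf (map_pmf P Q) b = pmf (bernoulli_pmf ?p) b"
      using t by (cases b) auto
  qed
  have "binomial_pmf m ?p
      = map_pmf (\<lambda>f. card {r\<in>{..<m}. f r}) (Pi_pmf {..<m} (P d) (\<lambda>_. bernoulli_pmf ?p))"
    by (rule binomial_pmf_altdef') auto
  also have "\<dots> = map_pmf (\<lambda>f. card {r\<in>{..<m}. f r}) (map_pmf (\<lambda>s. P \<circ> s) (Pi_pmf {..<m} d (\<lambda>_. Q)))"
    unfolding b[symmetric] by (subst Pi_pmf_map[where dflt = d]) auto
  finally show ?thesis by (simp add: pmf.map_comp o_def)
qed

text \<open>Hoeffding's inequality for the binomial count. Replacing the exact success probability
  by its bound \<alpha> only moves it closer to \<gamma>, which weakens the exponent.\<close>

lemma prob_card_ge_le: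
  fixes m :: nat and \<gamma> :: real
  assumes m: "0 < m" and Q: "measure_pmf.prob Q {s. P s} \<le> \<alpha>" and \<gamma>: "\<alpha> \<le> \<gamma>"
  shows "measure_pmf.prob (Pi_pmf {..<m} d (\<lambda>_. Q)) {s. \<gamma> * m \<le> card {r. r < m \<and> P (s r)}}
    \<le> exp (- 2 * m * (\<gamma> - \<alpha>)\<^sup>2)"
proof -
  let ?p = "measure_pmf.prob Q {s. P s}"
  interpret binomial_distribution m ?p by unfold_locales auto
  have "measure_pmf.prob (Pi_pmf {..<m} d (\<lambda>_. Q)) {s. \<gamma> * m \<le> card {r. r < m \<and> P (s r)}}
      = measure_pmf.prob (binomial_pmf m ?p) {x. \<gamma> * m \<le> real x}"
    unfolding map_card_Pi_pmf[where P = P and d = d, symmetric] by (simp add: vimage_def)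
  also have "{x::nat. \<gamma> * m \<le> real x} = {x. ?p + (\<gamma> - ?p) \<le> x / m}"
    using m by (auto simp: field_simps)
  also have "measure_pmf.prob (binomial_pmf m ?p) \<dots> \<le> exp (- 2 * m * (\<gamma> - ?p)\<^sup>2)"
    using Q \<gamma> m by (intro prob_ge') auto
  also have "\<dots> \<le> exp (- 2 * m * (\<gamma> - \<alpha>)\<^sup>2)"
  proof -
    have "(\<gamma> - \<alpha>)\<^sup>2 \<le> (\<gamma> - ?p)\<^sup>2" using Q \<gamma> by (intro power_mono) auto
    then show ?thesis by (simp add: mult_left_mono)
  qed
  finally show ?thesis .
qed

lemma prob_card_less_le:
  fixes m :: nat and \<gamma> :: real
  assumes m: "0 < m" and Q: "\<beta> \<le> measure_pmf.prob Q {s. P s}" and \<gamma>: "\<gamma> \<le> \<beta>"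
  shows "measure_pmf.prob (Pi_pmf {..<m} d (\<lambda>_. Q)) {s. card {r. r < m \<and> P (s r)} < \<gamma> * m}
    \<le> exp (- 2 * m * (\<beta> - \<gamma>)\<^sup>2)"
proof -
  let ?p = "measure_pmf.prob Q {s. P s}"
  interpret binomial_distribution m ?p by unfold_locales auto
  have "measure_pmf.prob (Pi_pmf {..<m} d (\<lambda>_. Q)) {s. card {r. r < m \<and> P (s r)} < \<gamma> * m}
      = measure_pmf.prob (binomial_pmf m ?p) {x. real x < \<gamma> * m}"
    unfolding map_card_Pi_pmf[where P = P and d = d, symmetric] by (simp add: vimage_def)
  also have "\<dots> \<le> measure_pmf.prob (binomial_pmf m ?p) {x. x / m \<le> ?p - (?p - \<gamma>)}"
    using m by (intro measure_pmf.finite_measure_mono) (auto simp: field_simps)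
  also have "\<dots> \<le> exp (- 2 * m * (?p - \<gamma>)\<^sup>2)"
    using Q \<gamma> m by (intro prob_le') auto
  also have "\<dots> \<le> exp (- 2 * m * (\<beta> - \<gamma>)\<^sup>2)"
  proof -
    have "(\<beta> - \<gamma>)\<^sup>2 \<le> (?p - \<gamma>)\<^sup>2" using Q \<gamma> by (intro power_mono) auto
    then show ?thesis by (simp add: mult_left_mono)
  qed
  finally show ?thesis .
qed

definition apply_rows :: "nat \<Rightarrow> nat \<Rightarrow> (nat \<Rightarrow> nat \<Rightarrow> real) \<Rightarrow> (nat \<Rightarrow> real) \<Rightarrow> nat \<Rightarrow> real" where
  "apply_rows K n \<rho> x c = (if c < K then \<Sum>a<n. \<rho> c a * x a else 0)"

lemma apply_rows_scale: "apply_rows K n \<rho> (\<lambda>a. b * x a) = (\<lambda>c. b * apply_rows K n \<rho> x c)"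
  by (auto simp: apply_rows_def sum_distrib_left fun_eq_iff intro!: sum.cong)

text \<open>A constant gap between the tails of a statistic at \<open>2 t\<close> and at \<open>t / 2\<close> is amplified by taking
  an order statistic of independent repetitions. All columns share the same repetitions, since only
  a union bound over the columns is needed.\<close>

lemma sketching_family_amplify:
  fixes Q :: "'s pmf" and \<rho> :: "'s \<Rightarrow> nat \<Rightarrow> nat \<Rightarrow> real"
    and g :: "'s \<Rightarrow> (nat \<Rightarrow> real) \<Rightarrow> real"
  assumes p: "1 \<le> p" and d: "0 < d" and t: "0 < t" and ab: "\<alpha> < \<beta>"
    and g: "\<And>s. g s \<in> borel_measurable (PiM UNIV (\<lambda>_. borel))"
    and g_scale: "\<And>s a u. 0 \<le> a \<Longrightarrow> g s (\<lambda>c. a * u c) = a * g s u"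
    and upper: "\<And>x. lp_norm p (vec n x) \<le> 1 \<Longrightarrow>
      measure_pmf.prob Q {s. 2 * t \<le> g s (apply_rows K n (\<rho> s) x)} \<le> \<alpha>"
    and lower: "\<And>x. lp_norm p (vec n x) = 1 \<Longrightarrow>
      \<beta> \<le> measure_pmf.prob Q {s. t / 2 < g s (apply_rows K n (\<rho> s) x)}"
    and m: "0 < m" "real d * exp (- (real m * (\<beta> - \<alpha>)\<^sup>2 / 2)) \<le> 1 / 12"
    and n: "0 < n"
  shows "\<exists>S f. sketching_family n d 1 p (2 * (d * m * K)) 2 S f"
proof -
  \<comment> \<open>The threshold frequency is halfway between the two tails. Both Hoeffding bounds
    then see a deviation \<open>(\<beta> - \<alpha>) / 2\<close>, which explains the exponent in the
    hypothesis on \<open>m\<close>.\<close>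
  define \<gamma> where "\<gamma> = (\<alpha> + \<beta>) / 2"
  define c0 where "c0 = nat \<lceil>\<gamma> * m\<rceil>"
  define R where "R s x = apply_rows K n (\<rho> s) x" for s x
  have \<gamma>: "\<alpha> < \<gamma>" "\<gamma> < \<beta>" using ab by (auto simp: \<gamma>_def)
  \<comment> \<open>Applied to the zero vector and to a normalised vector, \<open>upper\<close> and
    \<open>lower\<close> give \<open>0 \<le> \<alpha>\<close> and \<open>\<beta> \<le> 1\<close>;
    this places \<open>c0\<close> between 1 and \<open>m\<close>.\<close>
  have "lp_norm p (vec n (\<lambda>_. 0)) \<le> 1"
    using lp_norm_zero[OF p, of n] by (simp add: zero_vec_def)
  from upper[OF this] have a0: "0 \<le> \<alpha>" by (rule order_trans[OF measure_nonneg])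
  obtain e where e: "lp_norm p (vec n e) = 1"
  proof -
    let ?x = "vec n (\<lambda>_. 1) :: real vec"
    have "lp_norm p ?x \<noteq> 0"
      using lp_norm_eq_0D[OF p, of ?x 0] n by auto
    then have "lp_norm p ((1 / lp_norm p ?x) \<cdot>\<^sub>v ?x) = 1"
      using lp_norm_nonneg[of p ?x] by (simp add: lp_norm_smult[OF p])
    moreover have "(1 / lp_norm p ?x) \<cdot>\<^sub>v ?x = vec n (\<lambda>_. 1 / lp_norm p ?x)" by auto
    ultimately show ?thesis using that by metis
  qed
  have b1: "\<beta> \<le> 1" using lower[OF e] by (rule order_trans) simp
  have c0: "1 \<le> c0" "c0 \<le> m"
  proof -
    have "0 < \<gamma> * m" using \<gamma> a0 m by simp
    then show "1 \<le> c0" by (simp add: c0_def Suc_le_eq)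
    have "\<gamma> * m \<le> 1 * real m" using \<gamma> b1 by (intro mult_right_mono) auto
    then show "c0 \<le> m" by (simp add: c0_def ceiling_le_iff)
  qed
  have c0_le: "c0 \<le> k \<longleftrightarrow> \<gamma> * m \<le> real k" for k
    by (simp add: c0_def nat_le_iff ceiling_le_iff)
  define Q' where "Q' = Pi_pmf {..<m} undefined (\<lambda>_. Q)"
  \<comment> \<open>Row \<open>i\<close> belongs to column \<open>i div K div m\<close>, repetition
    \<open>(i div K) mod m\<close> and inner row \<open>i mod K\<close>; \<open>idx\<close> is the
    inverse numbering.\<close>
  define \<rho>' where "\<rho>' s i A = (\<Sum>a<n. \<rho> (s ((i div K) mod m)) (i mod K) a * A $$ (a, i div K div m))"
    for s i and A :: "real mat"
  define idx where "idx j r c = (j * m + r) * K + c" for j r c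
  have idx: "idx j r c div K = j * m + r" "idx j r c mod K = c" if "c < K" for j r c
    using that by (auto simp: idx_def)
  have idx_less: "idx j r c < d * m * K" if "j < d" "r < m" "c < K" for j r c
  proof -
    have "j * m + r < d * m"
      using that mult_le_mono1[of "Suc j" d m] by simp
    then show ?thesis
      using that mult_le_mono1[of "Suc (j * m + r)" "d * m" K] by (simp add: idx_def)
  qed
  define G where "G s j u = kth_largest m c0 (\<lambda>r. g (s r) (\<lambda>c. if c < K then u (idx j r c) else 0))"
    for s j and u :: "nat \<Rightarrow> real"
  define h where "h s u = Max ((\<lambda>j. G s j u) ` {..<d}) / t" for s u
  show ?thesis
  proof (rule sketching_family_seeded[where Q = Q' and \<rho> = \<rho>' and h = h])
    fix s :: "nat \<Rightarrow> 's" and i and A B :: "real mat"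
    assume i: "i < d * m * K" and AB: "A \<in> carrier_mat n d" "B \<in> carrier_mat n d"
    have "i div K < d * m" using i by (simp add: less_mult_imp_div_less)
    then have "i div K div m < d" by (simp add: less_mult_imp_div_less)
    then show "\<rho>' s i (A + B) = \<rho>' s i A + \<rho>' s i B"
      using AB by (simp add: \<rho>'_def sum.distrib[symmetric] algebra_simps cong: sum.cong_simp)
  next
    fix s :: "nat \<Rightarrow> 's" and i a and A :: "real mat"
    assume i: "i < d * m * K" and A: "A \<in> carrier_mat n d"
    have "i div K < d * m" using i by (simp add: less_mult_imp_div_less)
    then have "i div K div m < d" by (simp add: less_mult_imp_div_less)
    then show "\<rho>' s i (a \<cdot>\<^sub>m A) = a * \<rho>' s i A"
      using A by (simp add: \<rho>'_def sum_distrib_left algebra_simps cong: sum.cong_simp)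
  next
    fix s :: "nat \<Rightarrow> 's"
    have "g (s r) (\<lambda>c. if c < K then 0 else 0) = 0" for r
      using g_scale[of 0 "s r" "\<lambda>_. 0"] by simp
    then have "G s j (\<lambda>_. 0) = 0" for j
      using kth_largest_scale[OF c0, of 0 "\<lambda>_. 0"] by (simp add: G_def)
    moreover have "{..<d} \<noteq> {}" using d by auto
    ultimately show "h s (\<lambda>_. 0) = 0" by (simp add: h_def image_constant_conv)
  next
    fix s :: "nat \<Rightarrow> 's"
    have "(\<lambda>u. (\<lambda>c. if c < K then u (idx j r c) else 0))
        \<in> measurable (PiM UNIV (\<lambda>_. borel)) (PiM UNIV (\<lambda>_. borel :: real measure))" for j r
      by (rule measurable_PiM_single') auto
    then have "(\<lambda>u. g (s r) (\<lambda>c. if c < K then u (idx j r c) else 0))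
        \<in> borel_measurable (PiM UNIV (\<lambda>_. borel))" for j r
      by (rule measurable_compose) (rule g)
    then have "(\<lambda>u. G s j u) \<in> borel_measurable (PiM UNIV (\<lambda>_. borel))" for j
      unfolding G_def by (intro borel_measurable_kth_largest)
    then have "(\<lambda>u. Max ((\<lambda>j. G s j u) ` {..<d})) \<in> borel_measurable (PiM UNIV (\<lambda>_. borel))"
      by (intro borel_measurable_Max) auto
    then show "h s \<in> borel_measurable (PiM UNIV (\<lambda>_. borel))"
      unfolding h_def by (intro borel_measurable_divide borel_measurable_const)
  next
    fix A :: "real mat" assume A: "A \<in> carrier_mat n d"
    define x where "x j = (\<lambda>a. A $$ (a, j))" for j
    define N where "N = op_norm 1 p A"
    have col: "col A j = vec n (x j)" for j
      using A by (auto simp: x_def col_def)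
    have N: "N = Max ((\<lambda>j. lp_norm p (vec n (x j))) ` {..<d})"
      using op_norm_one[OF p A d] by (simp add: N_def col)
    have N_ge: "lp_norm p (vec n (x j)) \<le> N" if "j < d" for j
      unfolding N using that by (intro Max_ge) auto
    obtain j0 where j0: "j0 < d" "lp_norm p (vec n (x j0)) = N"
      using Max_in[of "(\<lambda>j. lp_norm p (vec n (x j))) ` {..<d}"] d N by fastforce
    have N0: "0 \<le> N" using j0 lp_norm_nonneg[of p "vec n (x j0)"] by simp
    define H where "H s j = kth_largest m c0 (\<lambda>r. g (s r) (R (s r) (x j)))" for s j
    have GH: "G s j (\<lambda>i. if i < d * m * K then \<rho>' s i A else 0) = H s j" if j: "j < d" for s j
    proof -
      have "(\<lambda>c. if c < K then if idx j r c < d * m * K then \<rho>' s (idx j r c) A else 0 else 0)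
          = R (s r) (x j)" if "r < m" for r
        using that j m
        by (auto simp: fun_eq_iff R_def apply_rows_def x_def idx idx_less \<rho>'_def)
      \<comment> \<open>The rows are known to agree only for \<open>r < m\<close>; the
        characterisation of the order statistic by counting looks at no others.\<close>
      then have "{r. r < m \<and> b \<le> g (s r) (\<lambda>c. if c < K then if idx j r c < d * m * K then \<rho>' s (idx j r c) A else 0 else 0)}
          = {r. r < m \<and> b \<le> g (s r) (R (s r) (x j))}" for b
        by (metis (no_types, lifting))
      then have "b \<le> G s j (\<lambda>i. if i < d * m * K then \<rho>' s i A else 0) \<longleftrightarrow> b \<le> H s j" for b
        by (simp add: G_def H_def kth_largest_ge_iff[OF c0])
      then show ?thesis by (meson order_antisym order_refl)
    qed
    have h_eq: "h s (\<lambda>i. if i < d * m * K then \<rho>' s i A else 0) = Max (H s ` {..<d}) / t" for s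
      unfolding h_def using GH by (simp cong: image_cong_simp)
    have scale: "g s (R s (x j)) = N * g s (R s (\<lambda>a. x j a / N))" if "N \<noteq> 0" for s j
    proof -
      have "R s (x j) = (\<lambda>c. N * R s (\<lambda>a. x j a / N) c)"
        using that unfolding R_def by (subst apply_rows_scale[symmetric]) simp
      then show ?thesis using g_scale[OF N0] by simp
    qed
    have norm: "lp_norm p (vec n (\<lambda>a. x j a / N)) = lp_norm p (vec n (x j)) / N" for j
    proof -
      have "vec n (\<lambda>a. x j a / N) = (1 / N) \<cdot>\<^sub>v vec n (x j)" by auto
      then show ?thesis using N0 by (simp add: lp_norm_smult[OF p])
    qed
    show "5 / 6 \<le> measure_pmf.prob Q' {s. good_estimate 2 (op_norm 1 p A)
        (h s (\<lambda>i. if i < d * m * K then \<rho>' s i A else 0))}"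
    proof (cases "N = 0")
      case True
      have "x j a = 0" if "j < d" "a < n" for j a
      proof -
        have "lp_norm p (vec n (x j)) = 0"
          using N_ge[OF that(1)] True lp_norm_nonneg[of p "vec n (x j)"] by simp
        then show ?thesis using lp_norm_eq_0D[OF p, of "vec n (x j)" a] that by simp
      qed
      then have "R s (x j) = (\<lambda>c. 0 * R s (x j) c)" if "j < d" for s j
        using that by (auto simp: R_def apply_rows_def fun_eq_iff)
      then have "g s (R s (x j)) = 0" if "j < d" for s j
        using g_scale[of 0 s "R s (x j)"] that by simp
      then have "H s j = 0" if "j < d" for s j
        using kth_largest_scale[OF c0, of 0 "\<lambda>_. 0"] that by (simp add: H_def)
      then have "Max (H s ` {..<d}) = 0" for s
        using d by (intro Max_eqI) force+
      then show ?thesis using True by (simp add: h_eq good_estimate_def flip: N_def)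
    next
      case False
      with N0 have N0: "0 < N" by simp
      define \<epsilon> where "\<epsilon> = exp (- (real m * (\<beta> - \<alpha>)\<^sup>2 / 2))"
      have up: "measure_pmf.prob Q' {s. 2 * t * N \<le> H s j} \<le> \<epsilon>" if j: "j < d" for j
      proof -
        \<comment> \<open>Each column is divided by the common \<open>N\<close> and not by its own
          norm, so its new norm may be smaller than 1; this is the reason for the inequality in
          \<open>upper\<close>.\<close>
        let ?P = "\<lambda>s. 2 * t \<le> g s (apply_rows K n (\<rho> s) (\<lambda>a. x j a / N))"
        have "lp_norm p (vec n (\<lambda>a. x j a / N)) \<le> 1"
          using N_ge[OF j] N0 by (simp add: norm divide_le_eq)
        from prob_card_ge_le[OF m(1) upper[OF this], of \<gamma> undefined] \<gamma>
        have "measure_pmf.prob Q' {s. \<gamma> * m \<le> card {r. r < m \<and> ?P (s r)}} \<le> exp (- 2 * m * (\<gamma> - \<alpha>)\<^sup>2)"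
          by (simp add: Q'_def)
        also have "(\<gamma> - \<alpha>)\<^sup>2 = (\<beta> - \<alpha>)\<^sup>2 / 4"
          by (simp add: \<gamma>_def power2_eq_square field_simps)
        also have "exp (- 2 * m * ((\<beta> - \<alpha>)\<^sup>2 / 4)) = \<epsilon>" by (simp add: \<epsilon>_def)
        also have "{s. \<gamma> * m \<le> card {r. r < m \<and> ?P (s r)}} = {s. 2 * t * N \<le> H s j}"
        proof -
          have "2 * t * N \<le> g s (R s (x j)) \<longleftrightarrow> ?P s" for s
            using N0 scale[of s j] by (simp add: R_def mult.commute[of _ N])
          then show ?thesis by (simp add: H_def kth_largest_ge_iff[OF c0] c0_le)
        qed
        finally show ?thesis .
      qed
      \<comment> \<open>Only a column attaining the maximum has to pass the lower threshold.\<close>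
      have low: "measure_pmf.prob Q' {s. \<not> t / 2 * N < H s j0} \<le> \<epsilon>"
      proof -
        let ?P = "\<lambda>s. t / 2 < g s (apply_rows K n (\<rho> s) (\<lambda>a. x j0 a / N))"
        have "lp_norm p (vec n (\<lambda>a. x j0 a / N)) = 1"
          using j0 N0 by (simp add: norm)
        from prob_card_less_le[OF m(1) lower[OF this], of \<gamma> undefined] \<gamma>
        have "measure_pmf.prob Q' {s. card {r. r < m \<and> ?P (s r)} < \<gamma> * m} \<le> exp (- 2 * m * (\<beta> - \<gamma>)\<^sup>2)"
          by (simp add: Q'_def)
        also have "(\<beta> - \<gamma>)\<^sup>2 = (\<beta> - \<alpha>)\<^sup>2 / 4"
          by (simp add: \<gamma>_def power2_eq_square field_simps)
        also have "exp (- 2 * m * ((\<beta> - \<alpha>)\<^sup>2 / 4)) = \<epsilon>" by (simp add: \<epsilon>_def)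
        also have "{s. card {r. r < m \<and> ?P (s r)} < \<gamma> * m} = {s. \<not> t / 2 * N < H s j0}"
        proof -
          have "t / 2 * N < g s (R s (x j0)) \<longleftrightarrow> ?P s" for s
            using N0 scale[of s j0] by (simp add: R_def mult.commute[of _ N] del: times_divide_eq_left)
          then show ?thesis
            by (simp add: H_def kth_largest_gt_iff[OF c0] c0_le not_le del: times_divide_eq_left)
        qed
        finally show ?thesis .
      qed
      let ?bad = "(\<Union>j<d. {s. 2 * t * N \<le> H s j}) \<union> {s. \<not> t / 2 * N < H s j0}"
      have "measure_pmf.prob Q' ?bad \<le> (\<Sum>j<d. \<epsilon>) + \<epsilon>"
      proof -
        have "measure_pmf.prob Q' ?bad \<le> measure_pmf.prob Q' (\<Union>j<d. {s. 2 * t * N \<le> H s j})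
            + measure_pmf.prob Q' {s. \<not> t / 2 * N < H s j0}"
          by (intro measure_Un_le) auto
        also have "measure_pmf.prob Q' (\<Union>j<d. {s. 2 * t * N \<le> H s j})
            \<le> (\<Sum>j<d. measure_pmf.prob Q' {s. 2 * t * N \<le> H s j})"
          by (intro measure_pmf.finite_measure_subadditive_finite) auto
        also have "\<dots> \<le> (\<Sum>j<d. \<epsilon>)" using up by (intro sum_mono) auto
        finally show ?thesis using low by simp
      qed
      \<comment> \<open>The \<open>d\<close> upper tails take 1 / 12 of the failure probability, the
        one lower tail at most another 1 / 12.\<close>
      also have "\<dots> \<le> 1 / 6"
      proof -
        have "1 * \<epsilon> \<le> real d * \<epsilon>" using d by (intro mult_right_mono) (auto simp: \<epsilon>_def)
        then show ?thesis using m by (simp flip: \<epsilon>_def)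
      qed
      finally have "5 / 6 \<le> measure_pmf.prob Q' (UNIV - ?bad)"
        using measure_pmf.prob_compl[of ?bad Q'] by simp
      also have "\<dots> \<le> measure_pmf.prob Q' {s. good_estimate 2 (op_norm 1 p A)
        (h s (\<lambda>i. if i < d * m * K then \<rho>' s i A else 0))}"
      proof (intro measure_pmf.finite_measure_mono subsetI)
        fix s assume s: "s \<in> UNIV - ?bad"
        have "Max (H s ` {..<d}) < 2 * t * N"
          using s d by (subst Max_less_iff) (auto simp: not_le)
        moreover have "t / 2 * N < Max (H s ` {..<d})"
          using s j0 by (subst Max_gr_iff) auto
        ultimately have "good_estimate 2 N (Max (H s ` {..<d}) / t)"
          using N0 t by (auto simp: good_estimate_def field_simps)
        then show "s \<in> {s. good_estimate 2 (op_norm 1 p A)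
          (h s (\<lambda>i. if i < d * m * K then \<rho>' s i A else 0))}"
          by (simp add: h_eq N_def)
      qed simp
      finally show ?thesis .
    qed
  qed
qed

subsection \<open>Moments of random signed sums\<close>

lemma integrable_pmf_bounded:
  fixes f :: "'a \<Rightarrow> real"
  assumes "\<And>x. \<bar>f x\<bar> \<le> C"
  shows "integrable (measure_pmf Q) f"
  using assms by (intro measure_pmf.integrable_const_bound[where B = C]) auto

lemma expectation_bind_pmf_bounded:
  fixes f :: "'b \<Rightarrow> real"
  assumes "\<And>x. \<bar>f x\<bar> \<le> C"
  shows "measure_pmf.expectation (bind_pmf Q N) f
    = measure_pmf.expectation Q (\<lambda>x. measure_pmf.expectation (N x) f)"
  unfolding measure_pmf_bind
  using assms measurable_measure_pmf[of N]
  by (intro integral_bind[where K = "count_space UNIV" and B = C and B' = 1])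
    (auto simp: measure_pmf.finite_measure)

lemma expectation_Pi_pmf_insert_bounded:
  fixes F :: "('a \<Rightarrow> 'b) \<Rightarrow> real"
  assumes "finite A" "a \<notin> A" "\<And>z. \<bar>F z\<bar> \<le> C"
  shows "measure_pmf.expectation (Pi_pmf (insert a A) d Q) F
    = measure_pmf.expectation (Q a) (\<lambda>y. measure_pmf.expectation (Pi_pmf A d Q) (\<lambda>z. F (z(a := y))))"
  using assms
  by (simp add: Pi_pmf_insert' expectation_bind_pmf_bounded[where C = C])

lemma expectation_pair_pmf_bounded:
  fixes F :: "'a \<times> 'b \<Rightarrow> real"
  assumes "\<And>z. \<bar>F z\<bar> \<le> C"
  shows "measure_pmf.expectation (pair_pmf Q R) F
    = measure_pmf.expectation Q (\<lambda>a. measure_pmf.expectation R (\<lambda>b. F (a, b)))"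
  using assms unfolding pair_pmf_def
  by (simp add: expectation_bind_pmf_bounded[where C = C])

lemma expectation_Pi_pmf_component:
  fixes f :: "'b \<Rightarrow> real"
  assumes "finite A" "i \<in> A"
  shows "measure_pmf.expectation (Pi_pmf A d Q) (\<lambda>z. f (z i)) = measure_pmf.expectation (Q i) f"
proof -
  have "Q i = map_pmf (\<lambda>z. z i) (Pi_pmf A d Q)" using assms by (simp add: Pi_pmf_component)
  then show ?thesis by simp
qed

lemma prob_Pi_pmf_component:
  assumes "finite A" "i \<in> A"
  shows "measure_pmf.prob (Pi_pmf A d Q) {z. P (z i)} = measure_pmf.prob (Q i) {y. P y}"
proof -
  have "Q i = map_pmf (\<lambda>z. z i) (Pi_pmf A d Q)" using assms by (simp add: Pi_pmf_component)
  then show ?thesis by (simp add: vimage_def)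
qed

lemma abs_sum_component_le:
  fixes f :: "'a \<Rightarrow> 'b \<Rightarrow> real"
  assumes "\<And>i y. i \<in> A \<Longrightarrow> \<bar>f i y\<bar> \<le> C"
  shows "\<bar>\<Sum>i\<in>A. f i (z i)\<bar> \<le> real (card A) * C"
proof -
  have "\<bar>\<Sum>i\<in>A. f i (z i)\<bar> \<le> (\<Sum>i\<in>A. \<bar>f i (z i)\<bar>)" by (rule sum_abs)
  also have "\<dots> \<le> real (card A) * C" using assms by (intro sum_bounded_above) auto
  finally show ?thesis .
qed

text \<open>Variances of independent centred summands add. Integrating out one coordinate leaves a
  cross term containing the mean of the remaining sum, which is 0.\<close>

lemma second_moment_Pi_pmf:
  fixes f :: "'a \<Rightarrow> 'b \<Rightarrow> real"
  assumes "finite A" and "\<And>i y. i \<in> A \<Longrightarrow> \<bar>f i y\<bar> \<le> C"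
    and "\<And>i. i \<in> A \<Longrightarrow> measure_pmf.expectation (Q i) (f i) = 0"
  shows "measure_pmf.expectation (Pi_pmf A d Q) (\<lambda>z. (\<Sum>i\<in>A. f i (z i))\<^sup>2)
    = (\<Sum>i\<in>A. measure_pmf.expectation (Q i) (\<lambda>y. (f i y)\<^sup>2))"
  using assms
proof (induction A rule: finite_induct)
  case (insert a A)
  let ?S = "\<lambda>z. \<Sum>i\<in>A. f i (z i)"
  let ?E = "measure_pmf.expectation (Pi_pmf A d Q)"
  have S: "\<bar>?S z\<bar> \<le> card A * C" for z
    using insert.prems by (intro abs_sum_component_le) auto
  have SS: "\<bar>(?S z)\<^sup>2\<bar> \<le> (card A * C)\<^sup>2" for z
    using S[of z] by (simp add: abs_le_square_iff[symmetric] order_trans[OF _ abs_ge_self])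
  have all: "\<bar>(\<Sum>i\<in>insert a A. f i (z i))\<^sup>2\<bar> \<le> (card (insert a A) * C)\<^sup>2" for z
  proof -
    have "\<bar>\<Sum>i\<in>insert a A. f i (z i)\<bar> \<le> card (insert a A) * C"
      using insert.prems by (intro abs_sum_component_le) auto
    then show ?thesis by (simp add: abs_le_square_iff[symmetric] order_trans[OF _ abs_ge_self])
  qed
  have fC: "\<bar>f a y\<bar> \<le> C" for y using insert.prems by simp
  have fC2: "\<bar>(f a y)\<^sup>2\<bar> \<le> C\<^sup>2" for y
    using fC[of y] by (simp add: abs_le_square_iff[symmetric] order_trans[OF _ abs_ge_self])
  have intS: "integrable (Pi_pmf A d Q) ?S" by (rule integrable_pmf_bounded) (rule S)
  have intSS: "integrable (Pi_pmf A d Q) (\<lambda>z. (?S z)\<^sup>2)" by (rule integrable_pmf_bounded) (rule SS)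
  have intf: "integrable (Q a) (\<lambda>y. (f a y)\<^sup>2)" by (rule integrable_pmf_bounded) (rule fC2)
  have ES: "?E ?S = 0"
    using insert.prems insert.hyps
    by (subst Bochner_Integration.integral_sum)
      (auto simp: expectation_Pi_pmf_component intro!: integrable_pmf_bounded)
  have upd: "(\<Sum>i\<in>insert a A. f i ((z(a := y)) i)) = f a y + ?S z" for z y
    using insert.hyps by (auto intro!: sum.cong)
  have "measure_pmf.expectation (Pi_pmf (insert a A) d Q) (\<lambda>z. (\<Sum>i\<in>insert a A. f i (z i))\<^sup>2)
      = measure_pmf.expectation (Q a) (\<lambda>y. ?E (\<lambda>z. (f a y + ?S z)\<^sup>2))"
    using expectation_Pi_pmf_insert_bounded[where F = "\<lambda>z. (\<Sum>i\<in>insert a A. f i (z i))\<^sup>2", OF insert.hyps all, of d Q]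
    unfolding upd .
  also have "\<dots> = measure_pmf.expectation (Q a) (\<lambda>y. (f a y)\<^sup>2 + ?E (\<lambda>z. (?S z)\<^sup>2))"
  proof (rule arg_cong[where f = "measure_pmf.expectation (Q a)"], rule ext)
    fix y
    have "?E (\<lambda>z. (f a y + ?S z)\<^sup>2) = ?E (\<lambda>z. (f a y)\<^sup>2 + 2 * f a y * ?S z + (?S z)\<^sup>2)"
      by (simp add: power2_sum algebra_simps)
    also have "\<dots> = (f a y)\<^sup>2 + 2 * f a y * ?E ?S + ?E (\<lambda>z. (?S z)\<^sup>2)"
      using intS intSS by simp
    finally show "?E (\<lambda>z. (f a y + ?S z)\<^sup>2) = (f a y)\<^sup>2 + ?E (\<lambda>z. (?S z)\<^sup>2)"
      using ES by simp
  qed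
  also have "\<dots> = measure_pmf.expectation (Q a) (\<lambda>y. (f a y)\<^sup>2) + ?E (\<lambda>z. (?S z)\<^sup>2)"
    using intf by simp
  finally show ?case using insert by simp
qed simp

text \<open>Chebyshev's inequality without centring: \<open>F\<close> may carry any shift, and the
  Cantelli bounds below rely on that freedom.\<close>

lemma prob_abs_ge_le:
  fixes F :: "'a \<Rightarrow> real"
  assumes "\<And>x. \<bar>F x\<bar> \<le> C" "0 < a"
  shows "measure_pmf.prob Q {x. a \<le> \<bar>F x\<bar>} \<le> measure_pmf.expectation Q (\<lambda>x. (F x)\<^sup>2) / a\<^sup>2"
proof -
  have "\<bar>(F x)\<^sup>2\<bar> \<le> C\<^sup>2" for x
    using assms(1)[of x] by (simp add: abs_le_square_iff[symmetric] order_trans[OF _ abs_ge_self])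
  then have "integrable Q (\<lambda>x. (F x)\<^sup>2)" by (intro integrable_pmf_bounded)
  then show ?thesis
    using measure_pmf.second_moment_method[of F Q a] assms by simp
qed

section \<open>Sums with random signs\<close>

abbreviation coin :: "bool pmf" where "coin \<equiv> bernoulli_pmf (1 / 2)"

definition coin_sgn :: "bool \<Rightarrow> real" where
  "coin_sgn b = (if b then 1 else - 1)"

lemma coin_sgn_simps [simp]: "coin_sgn b * coin_sgn b = 1" "(coin_sgn b)\<^sup>2 = 1" "\<bar>coin_sgn b\<bar> = 1"
  by (auto simp: coin_sgn_def)

lemma expectation_coin_sgn: "measure_pmf.expectation coin (\<lambda>b. coin_sgn b * c) = 0"
  by (simp add: coin_sgn_def)

lemma expectation_coin_affine:
  "measure_pmf.expectation coin (\<lambda>b. coin_sgn b * c + e) = e"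
  by (simp add: coin_sgn_def add_divide_distrib diff_divide_distrib)

text \<open>Khintchine's inequality for the exponent 4. After averaging over the new sign only its
  even powers in the binomial expansion remain.\<close>

lemma fourth_moment_coin:
  fixes x :: "'a \<Rightarrow> real"
  assumes "finite A"
  shows "measure_pmf.expectation (Pi_pmf A d (\<lambda>_. coin)) (\<lambda>z. (\<Sum>i\<in>A. coin_sgn (z i) * x i) ^ 4)
    \<le> 3 * (\<Sum>i\<in>A. (x i)\<^sup>2)\<^sup>2"
  using assms
proof (induction A rule: finite_induct)
  case (insert a A)
  let ?S = "\<lambda>z. \<Sum>i\<in>A. coin_sgn (z i) * x i"
  let ?E = "measure_pmf.expectation (Pi_pmf A d (\<lambda>_. coin))"
  define C where "C = (\<Sum>i\<in>insert a A. \<bar>x i\<bar>)"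
  have bnd: "\<bar>\<Sum>i\<in>B. coin_sgn (z i) * x i\<bar> \<le> C" if "B \<subseteq> insert a A" for z B
  proof -
    have "\<bar>\<Sum>i\<in>B. coin_sgn (z i) * x i\<bar> \<le> (\<Sum>i\<in>B. \<bar>coin_sgn (z i) * x i\<bar>)" by (rule sum_abs)
    also have "\<dots> \<le> C"
      unfolding C_def abs_mult coin_sgn_simps mult_1 using that insert.hyps by (intro sum_mono2) auto
    finally show ?thesis .
  qed
  have pow: "\<bar>r ^ k\<bar> \<le> C ^ k" if "\<bar>r\<bar> \<le> C" for r k
    using that by (simp add: power_abs power_mono)
  have S: "\<bar>?S z ^ k\<bar> \<le> C ^ k" for z k by (intro pow bnd) auto
  have all: "\<bar>(\<Sum>i\<in>insert a A. coin_sgn (z i) * x i) ^ 4\<bar> \<le> C ^ 4" for z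
    by (intro pow bnd) auto
  have int: "integrable (Pi_pmf A d (\<lambda>_. coin)) (\<lambda>z. ?S z ^ k)" for k
    by (rule integrable_pmf_bounded) (rule S)
  have upd: "(\<Sum>i\<in>insert a A. coin_sgn ((z(a := y)) i) * x i) = coin_sgn y * x a + ?S z" for z y
    using insert.hyps by (auto intro!: sum.cong)
  have ES2: "?E (\<lambda>z. ?S z ^ 2) = (\<Sum>i\<in>A. (x i)\<^sup>2)"
  proof -
    have "?E (\<lambda>z. ?S z ^ 2) = (\<Sum>i\<in>A. measure_pmf.expectation coin (\<lambda>y. (coin_sgn y * x i)\<^sup>2))"
    proof (rule second_moment_Pi_pmf[where C = C])
      fix i y assume "i \<in> A"
      then show "\<bar>coin_sgn y * x i\<bar> \<le> C"
        unfolding C_def abs_mult using insert.hyps(1) member_le_sum[of i "insert a A" "\<lambda>i. \<bar>x i\<bar>"] by simp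
    qed (use insert.hyps expectation_coin_sgn in auto)
    then show ?thesis by (simp add: power_mult_distrib)
  qed
  have "measure_pmf.expectation (Pi_pmf (insert a A) d (\<lambda>_. coin)) (\<lambda>z. (\<Sum>i\<in>insert a A. coin_sgn (z i) * x i) ^ 4)
      = measure_pmf.expectation coin (\<lambda>y. ?E (\<lambda>z. (coin_sgn y * x a + ?S z) ^ 4))"
    using expectation_Pi_pmf_insert_bounded[where F = "\<lambda>z. (\<Sum>i\<in>insert a A. coin_sgn (z i) * x i) ^ 4", OF insert.hyps all, of d "\<lambda>_. coin"]
    unfolding upd .
  also have "\<dots> = measure_pmf.expectation coin (\<lambda>y. coin_sgn y * (4 * x a ^ 3 * ?E ?S + 4 * x a * ?E (\<lambda>z. ?S z ^ 3))
      + (x a ^ 4 + 6 * (x a)\<^sup>2 * ?E (\<lambda>z. ?S z ^ 2) + ?E (\<lambda>z. ?S z ^ 4)))"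
  proof (rule arg_cong[where f = "measure_pmf.expectation coin"], rule ext)
    fix y
    have "(coin_sgn y * x a + s) ^ 4 = x a ^ 4 + 4 * (coin_sgn y * x a ^ 3) * s + 6 * (x a)\<^sup>2 * s ^ 2
        + 4 * (coin_sgn y * x a) * s ^ 3 + s ^ 4" for s
      by (simp add: coin_sgn_def power4_eq_xxxx power3_eq_cube power2_eq_square algebra_simps)
    then have "?E (\<lambda>z. (coin_sgn y * x a + ?S z) ^ 4)
        = x a ^ 4 + 4 * (coin_sgn y * x a ^ 3) * ?E ?S + 6 * (x a)\<^sup>2 * ?E (\<lambda>z. ?S z ^ 2)
        + 4 * (coin_sgn y * x a) * ?E (\<lambda>z. ?S z ^ 3) + ?E (\<lambda>z. ?S z ^ 4)"
      using int[of 1] int[of 2] int[of 3] int[of 4] by simp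
    then show "?E (\<lambda>z. (coin_sgn y * x a + ?S z) ^ 4)
      = coin_sgn y * (4 * x a ^ 3 * ?E ?S + 4 * x a * ?E (\<lambda>z. ?S z ^ 3))
      + (x a ^ 4 + 6 * (x a)\<^sup>2 * ?E (\<lambda>z. ?S z ^ 2) + ?E (\<lambda>z. ?S z ^ 4))"
      by (simp add: algebra_simps)
  qed
  also have "\<dots> = x a ^ 4 + 6 * (x a)\<^sup>2 * ?E (\<lambda>z. ?S z ^ 2) + ?E (\<lambda>z. ?S z ^ 4)"
    by (rule expectation_coin_affine)
  also have "\<dots> \<le> x a ^ 4 + 6 * (x a)\<^sup>2 * (\<Sum>i\<in>A. (x i)\<^sup>2) + 3 * (\<Sum>i\<in>A. (x i)\<^sup>2)\<^sup>2"
    using insert.IH ES2 by simp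
  \<comment> \<open>The right-hand side is larger by exactly \<open>2 * x a ^ 4\<close>.\<close>
  also have "\<dots> \<le> 3 * ((x a)\<^sup>2 + (\<Sum>i\<in>A. (x i)\<^sup>2))\<^sup>2"
    using zero_le_even_power[of 4 "x a"]
    by (simp add: power2_eq_square power4_eq_xxxx algebra_simps)
  finally show ?case using insert.hyps by simp
qed simp

text \<open>Both tail bounds are one-sided Chebyshev (Cantelli) inequalities for the square of the
  random sum, with the shift optimised; the two-sided inequality would leave no gap.\<close>

lemma coin_sum_tails:
  fixes x :: "nat \<Rightarrow> real" and n :: nat
  defines "Q \<equiv> Pi_pmf {..<n} undefined (\<lambda>_. coin)"
  shows "(\<Sum>i<n. (x i)\<^sup>2) \<le> 1 \<Longrightarrow>
      measure_pmf.prob Q {z. 2 \<le> \<bar>\<Sum>i<n. coin_sgn (z i) * x i\<bar>} \<le> 2 / 11"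
    and "(\<Sum>i<n. (x i)\<^sup>2) = 1 \<Longrightarrow>
      9 / 41 \<le> measure_pmf.prob Q {z. 1 / 2 < \<bar>\<Sum>i<n. coin_sgn (z i) * x i\<bar>}"
proof -
  define s where "s = (\<Sum>i<n. (x i)\<^sup>2)"
  define Z where "Z z = (\<Sum>i<n. coin_sgn (z i) * x i)" for z
  define C where "C = (\<Sum>i<n. \<bar>x i\<bar>)"
  have Z: "\<bar>Z z\<bar> \<le> C" for z
  proof -
    have "\<bar>Z z\<bar> \<le> (\<Sum>i<n. \<bar>coin_sgn (z i) * x i\<bar>)" unfolding Z_def by (rule sum_abs)
    then show ?thesis by (simp add: abs_mult C_def)
  qed
  have Zk: "\<bar>Z z ^ k\<bar> \<le> C ^ k" for z k
    using Z[of z] by (simp add: power_abs power_mono)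
  have int: "integrable Q (\<lambda>z. Z z ^ k)" for k
    by (rule integrable_pmf_bounded) (rule Zk)
  let ?E = "measure_pmf.expectation Q"
  have E2: "?E (\<lambda>z. Z z ^ 2) = s"
  proof -
    have "?E (\<lambda>z. Z z ^ 2) = (\<Sum>i<n. measure_pmf.expectation coin (\<lambda>y. (coin_sgn y * x i)\<^sup>2))"
      unfolding Q_def Z_def
    proof (rule second_moment_Pi_pmf[where C = C])
      fix i y assume "i \<in> {..<n}"
      then show "\<bar>coin_sgn y * x i\<bar> \<le> C"
        unfolding C_def abs_mult using member_le_sum[of i "{..<n}" "\<lambda>i. \<bar>x i\<bar>"] by simp
    qed (use expectation_coin_sgn in auto)
    then show ?thesis by (simp add: power_mult_distrib s_def)
  qed
  have E4: "?E (\<lambda>z. Z z ^ 4) \<le> 3 * s\<^sup>2"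
    unfolding Q_def Z_def s_def by (rule fourth_moment_coin) simp
  have s0: "0 \<le> s" by (simp add: s_def sum_nonneg)
  have E: "?E (\<lambda>z. (Z z ^ 2 - c)\<^sup>2) = ?E (\<lambda>z. Z z ^ 4) - 2 * c * s + c\<^sup>2" for c
  proof -
    have "(r ^ 2 - c)\<^sup>2 = r ^ 4 - 2 * c * r ^ 2 + c\<^sup>2" for r :: real
      by (simp add: power2_eq_square power4_eq_xxxx algebra_simps)
    then have "?E (\<lambda>z. (Z z ^ 2 - c)\<^sup>2) = ?E (\<lambda>z. Z z ^ 4 - 2 * c * Z z ^ 2 + c\<^sup>2)" by simp
    also have "\<dots> = ?E (\<lambda>z. Z z ^ 4) - 2 * c * ?E (\<lambda>z. Z z ^ 2) + c\<^sup>2"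
      using int[of 2] int[of 4] by simp
    finally show ?thesis using E2 by simp
  qed
  have bnd: "\<bar>Z z ^ 2 - c\<bar> \<le> C\<^sup>2 + \<bar>c\<bar>" for z c
    using Zk[of z 2] by linarith
  have markov: "measure_pmf.prob Q {z. b \<le> \<bar>Z z ^ 2 - c\<bar>} \<le> (3 * s\<^sup>2 - 2 * c * s + c\<^sup>2) / b\<^sup>2"
    if "0 < b" for b c
  proof -
    have "measure_pmf.prob Q {z. b \<le> \<bar>Z z ^ 2 - c\<bar>} \<le> ?E (\<lambda>z. (Z z ^ 2 - c)\<^sup>2) / b\<^sup>2"
      by (rule prob_abs_ge_le[OF bnd that])
    also have "\<dots> \<le> (3 * s\<^sup>2 - 2 * c * s + c\<^sup>2) / b\<^sup>2"
      using E4 unfolding E by (intro divide_right_mono) auto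
    finally show ?thesis .
  qed
  show "measure_pmf.prob Q {z. 2 \<le> \<bar>\<Sum>i<n. coin_sgn (z i) * x i\<bar>} \<le> 2 / 11"
    if "(\<Sum>i<n. (x i)\<^sup>2) \<le> 1"
  proof -
    have s1: "s \<le> 1" using that by (simp add: s_def)
    \<comment> \<open>At \<open>s = 1\<close> the square has mean 1 and variance at most 2. For the
      deviation 3 the optimal Cantelli shift moves the centre to \<open>1 - 2 / 3\<close>, with
      bound \<open>2 / (2 + 9)\<close>.\<close>
    have "measure_pmf.prob Q {z. 2 \<le> \<bar>Z z\<bar>} \<le> measure_pmf.prob Q {z. 11 / 3 \<le> \<bar>Z z ^ 2 - 1 / 3\<bar>}"
    proof (intro measure_pmf.finite_measure_mono subsetI)
      fix z assume "z \<in> {z. 2 \<le> \<bar>Z z\<bar>}"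
      then have "2\<^sup>2 \<le> \<bar>Z z\<bar>\<^sup>2" by (intro power_mono) auto
      then show "z \<in> {z. 11 / 3 \<le> \<bar>Z z ^ 2 - 1 / 3\<bar>}" by simp
    qed simp
    also have "\<dots> \<le> (3 * s\<^sup>2 - 2 * (1 / 3) * s + (1 / 3)\<^sup>2) / (11 / 3)\<^sup>2"
      by (rule markov) simp
    also have "\<dots> \<le> 2 / 11"
    proof -
      \<comment> \<open>On the unit interval the quadratic in \<open>s\<close> is largest at
        \<open>s = 1\<close>; the product is its distance from that value.\<close>
      have "0 \<le> (1 - s) * (3 * s + 7 / 3)" using s0 s1 by (intro mult_nonneg_nonneg) auto
      then show ?thesis by (simp add: power2_eq_square field_simps)
    qed
    finally show ?thesis by (simp add: Z_def)
  qed
  show "9 / 41 \<le> measure_pmf.prob Q {z. 1 / 2 < \<bar>\<Sum>i<n. coin_sgn (z i) * x i\<bar>}"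
    if "(\<Sum>i<n. (x i)\<^sup>2) = 1"
  proof -
    have s1: "s = 1" using that by (simp add: s_def)
    \<comment> \<open>For the deviation 3 / 4 below the mean the optimal centre is
      \<open>1 + 2 / (3 / 4) = 11 / 3\<close>, with bound \<open>2 / (2 + 9 / 16)\<close>. The
      complement 9 / 41 exceeds 2 / 11.\<close>
    have "measure_pmf.prob Q (- {z. 1 / 2 < \<bar>Z z\<bar>}) \<le> measure_pmf.prob Q {z. 41 / 12 \<le> \<bar>Z z ^ 2 - 11 / 3\<bar>}"
    proof (intro measure_pmf.finite_measure_mono subsetI)
      fix z assume "z \<in> - {z. 1 / 2 < \<bar>Z z\<bar>}"
      then have "\<bar>Z z\<bar>\<^sup>2 \<le> (1 / 2)\<^sup>2" by (intro power_mono) auto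
      then have "Z z ^ 2 \<le> 1 / 4" by (simp add: power2_eq_square)
      then show "z \<in> {z. 41 / 12 \<le> \<bar>Z z ^ 2 - 11 / 3\<bar>}" by simp
    qed simp
    also have "\<dots> \<le> (3 * s\<^sup>2 - 2 * (11 / 3) * s + (11 / 3)\<^sup>2) / (41 / 12)\<^sup>2"
      by (rule markov) simp
    also have "\<dots> = 32 / 41" by (simp add: s1 power2_eq_square)
    finally show ?thesis
      using measure_pmf.prob_compl[of "{z. 1 / 2 < \<bar>Z z\<bar>}" Q] by (simp add: Z_def Compl_eq_Diff_UNIV)
  qed
qed

subsection \<open>Dyadic weights\<close>

lemma power_powr_swap: "(b powr a) ^ k = (b ^ k) powr a" if "0 < b" for b a :: real
  using that by (induction k) (simp_all add: powr_mult)

text \<open>Dyadic weights \<open>2 ^ j\<close> with the tail \<open>s powr - p\<close>, up to rounding \<open>s\<close> to a power of two.\<close>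

definition level_pmf :: "real \<Rightarrow> nat pmf" where
  "level_pmf p = geometric_pmf (1 - 2 powr - p)"

lemma pmf_level:
  assumes "0 < p"
  shows "pmf (level_pmf p) j = (2 powr - p) ^ j * (1 - 2 powr - p)"
proof -
  have "2 powr - p < 1" using assms by (simp add: powr_less_one)
  then show ?thesis by (simp add: level_pmf_def pmf_geometric)
qed

lemma le_two_power_iff:
  assumes "0 < s"
  shows "s \<le> 2 ^ j \<longleftrightarrow> nat \<lceil>log 2 s\<rceil> \<le> j"
proof -
  have "s \<le> 2 ^ j \<longleftrightarrow> log 2 s \<le> real j"
    using assms by (subst powr_realpow[symmetric]) (simp_all add: log_le_iff)
  then show ?thesis by (simp add: nat_le_iff ceiling_le_iff)
qed

text \<open>Rounding up to a power of two at most doubles \<open>s\<close>. Below 1 / 2 this fails,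
  since the smallest power available is 1.\<close>

lemma two_power_ceiling_log:
  assumes "0 < s"
  shows "s \<le> 2 ^ nat \<lceil>log 2 s\<rceil>" "1 / 2 \<le> s \<Longrightarrow> 2 ^ nat \<lceil>log 2 s\<rceil> \<le> 2 * s"
proof -
  show "s \<le> 2 ^ nat \<lceil>log 2 s\<rceil>" using le_two_power_iff[OF assms] by blast
  assume s: "1 / 2 \<le> s"
  show "2 ^ nat \<lceil>log 2 s\<rceil> \<le> 2 * s"
  proof (cases "nat \<lceil>log 2 s\<rceil>")
    case 0
    then show ?thesis using s by simp
  next
    case (Suc k)
    then have "\<not> s \<le> 2 ^ k" using le_two_power_iff[OF assms, of k] by simp
    then show ?thesis by (simp add: Suc)
  qed
qed

lemma prob_level_ge:
  assumes "0 < p"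
  shows "measure_pmf.prob (level_pmf p) {k..} = (2 powr - p) ^ k"
proof -
  let ?q = "2 powr - p :: real"
  have q: "?q < 1" using assms by (simp add: powr_less_one)
  have "measure_pmf.prob (level_pmf p) {..<k} = (\<Sum>j<k. ?q ^ j * (1 - ?q))"
    using assms by (simp add: measure_measure_pmf_finite pmf_level)
  also have "\<dots> = 1 - ?q ^ k"
  proof -
    have "(\<Sum>j<k. ?q ^ j * (1 - ?q)) = (\<Sum>j<k. ?q ^ j) * (1 - ?q)"
      by (rule sum_distrib_right[symmetric])
    also have "\<dots> = 1 - ?q ^ k" by (metis one_diff_power_eq mult.commute)
    finally show ?thesis .
  qed
  finally have "measure_pmf.prob (level_pmf p) {..<k} = 1 - ?q ^ k" .
  moreover have "{k..} = UNIV - {..<k}" by auto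
  ultimately show ?thesis
    using measure_pmf.prob_compl[of "{..<k}" "level_pmf p"] by simp
qed

lemma level_tail:
  assumes p: "0 < p" and s: "0 < s"
  shows "measure_pmf.prob (level_pmf p) {j. s \<le> 2 ^ j} \<le> s powr - p"
    and "1 / 2 \<le> s \<Longrightarrow> (2 * s) powr - p \<le> measure_pmf.prob (level_pmf p) {j. s \<le> 2 ^ j}"
proof -
  define k where "k = nat \<lceil>log 2 s\<rceil>"
  have "{j. s \<le> 2 ^ j} = {k..}"
    unfolding k_def by (simp only: le_two_power_iff[OF s] atLeast_def)
  then have eq: "measure_pmf.prob (level_pmf p) {j. s \<le> 2 ^ j} = (2 ^ k) powr - p"
    by (simp only: prob_level_ge[OF p] power_powr_swap zero_less_numeral)
  show "measure_pmf.prob (level_pmf p) {j. s \<le> 2 ^ j} \<le> s powr - p"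
    unfolding eq k_def by (rule powr_mono2'[OF _ s two_power_ceiling_log(1)[OF s]]) (use p in simp)
  show "(2 * s) powr - p \<le> measure_pmf.prob (level_pmf p) {j. s \<le> 2 ^ j}" if "1 / 2 \<le> s"
    unfolding eq k_def by (rule powr_mono2'[OF _ _ two_power_ceiling_log(2)[OF s that]]) (use p in simp_all)
qed

text \<open>The expectation is, up to a factor below 1, a geometric sum with ratio
  \<open>2 powr (2 - p)\<close>. Below 2 the ratio exceeds 1 and the last term, of order
  \<open>s powr (2 - p)\<close>, dominates; above 2 the sum is bounded uniformly in
  \<open>s\<close>.\<close>

lemma level_truncated_second_moment:
  assumes p: "0 < p" and s: "0 < s"
  defines "T \<equiv> measure_pmf.expectation (level_pmf p) (\<lambda>j. if 2 ^ j < s then 4 ^ j else 0)"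
  shows "p < 2 \<Longrightarrow> T \<le> 2 powr (2 - p) / (2 powr (2 - p) - 1) * s powr (2 - p)"
    and "2 < p \<Longrightarrow> T \<le> 1 / (1 - 2 powr (2 - p))"
proof -
  define k where "k = nat \<lceil>log 2 s\<rceil>"
  define \<rho> :: real where "\<rho> = 2 powr (2 - p)"
  let ?q = "2 powr - p :: real"
  have q: "0 < ?q" "?q < 1" using p by (auto simp: powr_less_one)
  have \<rho>q: "\<rho> = 4 * ?q" using powr_add[of 2 2 "- p"] by (simp add: \<rho>_def)
  have lt: "2 ^ j < s \<longleftrightarrow> j < k" for j
    unfolding k_def by (metis le_two_power_iff[OF s] linorder_not_le)
  have "T = (\<Sum>j<k. 4 ^ j * pmf (level_pmf p) j)"
    unfolding T_def lt
    by (subst integral_measure_pmf_real[of "{..<k}"]) (auto split: if_splits intro!: sum.cong)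
  also have "\<dots> = (\<Sum>j<k. \<rho> ^ j) * (1 - ?q)"
    by (simp add: pmf_level[OF p] \<rho>q power_mult_distrib sum_distrib_right mult.assoc)
  finally have T: "T = (\<Sum>j<k. \<rho> ^ j) * (1 - ?q)" .
  have "0 \<le> (\<Sum>j<k. \<rho> ^ j)" by (intro sum_nonneg) (simp add: \<rho>_def)
  then have Tle: "T \<le> (\<Sum>j<k. \<rho> ^ j)"
    unfolding T using q by (intro mult_right_le_one_le) auto
  show "T \<le> 1 / (1 - \<rho>)" if "2 < p"
  proof -
    have \<rho>: "0 < \<rho>" "\<rho> < 1" using that by (auto simp: \<rho>_def powr_less_one)
    then have "(\<Sum>j<k. \<rho> ^ j) = (1 - \<rho> ^ k) / (1 - \<rho>)" by (simp add: sum_gp_strict)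
    also have "\<dots> \<le> 1 / (1 - \<rho>)" using \<rho> by (intro divide_right_mono) auto
    finally show ?thesis using Tle by simp
  qed
  show "T \<le> \<rho> / (\<rho> - 1) * s powr (2 - p)" if p2: "p < 2"
  proof -
    have \<rho>: "1 < \<rho>" unfolding \<rho>_def using p2 by (intro gr_one_powr) auto
    show ?thesis
    proof (cases k)
      case 0
      have "0 \<le> \<rho> / (\<rho> - 1) * s powr (2 - p)"
        using \<rho> by (intro mult_nonneg_nonneg divide_nonneg_nonneg) auto
      then show ?thesis using Tle 0 by simp
    next
      case (Suc i)
      then have "2 ^ i < s" using lt[of i] by simp
      then have "(2 ^ i) powr (2 - p) \<le> s powr (2 - p)" using p2 by (intro powr_mono2) auto
      moreover have "(2 ^ i) powr (2 - p) = \<rho> ^ i"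
        unfolding \<rho>_def by (rule power_powr_swap[symmetric]) simp
      ultimately have "\<rho> ^ k \<le> \<rho> * s powr (2 - p)" using \<rho> by (simp add: Suc)
      have "(\<Sum>j<k. \<rho> ^ j) = (\<rho> ^ k - 1) / (\<rho> - 1)" using \<rho> by (simp add: geometric_sum)
      also have "\<dots> \<le> \<rho> * s powr (2 - p) / (\<rho> - 1)"
        using \<rho> \<open>\<rho> ^ k \<le> \<rho> * s powr (2 - p)\<close> by (intro divide_right_mono) auto
      finally show ?thesis using Tle by simp
    qed
  qed
qed

lemma weighted_max_upper:
  fixes w :: "'b \<Rightarrow> real" and x :: "nat \<Rightarrow> real"
  assumes tail: "\<And>s. 0 < s \<Longrightarrow> measure_pmf.prob V {v. s \<le> w v} \<le> s powr - p"
    and p: "0 < p" and x: "(\<Sum>i<n. \<bar>x i\<bar> powr p) \<le> 1" and s: "0 < s"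
  shows "i < n \<Longrightarrow> measure_pmf.prob V {v. s \<le> w v * \<bar>x i\<bar>} \<le> (\<bar>x i\<bar> / s) powr p"
    and "measure_pmf.prob (Pi_pmf {..<n} d (\<lambda>_. V)) {z. \<exists>i<n. s \<le> w (z i) * \<bar>x i\<bar>} \<le> s powr - p"
proof -
  show coord: "measure_pmf.prob V {v. s \<le> w v * \<bar>x i\<bar>} \<le> (\<bar>x i\<bar> / s) powr p" for i
  proof (cases "x i = 0")
    case True
    then show ?thesis using s by simp
  next
    case False
    then have "{v. s \<le> w v * \<bar>x i\<bar>} = {v. s / \<bar>x i\<bar> \<le> w v}" by (auto simp: divide_le_eq)
    then show ?thesis
      using tail[of "s / \<bar>x i\<bar>"] False s
      by (simp add: powr_minus powr_divide field_simps)
  qed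
  let ?Q = "Pi_pmf {..<n} d (\<lambda>_. V)"
  have "measure_pmf.prob ?Q {z. \<exists>i<n. s \<le> w (z i) * \<bar>x i\<bar>}
      = measure_pmf.prob ?Q (\<Union>i<n. {z. s \<le> w (z i) * \<bar>x i\<bar>})"
    by (rule arg_cong) auto
  also have "\<dots> \<le> (\<Sum>i<n. measure_pmf.prob ?Q {z. s \<le> w (z i) * \<bar>x i\<bar>})"
    by (intro measure_pmf.finite_measure_subadditive_finite) auto
  also have "\<dots> = (\<Sum>i<n. measure_pmf.prob V {v. s \<le> w v * \<bar>x i\<bar>})"
    using prob_Pi_pmf_component[of "{..<n}" _ d "\<lambda>_. V"]
    by (intro sum.cong) auto
  also have "\<dots> \<le> (\<Sum>i<n. (\<bar>x i\<bar> / s) powr p)" by (intro sum_mono coord)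
  also have "\<dots> = (\<Sum>i<n. \<bar>x i\<bar> powr p) * s powr - p"
    using s by (simp add: powr_divide powr_minus_divide sum_divide_distrib)
  also have "\<dots> \<le> 1 * s powr - p" using x by (intro mult_right_mono) auto
  finally show "measure_pmf.prob ?Q {z. \<exists>i<n. s \<le> w (z i) * \<bar>x i\<bar>} \<le> s powr - p" by simp
qed

text \<open>By independence all coordinates stay below \<open>s\<close> with probability at most the
  product of the \<open>1 - \<bar>x i\<bar> powr p * S\<close>, hence at most
  \<open>exp (- S)\<close>, and \<open>1 - exp (- S) \<ge> S / (1 + S)\<close>.\<close>

lemma weighted_max_lower:
  fixes w :: "'b \<Rightarrow> real" and x :: "nat \<Rightarrow> real"
  assumes tail: "\<And>s. 1 / 2 \<le> s \<Longrightarrow> (2 * s) powr - p \<le> measure_pmf.prob V {v. s \<le> w v}"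
    and p: "0 < p" and x: "(\<Sum>i<n. \<bar>x i\<bar> powr p) = 1" and s: "1 / 2 \<le> s"
  defines "S \<equiv> (2 * s) powr - p"
  shows "S / (1 + S) \<le> measure_pmf.prob (Pi_pmf {..<n} d (\<lambda>_. V)) {z. \<exists>i<n. s \<le> w (z i) * \<bar>x i\<bar>}"
proof -
  let ?Q = "Pi_pmf {..<n} d (\<lambda>_. V)"
  have S: "0 < S" using s by (simp add: S_def)
  \<comment> \<open>Coordinates of modulus at most 1 keep \<open>s / \<bar>x i\<bar>\<close> in the
    range from 1 / 2 on, where the lower tail bound holds.\<close>
  have x1: "\<bar>x i\<bar> \<le> 1" if "i < n" for i
  proof -
    have "\<bar>x i\<bar> powr p \<le> (\<Sum>i<n. \<bar>x i\<bar> powr p)" using that by (intro member_le_sum) auto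
    then have "\<bar>x i\<bar> powr p \<le> 1 powr p" using x by simp
    then show ?thesis using p powr_less_mono2[of p 1 "\<bar>x i\<bar>"] by (meson linorder_not_le zero_le_one)
  qed
  have coord: "\<bar>x i\<bar> powr p * S \<le> measure_pmf.prob V {v. s \<le> w v * \<bar>x i\<bar>}" if "i < n" for i
  proof (cases "x i = 0")
    case True
    then show ?thesis using p by simp
  next
    case False
    have "1 / 2 \<le> s / \<bar>x i\<bar>" using x1[OF that] s False by (simp add: field_simps)
    moreover have "{v. s \<le> w v * \<bar>x i\<bar>} = {v. s / \<bar>x i\<bar> \<le> w v}" using False by (auto simp: divide_le_eq)
    ultimately show ?thesis
      using tail[of "s / \<bar>x i\<bar>"] False s by (simp add: S_def powr_minus powr_divide field_simps)
  qed
  have "measure_pmf.prob ?Q (UNIV - {z. \<exists>i<n. s \<le> w (z i) * \<bar>x i\<bar>})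
      = measure_pmf.prob ?Q (Pi {..<n} (\<lambda>i. {v. \<not> s \<le> w v * \<bar>x i\<bar>}))"
    by (rule arg_cong) auto
  also have "\<dots> = (\<Prod>i<n. measure_pmf.prob V {v. \<not> s \<le> w v * \<bar>x i\<bar>})"
    by (subst measure_Pi_pmf_Pi) auto
  also have "\<dots> \<le> (\<Prod>i<n. exp (- (\<bar>x i\<bar> powr p * S)))"
  proof (intro prod_mono conjI)
    fix i assume i: "i \<in> {..<n}"
    have "{v. \<not> s \<le> w v * \<bar>x i\<bar>} = UNIV - {v. s \<le> w v * \<bar>x i\<bar>}" by auto
    then have "measure_pmf.prob V {v. \<not> s \<le> w v * \<bar>x i\<bar>} = 1 - measure_pmf.prob V {v. s \<le> w v * \<bar>x i\<bar>}"
      using measure_pmf.prob_compl[of "{v. s \<le> w v * \<bar>x i\<bar>}" V] by simp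
    also have "\<dots> \<le> 1 + (- (\<bar>x i\<bar> powr p * S))" using coord[of i] i by simp
    also have "\<dots> \<le> exp (- (\<bar>x i\<bar> powr p * S))" by (rule exp_ge_add_one_self)
    finally show "measure_pmf.prob V {v. \<not> s \<le> w v * \<bar>x i\<bar>} \<le> exp (- (\<bar>x i\<bar> powr p * S))" .
  qed simp
  also have "\<dots> = exp (- S)"
    using x by (simp add: exp_sum[symmetric] sum_negf flip: sum_distrib_right)
  also have "\<dots> \<le> 1 / (1 + S)"
    using S exp_ge_add_one_self[of S] by (simp add: exp_minus field_simps)
  finally have "1 - 1 / (1 + S) \<le> measure_pmf.prob ?Q {z. \<exists>i<n. s \<le> w (z i) * \<bar>x i\<bar>}"
    using measure_pmf.prob_compl[of "{z. \<exists>i<n. s \<le> w (z i) * \<bar>x i\<bar>}" ?Q] by simp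
  moreover have "1 - 1 / (1 + S) = S / (1 + S)" using S by (simp add: field_simps)
  ultimately show ?thesis by simp
qed

text \<open>Here \<open>U s\<close> stands for the event that the largest weighted coordinate is at least \<open>s\<close>, and outside
  \<open>B\<close> the statistic \<open>G\<close> agrees with that coordinate up to \<open>t / 8\<close>. The rounding of the weights costs a
  factor 2, so \<open>U (5 / 8 * t)\<close> has probability about \<open>(5 / 4 * t) powr - p\<close>.\<close>

lemma gap_from_max:
  fixes G :: "'a \<Rightarrow> real"
  assumes p: "1 \<le> p" and t: "0 < t" and S: "S = (5 / 4 * t) powr - p" "S \<le> 1 / 5"
    and bad: "measure_pmf.prob Q B \<le> S / 24"
  shows "\<lbrakk>\<And>z. z \<notin> B \<Longrightarrow> 2 * t \<le> G z \<Longrightarrow> U (15 / 8 * t) z;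
      measure_pmf.prob Q {z. U (15 / 8 * t) z} \<le> (15 / 8 * t) powr - p\<rbrakk> \<Longrightarrow>
      measure_pmf.prob Q {z. 2 * t \<le> G z} \<le> 17 / 24 * S"
    and "\<lbrakk>\<And>z. z \<notin> B \<Longrightarrow> U (5 / 8 * t) z \<Longrightarrow> t / 2 < G z;
      S / (1 + S) \<le> measure_pmf.prob Q {z. U (5 / 8 * t) z}\<rbrakk> \<Longrightarrow>
      19 / 24 * S \<le> measure_pmf.prob Q {z. t / 2 < G z}"
proof -
  have S0: "0 < S" using t S by simp
  show "measure_pmf.prob Q {z. 2 * t \<le> G z} \<le> 17 / 24 * S"
    if G: "\<And>z. z \<notin> B \<Longrightarrow> 2 * t \<le> G z \<Longrightarrow> U (15 / 8 * t) z"
      and U: "measure_pmf.prob Q {z. U (15 / 8 * t) z} \<le> (15 / 8 * t) powr - p"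
  proof -
    have "measure_pmf.prob Q {z. 2 * t \<le> G z} \<le> measure_pmf.prob Q ({z. U (15 / 8 * t) z} \<union> B)"
      using G by (intro measure_pmf.finite_measure_mono) auto
    also have "\<dots> \<le> measure_pmf.prob Q {z. U (15 / 8 * t) z} + measure_pmf.prob Q B"
      by (intro measure_Un_le) auto
    \<comment> \<open>The thresholds \<open>15 / 8 * t\<close> and \<open>5 / 4 * t\<close> have
      ratio 3 / 2, and \<open>p = 1\<close> is the worst case. Adding \<open>S / 24\<close> for
      \<open>B\<close> gives 17 / 24.\<close>
    also have "measure_pmf.prob Q {z. U (15 / 8 * t) z} \<le> 2 / 3 * S"
    proof -
      have "(15 / 8 * t) powr - p = (3 / 2 * (5 / 4 * t)) powr - p" by simp
      also have "\<dots> = (3 / 2) powr - p * S"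
        using t unfolding S by (subst powr_mult) auto
      also have "\<dots> \<le> (3 / 2) powr - 1 * S"
        using p S0 by (intro mult_right_mono powr_mono) auto
      finally show ?thesis using U by (simp add: powr_minus)
    qed
    finally show ?thesis using bad by simp
  qed
  show "19 / 24 * S \<le> measure_pmf.prob Q {z. t / 2 < G z}"
    if G: "\<And>z. z \<notin> B \<Longrightarrow> U (5 / 8 * t) z \<Longrightarrow> t / 2 < G z"
      and U: "S / (1 + S) \<le> measure_pmf.prob Q {z. U (5 / 8 * t) z}"
  proof -
    have "measure_pmf.prob Q {z. U (5 / 8 * t) z} \<le> measure_pmf.prob Q ({z. t / 2 < G z} \<union> B)"
      using G by (intro measure_pmf.finite_measure_mono) auto
    also have "\<dots> \<le> measure_pmf.prob Q {z. t / 2 < G z} + measure_pmf.prob Q B"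
      by (intro measure_Un_le) auto
    finally have "S / (1 + S) \<le> measure_pmf.prob Q {z. t / 2 < G z} + S / 24"
      using U bad by simp
    \<comment> \<open>As \<open>S \<le> 1 / 5\<close>, passing from \<open>S\<close> to
      \<open>S / (1 + S)\<close> loses at most a sixth; after removing \<open>S / 24\<close> there
      remain 19 / 24, still above 17 / 24.\<close>
    moreover have "5 / 6 * S \<le> S / (1 + S)"
    proof -
      have "S * (5 * (1 + S)) \<le> S * 6" using S S0 by (intro mult_left_mono) auto
      then show ?thesis using S0 by (simp add: field_simps)
    qed
    ultimately show ?thesis by simp
  qed
qed

subsection \<open>A single row suffices below 2\<close>

definition signed_level_pmf :: "real \<Rightarrow> (bool \<times> nat) pmf" where
  "signed_level_pmf p = pair_pmf coin (level_pmf p)"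

definition signed_weight :: "bool \<times> nat \<Rightarrow> real" where
  "signed_weight v = coin_sgn (fst v) * 2 ^ snd v"

lemma abs_signed_weight: "\<bar>signed_weight v\<bar> = 2 ^ snd v"
  by (simp add: signed_weight_def abs_mult)

lemma prob_signed_level_snd:
  "measure_pmf.prob (signed_level_pmf p) {v. P (snd v)} = measure_pmf.prob (level_pmf p) {j. P j}"
proof -
  have "level_pmf p = map_pmf snd (signed_level_pmf p)"
    by (simp add: signed_level_pmf_def map_snd_pair_pmf)
  then show ?thesis by (simp add: vimage_def)
qed

text \<open>The random sign makes each truncated term centred, so the second moments add. For term
  \<open>i\<close> the weight is cut at \<open>\<tau> / \<bar>x i\<bar>\<close>, which makes its
  moment at most a multiple of \<open>\<bar>x i\<bar> powr p\<close>; the total is therefore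
  independent of \<open>n\<close>.\<close>

lemma truncated_sum_second_moment:
  fixes x :: "nat \<Rightarrow> real"
  assumes p: "0 < p" "p < 2" and x: "(\<Sum>i<n. \<bar>x i\<bar> powr p) \<le> 1" and \<tau>: "0 < \<tau>"
  defines "f \<equiv> \<lambda>i v. if \<bar>signed_weight v * x i\<bar> < \<tau> then signed_weight v * x i else 0"
  shows "measure_pmf.expectation (Pi_pmf {..<n} d (\<lambda>_. signed_level_pmf p)) (\<lambda>z. (\<Sum>i<n. f i (z i))\<^sup>2)
    \<le> 2 powr (2 - p) / (2 powr (2 - p) - 1) * \<tau> powr (2 - p)"
proof -
  define C where "C = 2 powr (2 - p) / (2 powr (2 - p) - 1)"
  have C: "0 \<le> C" using p by (simp add: C_def ge_one_powr_ge_zero)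
  have fb: "\<bar>f i v\<bar> \<le> \<tau>" for i v using \<tau> by (simp add: f_def)
  define h where "h i j = (if 2 ^ j * \<bar>x i\<bar> < \<tau> then 2 ^ j * x i else 0)" for i and j :: nat
  have fh: "f i (b, j) = coin_sgn b * h i j" for i b j
    by (simp add: f_def h_def abs_signed_weight abs_mult) (simp add: signed_weight_def)
  have f2: "(f i v)\<^sup>2 = (h i (snd v))\<^sup>2" for i v
    by (cases v) (simp add: fh power_mult_distrib)
  have Ef: "measure_pmf.expectation (signed_level_pmf p) (f i) = 0" for i
  proof -
    have "measure_pmf.expectation (signed_level_pmf p) (f i)
        = measure_pmf.expectation coin (\<lambda>b. measure_pmf.expectation (level_pmf p) (\<lambda>j. f i (b, j)))"
      unfolding signed_level_pmf_def by (rule expectation_pair_pmf_bounded) (rule fb)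
    then show ?thesis by (simp add: fh coin_sgn_def)
  qed
  have Ef2: "measure_pmf.expectation (signed_level_pmf p) (\<lambda>v. (f i v)\<^sup>2)
      \<le> C * \<tau> powr (2 - p) * \<bar>x i\<bar> powr p" for i
  proof (cases "x i = 0")
    case True
    then show ?thesis by (simp add: f_def cong: if_cong)
  next
    case False
    have "measure_pmf.expectation (signed_level_pmf p) (\<lambda>v. (f i v)\<^sup>2)
        = measure_pmf.expectation (level_pmf p) (\<lambda>j. (h i j)\<^sup>2)"
      unfolding f2 signed_level_pmf_def by (rule expectation_pair_pmf_snd)
    also have "\<dots> = measure_pmf.expectation (level_pmf p)
        (\<lambda>j. (x i)\<^sup>2 * (if 2 ^ j < \<tau> / \<bar>x i\<bar> then 4 ^ j else 0))"
    proof -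
      have "((2::real) ^ j)\<^sup>2 = 4 ^ j" for j by (simp add: power2_eq_square flip: power_mult_distrib)
      then have "(h i j)\<^sup>2 = (x i)\<^sup>2 * (if 2 ^ j < \<tau> / \<bar>x i\<bar> then 4 ^ j else 0)" for j
        using False by (simp add: h_def less_divide_eq power_mult_distrib)
      then show ?thesis by presburger
    qed
    also have "\<dots> = (x i)\<^sup>2 * measure_pmf.expectation (level_pmf p) (\<lambda>j. if 2 ^ j < \<tau> / \<bar>x i\<bar> then 4 ^ j else 0)"
      by (rule integral_mult_right_zero)
    also have "\<dots> \<le> (x i)\<^sup>2 * (C * (\<tau> / \<bar>x i\<bar>) powr (2 - p))"
      unfolding C_def using False \<tau> p
      by (intro mult_left_mono level_truncated_second_moment(1)) auto
    also have "\<dots> = C * \<tau> powr (2 - p) * \<bar>x i\<bar> powr p"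
    proof -
      have "(x i)\<^sup>2 = \<bar>x i\<bar> powr (p + (2 - p))" using False by (simp add: powr_numeral)
      also have "\<dots> = \<bar>x i\<bar> powr p * \<bar>x i\<bar> powr (2 - p)" by (rule powr_add)
      finally have "(x i)\<^sup>2 = \<bar>x i\<bar> powr p * \<bar>x i\<bar> powr (2 - p)" .
      then show ?thesis using False \<tau> by (simp add: powr_divide)
    qed
    finally show ?thesis .
  qed
  have "measure_pmf.expectation (Pi_pmf {..<n} d (\<lambda>_. signed_level_pmf p)) (\<lambda>z. (\<Sum>i<n. f i (z i))\<^sup>2)
      = (\<Sum>i<n. measure_pmf.expectation (signed_level_pmf p) (\<lambda>v. (f i v)\<^sup>2))"
    using Ef by (intro second_moment_Pi_pmf[where C = \<tau>] fb) auto
  also have "\<dots> \<le> (\<Sum>i<n. C * \<tau> powr (2 - p) * \<bar>x i\<bar> powr p)" by (intro sum_mono Ef2)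
  also have "\<dots> = C * \<tau> powr (2 - p) * (\<Sum>i<n. \<bar>x i\<bar> powr p)" by (simp add: sum_distrib_left)
  also have "\<dots> \<le> C * \<tau> powr (2 - p) * 1" using x C by (intro mult_left_mono) auto
  finally show ?thesis by (simp add: C_def)
qed

text \<open>Independence bounds each pair by a product, and the sum over pairs is at most the square
  of the single sum. The result is quadratic in the tail, hence negligible for a high
  threshold.\<close>

lemma prob_two_large:
  fixes w :: "'b \<Rightarrow> real" and x :: "nat \<Rightarrow> real"
  assumes tail: "\<And>s. 0 < s \<Longrightarrow> measure_pmf.prob V {v. s \<le> w v} \<le> s powr - p"
    and p: "0 < p" and x: "(\<Sum>i<n. \<bar>x i\<bar> powr p) \<le> 1" and s: "0 < s"
  shows "measure_pmf.prob (Pi_pmf {..<n} d (\<lambda>_. V))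
      {z. \<exists>i<n. \<exists>k<n. i \<noteq> k \<and> s \<le> w (z i) * \<bar>x i\<bar> \<and> s \<le> w (z k) * \<bar>x k\<bar>} \<le> (s powr - p)\<^sup>2"
proof -
  let ?Q = "Pi_pmf {..<n} d (\<lambda>_. V)"
  let ?a = "\<lambda>i. (\<bar>x i\<bar> / s) powr p"
  let ?D = "{(i, k). i < n \<and> k < n \<and> i \<noteq> k}"
  let ?L = "\<lambda>i. {v. s \<le> w v * \<bar>x i\<bar>}"
  have fin: "finite ?D" by (rule finite_subset[of _ "{..<n} \<times> {..<n}"]) auto
  have pair: "measure_pmf.prob ?Q {z. z i \<in> ?L i \<and> z k \<in> ?L k} \<le> ?a i * ?a k"
    if "i < n" "k < n" "i \<noteq> k" for i k
  proof -
    have "{z. z i \<in> ?L i \<and> z k \<in> ?L k} = Pi {..<n} (\<lambda>l. if l \<in> {i, k} then ?L l else UNIV)"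
      using that by (fastforce simp: Pi_def)
    then have "measure_pmf.prob ?Q {z. z i \<in> ?L i \<and> z k \<in> ?L k}
        = (\<Prod>l<n. measure_pmf.prob V (if l \<in> {i, k} then ?L l else UNIV))"
      by (simp only: measure_Pi_pmf_Pi finite_lessThan)
    also have "\<dots> = (\<Prod>l\<in>{i, k}. measure_pmf.prob V (?L l))"
      using that by (intro prod.mono_neutral_cong_right) auto
    also have "\<dots> = measure_pmf.prob V (?L i) * measure_pmf.prob V (?L k)"
      using that by simp
    also have "\<dots> \<le> ?a i * ?a k"
      using that by (intro mult_mono weighted_max_upper(1)[OF tail p x s]) auto
    finally show ?thesis .
  qed
  have "{z. \<exists>i<n. \<exists>k<n. i \<noteq> k \<and> s \<le> w (z i) * \<bar>x i\<bar> \<and> s \<le> w (z k) * \<bar>x k\<bar>}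
      = (\<Union>(i, k)\<in>?D. {z. z i \<in> ?L i \<and> z k \<in> ?L k})"
    by auto
  then have "measure_pmf.prob ?Q {z. \<exists>i<n. \<exists>k<n. i \<noteq> k \<and> s \<le> w (z i) * \<bar>x i\<bar> \<and> s \<le> w (z k) * \<bar>x k\<bar>}
      = measure_pmf.prob ?Q (\<Union>(i, k)\<in>?D. {z. z i \<in> ?L i \<and> z k \<in> ?L k})"
    by (rule arg_cong)
  also have "\<dots> \<le> (\<Sum>u\<in>?D. measure_pmf.prob ?Q (case u of (i, k) \<Rightarrow> {z. z i \<in> ?L i \<and> z k \<in> ?L k}))"
    by (intro measure_pmf.finite_measure_subadditive_finite fin) auto
  also have "\<dots> \<le> (\<Sum>u\<in>?D. ?a (fst u) * ?a (snd u))"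
    using pair by (intro sum_mono) auto
  also have "\<dots> \<le> (\<Sum>u\<in>{..<n} \<times> {..<n}. ?a (fst u) * ?a (snd u))"
    by (intro sum_mono2) auto
  also have "\<dots> = (\<Sum>i<n. ?a i)\<^sup>2"
    by (simp add: power2_eq_square sum_product sum.cartesian_product case_prod_beta)
  also have "(\<Sum>i<n. ?a i) = (\<Sum>i<n. \<bar>x i\<bar> powr p) * s powr - p"
    using s by (simp add: powr_divide powr_minus_divide sum_divide_distrib)
  also have "(\<dots>)\<^sup>2 \<le> (1 * s powr - p)\<^sup>2"
    using x by (intro power_mono mult_right_mono mult_nonneg_nonneg sum_nonneg) auto
  finally show ?thesis by simp
qed

text \<open>The order of choice matters. For every \<open>t\<close> the truncated part has the same
  order \<open>t powr - p\<close> as the target, so \<open>\<epsilon>\<close> must make its constant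
  small. The pair term grows as \<open>\<epsilon>\<close> shrinks, but it is quadratic in
  \<open>t powr - p\<close> and is then beaten by a large \<open>t\<close>. Each takes half of the 1
  / 24.\<close>

lemma single_jump_parameters:
  fixes p C :: real
  assumes p: "1 \<le> p" "p < 2" and C: "0 < C"
  obtains \<epsilon> t :: real where "0 < \<epsilon>" "\<epsilon> \<le> 1 / 8" "1 \<le> t" "(5 / 4 * t) powr - p \<le> 1 / 5"
    "((\<epsilon> * t) powr - p)\<^sup>2 + C * (\<epsilon> * t) powr (2 - p) / (t / 8)\<^sup>2 \<le> (5 / 4 * t) powr - p / 24"
proof -
  define q where "q = (5 / 4 :: real) powr - p"
  have q: "0 < q" by (simp add: q_def)
  define \<epsilon> where "\<epsilon> = min (1 / 8) ((q / (48 * 64 * C)) powr (1 / (2 - p)))"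
  have \<epsilon>: "0 < \<epsilon>" "\<epsilon> \<le> 1 / 8" using q C by (auto simp: \<epsilon>_def)
  have "\<epsilon> powr (2 - p) \<le> ((q / (48 * 64 * C)) powr (1 / (2 - p))) powr (2 - p)"
    using \<epsilon> p by (intro powr_mono2) (auto simp: \<epsilon>_def)
  also have "\<dots> = q / (48 * 64 * C)" using p q C by (simp add: powr_powr)
  finally have \<epsilon>q: "64 * C * \<epsilon> powr (2 - p) \<le> q / 48" using C by (simp add: field_simps)
  \<comment> \<open>\<open>\<delta>\<close> is the later value of \<open>t powr - p\<close>; its
    three bounds give \<open>1 \<le> t\<close>, the bound 1 / 5 and the pair estimate.\<close>
  define \<delta> where "\<delta> = min 1 (min (1 / (5 * q)) ((\<epsilon> powr p)\<^sup>2 * q / 48))"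
  have \<delta>: "0 < \<delta>" "\<delta> \<le> 1" "\<delta> \<le> 1 / (5 * q)" "\<delta> \<le> (\<epsilon> powr p)\<^sup>2 * q / 48"
    using q \<epsilon> by (auto simp: \<delta>_def)
  define t where "t = \<delta> powr - (1 / p)"
  have t: "0 < t" using \<delta> by (simp add: t_def)
  have tp: "t powr - p = \<delta>" using \<delta> p by (simp add: t_def powr_powr)
  have t1: "1 \<le> t"
    using powr_mono2'[of "- (1 / p)" \<delta> 1] \<delta> p by (simp add: t_def)
  have S: "(5 / 4 * t) powr - p = q * \<delta>" using t by (subst powr_mult) (auto simp: q_def tp)
  have "C * (\<epsilon> * t) powr (2 - p) / (t / 8)\<^sup>2 = 64 * C * \<epsilon> powr (2 - p) * (t powr (2 - p) / t\<^sup>2)"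
    using \<epsilon> t by (simp add: powr_mult power_divide)
  also have "t powr (2 - p) / t\<^sup>2 = \<delta>"
  proof -
    have "t powr (2 + - p) = t powr 2 * t powr - p" by (rule powr_add)
    then show ?thesis using t tp by simp
  qed
  also have "64 * C * \<epsilon> powr (2 - p) * \<delta> \<le> q / 48 * \<delta>" using \<epsilon>q \<delta> by (intro mult_right_mono) auto
  finally have 1: "C * (\<epsilon> * t) powr (2 - p) / (t / 8)\<^sup>2 \<le> q * \<delta> / 48" by simp
  have "((\<epsilon> * t) powr - p)\<^sup>2 = \<delta> * \<delta> / (\<epsilon> powr p)\<^sup>2"
    using \<epsilon> t by (simp add: powr_mult tp power_mult_distrib powr_minus_divide[of \<epsilon>] power_divide power2_eq_square)
  also have "\<dots> \<le> \<delta> * ((\<epsilon> powr p)\<^sup>2 * q / 48) / (\<epsilon> powr p)\<^sup>2"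
    using \<delta> by (intro divide_right_mono mult_left_mono) auto
  also have "\<dots> = q * \<delta> / 48" using \<epsilon> by simp
  finally have 2: "((\<epsilon> * t) powr - p)\<^sup>2 \<le> q * \<delta> / 48" .
  have "q * \<delta> \<le> q * (1 / (5 * q))" using \<delta> q by (intro mult_left_mono) auto
  then have "(5 / 4 * t) powr - p \<le> 1 / 5" unfolding S using q by simp
  moreover have "((\<epsilon> * t) powr - p)\<^sup>2 + C * (\<epsilon> * t) powr (2 - p) / (t / 8)\<^sup>2 \<le> (5 / 4 * t) powr - p / 24"
    unfolding S using add_mono[OF 2 1] by linarith
  ultimately show ?thesis by (rule that[OF \<epsilon> t1])
qed

text \<open>The principle of a single big jump: outside the bad event at most one term reaches
  \<open>\<tau>\<close> and the others together stay below \<open>t / 8\<close>, so the sum is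
  within \<open>t / 8\<close> of that term, or of 0. Both \<open>t\<close> and \<open>S\<close> are
  chosen before \<open>n\<close>, which keeps the gap constant.\<close>

lemma single_row_gap_below_two:
  fixes p :: real
  assumes p: "1 \<le> p" "p < 2"
  obtains t S :: real where "0 < t" "0 < S"
    "\<And>n (x :: nat \<Rightarrow> real). (\<Sum>i<n. \<bar>x i\<bar> powr p) \<le> 1 \<Longrightarrow>
      measure_pmf.prob (Pi_pmf {..<n} undefined (\<lambda>_. signed_level_pmf p))
        {z. 2 * t \<le> \<bar>\<Sum>i<n. signed_weight (z i) * x i\<bar>} \<le> 17 / 24 * S"
    "\<And>n (x :: nat \<Rightarrow> real). (\<Sum>i<n. \<bar>x i\<bar> powr p) = 1 \<Longrightarrow> 19 / 24 * S \<le>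
      measure_pmf.prob (Pi_pmf {..<n} undefined (\<lambda>_. signed_level_pmf p))
        {z. t / 2 < \<bar>\<Sum>i<n. signed_weight (z i) * x i\<bar>}"
proof -
  define C where "C = 2 powr (2 - p) / (2 powr (2 - p) - 1)"
  have "1 < 2 powr (2 - p)" using p by (intro gr_one_powr) auto
  then have C: "0 < C" by (simp add: C_def)
  obtain \<epsilon> t where \<epsilon>: "0 < \<epsilon>" "\<epsilon> \<le> 1 / 8" and t: "1 \<le> t" and S5: "(5 / 4 * t) powr - p \<le> 1 / 5"
    and small: "((\<epsilon> * t) powr - p)\<^sup>2 + C * (\<epsilon> * t) powr (2 - p) / (t / 8)\<^sup>2 \<le> (5 / 4 * t) powr - p / 24"
    by (rule single_jump_parameters[OF p C])
  define S where "S = (5 / 4 * t) powr - p"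
  define \<tau> where "\<tau> = \<epsilon> * t"
  have \<tau>: "0 < \<tau>" "\<tau> \<le> t / 8" using \<epsilon> t by (auto simp: \<tau>_def)
  let ?V = "signed_level_pmf p"
  let ?Q = "\<lambda>n. Pi_pmf {..<n} undefined (\<lambda>_. ?V)"
  let ?w = "\<lambda>v :: bool \<times> nat. 2 ^ snd v :: real"
  have p0: "0 < p" using p by simp
  have tail_ub: "measure_pmf.prob ?V {v. s \<le> ?w v} \<le> s powr - p" if "0 < s" for s
    using level_tail(1)[OF p0 that] by (simp add: prob_signed_level_snd[of p "\<lambda>j. s \<le> 2 ^ j"])
  have tail_lb: "(2 * s) powr - p \<le> measure_pmf.prob ?V {v. s \<le> ?w v}" if "1 / 2 \<le> s" for s
    using level_tail(2)[OF p0 _ that] that by (simp add: prob_signed_level_snd[of p "\<lambda>j. s \<le> 2 ^ j"])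
  define f where "f x i v = (if \<bar>signed_weight v * x i\<bar> < \<tau> then signed_weight v * x i else 0)"
    for x :: "nat \<Rightarrow> real" and i v
  define B where "B n x = {z. \<exists>i<n. \<exists>k<n. i \<noteq> k \<and> \<tau> \<le> ?w (z i) * \<bar>x i\<bar> \<and> \<tau> \<le> ?w (z k) * \<bar>x k\<bar>}
      \<union> {z. t / 8 \<le> \<bar>\<Sum>i<n. f x i (z i)\<bar>}" for n and x :: "nat \<Rightarrow> real"
  define U where "U n x s z \<longleftrightarrow> (\<exists>i<n. s \<le> ?w (z i) * \<bar>x i\<bar>)" for n and x :: "nat \<Rightarrow> real" and s z
  have bad: "measure_pmf.prob (?Q n) (B n x) \<le> S / 24" if x: "(\<Sum>i<n. \<bar>x i\<bar> powr p) \<le> 1" for n x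
  proof -
    have fb: "\<bar>\<Sum>i<n. f x i (z i)\<bar> \<le> card {..<n} * \<tau>" for z
      using \<tau> by (intro abs_sum_component_le) (auto simp: f_def)
    have "measure_pmf.prob (?Q n) {z. t / 8 \<le> \<bar>\<Sum>i<n. f x i (z i)\<bar>}
        \<le> measure_pmf.expectation (?Q n) (\<lambda>z. (\<Sum>i<n. f x i (z i))\<^sup>2) / (t / 8)\<^sup>2"
      by (rule prob_abs_ge_le[OF fb]) (use t in simp)
    also have "\<dots> \<le> C * \<tau> powr (2 - p) / (t / 8)\<^sup>2"
      unfolding f_def C_def
      by (intro divide_right_mono truncated_sum_second_moment[OF p0 p(2) x \<tau>(1)]) simp
    finally have "measure_pmf.prob (?Q n) {z. t / 8 \<le> \<bar>\<Sum>i<n. f x i (z i)\<bar>} \<le> C * \<tau> powr (2 - p) / (t / 8)\<^sup>2" .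
    moreover have "measure_pmf.prob (?Q n) {z. \<exists>i<n. \<exists>k<n. i \<noteq> k \<and> \<tau> \<le> ?w (z i) * \<bar>x i\<bar> \<and> \<tau> \<le> ?w (z k) * \<bar>x k\<bar>}
        \<le> (\<tau> powr - p)\<^sup>2"
      by (rule prob_two_large[OF tail_ub p0 x \<tau>(1)])
    ultimately have "measure_pmf.prob (?Q n) (B n x) \<le> (\<tau> powr - p)\<^sup>2 + C * \<tau> powr (2 - p) / (t / 8)\<^sup>2"
      unfolding B_def by (intro order_trans[OF measure_Un_le] add_mono) auto
    then show ?thesis using small unfolding S_def \<tau>_def by linarith
  qed
  have close: "(2 * t \<le> \<bar>\<Sum>i<n. signed_weight (z i) * x i\<bar> \<longrightarrow> U n x (15 / 8 * t) z) \<and>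
      (U n x (5 / 8 * t) z \<longrightarrow> t / 2 < \<bar>\<Sum>i<n. signed_weight (z i) * x i\<bar>)"
    if z: "z \<notin> B n x" for n x z
  proof -
    let ?y = "\<lambda>i. signed_weight (z i) * x i"
    have absy: "\<bar>?y i\<bar> = ?w (z i) * \<bar>x i\<bar>" for i by (simp add: abs_mult abs_signed_weight)
    have F: "\<bar>\<Sum>i<n. f x i (z i)\<bar> < t / 8" using z by (auto simp: B_def)
    show ?thesis
    proof (cases "\<exists>i<n. \<tau> \<le> \<bar>?y i\<bar>")
      \<comment> \<open>Without a large term the truncated sum is the whole sum, and neither premise
        can hold.\<close>
      case False
      then have "(\<Sum>i<n. f x i (z i)) = (\<Sum>i<n. ?y i)"
        by (intro sum.cong) (auto simp: f_def)
      moreover have "\<not> U n x (5 / 8 * t) z"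
        using False \<tau> t by (fastforce simp: U_def simp flip: absy)
      ultimately show ?thesis using F t by simp
    next
      case True
      then obtain i where i: "i < n" "\<tau> \<le> \<bar>?y i\<bar>" by blast
      have small: "\<bar>?y k\<bar> < \<tau>" if "k < n" "k \<noteq> i" for k
        using z i that by (fastforce simp: B_def simp flip: absy)
      have "(\<Sum>k<n. ?y k) = ?y i + (\<Sum>k\<in>{..<n} - {i}. ?y k)"
        using i by (simp add: sum.remove)
      moreover have "(\<Sum>k<n. f x k (z k)) = f x i (z i) + (\<Sum>k\<in>{..<n} - {i}. f x k (z k))"
        using i by (simp add: sum.remove)
      moreover have "(\<Sum>k\<in>{..<n} - {i}. f x k (z k)) = (\<Sum>k\<in>{..<n} - {i}. ?y k)"
        using small by (intro sum.cong) (auto simp: f_def)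
      moreover have "f x i (z i) = 0" using i by (simp add: f_def)
      ultimately have near: "\<bar>(\<Sum>k<n. ?y k) - ?y i\<bar> < t / 8" using F by simp
      show ?thesis
      proof (intro conjI impI)
        assume "2 * t \<le> \<bar>\<Sum>k<n. ?y k\<bar>"
        then have "15 / 8 * t \<le> \<bar>?y i\<bar>" using near by linarith
        then show "U n x (15 / 8 * t) z" using i by (auto simp: U_def absy)
      next
        assume "U n x (5 / 8 * t) z"
        then obtain k where k: "k < n" "5 / 8 * t \<le> \<bar>?y k\<bar>" by (auto simp: U_def absy)
        have "k = i" using small[of k] k \<tau> t by linarith
        then have "5 / 8 * t \<le> \<bar>?y i\<bar>" using k by simp
        then show "t / 2 < \<bar>\<Sum>k<n. ?y k\<bar>" using near by linarith
      qed
    qed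
  qed
  show ?thesis
  proof (rule that[of t S])
    show "0 < t" "0 < S" using t by (auto simp: S_def)
    show "measure_pmf.prob (?Q n) {z. 2 * t \<le> \<bar>\<Sum>i<n. signed_weight (z i) * x i\<bar>} \<le> 17 / 24 * S"
      if x: "(\<Sum>i<n. \<bar>x i\<bar> powr p) \<le> 1" for n and x :: "nat \<Rightarrow> real"
    proof (rule gap_from_max(1)[OF p(1) _ S_def _ bad[OF x], where U = "U n x"])
      show "measure_pmf.prob (?Q n) {z. U n x (15 / 8 * t) z} \<le> (15 / 8 * t) powr - p"
        unfolding U_def using t by (intro weighted_max_upper(2)[OF tail_ub p0 x]) auto
    qed (use t S5 close in \<open>auto simp: S_def\<close>)
    show "19 / 24 * S \<le> measure_pmf.prob (?Q n) {z. t / 2 < \<bar>\<Sum>i<n. signed_weight (z i) * x i\<bar>}"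
      if x: "(\<Sum>i<n. \<bar>x i\<bar> powr p) = 1" for n and x :: "nat \<Rightarrow> real"
    proof (rule gap_from_max(2)[OF p(1) _ S_def _ bad, where U = "U n x"])
      have "S = (2 * (5 / 8 * t)) powr - p" by (simp add: S_def)
      then show "S / (1 + S) \<le> measure_pmf.prob (?Q n) {z. U n x (5 / 8 * t) z}"
        using weighted_max_lower[OF tail_lb p0 x, of "5 / 8 * t" undefined] t by (simp add: U_def)
    qed (use t S5 close x in \<open>auto simp: S_def\<close>)
  qed
qed

subsection \<open>Count sketch above 2\<close>

lemma prob_eq_expectation_indicat:
  "measure_pmf.prob Q A = measure_pmf.expectation Q (indicat_real A)"
  by simp

lemma expectation_le_const:
  fixes F :: "'a \<Rightarrow> real"
  assumes "\<And>x. 0 \<le> F x" "\<And>x. F x \<le> c"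
  shows "measure_pmf.expectation Q F \<le> c"
proof -
  have "integrable Q F"
    using assms by (intro integrable_pmf_bounded[where C = c]) simp
  then show ?thesis using assms by (intro measure_pmf.integral_le_const) auto
qed

text \<open>Conditioning on the first component; it is used with the weights fixed and the hash
  functions random.\<close>

lemma prob_pair_pmf_le:
  assumes "\<And>a. measure_pmf.prob R {b. P a b} \<le> c"
  shows "measure_pmf.prob (pair_pmf Q R) {z. P (fst z) (snd z)} \<le> c"
proof -
  let ?F = "indicat_real {z. P (fst z) (snd z)}"
  have F: "\<bar>?F z\<bar> \<le> 1" for z by (simp add: indicator_def)
  have "measure_pmf.prob (pair_pmf Q R) {z. P (fst z) (snd z)}
      = measure_pmf.expectation Q (\<lambda>a. measure_pmf.expectation R (\<lambda>b. ?F (a, b)))"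
    unfolding prob_eq_expectation_indicat by (rule expectation_pair_pmf_bounded) (rule F)
  also have "(\<lambda>a. measure_pmf.expectation R (\<lambda>b. ?F (a, b))) = (\<lambda>a. measure_pmf.prob R {b. P a b})"
  proof
    fix a
    have "(\<lambda>b. ?F (a, b)) = indicat_real {b. P a b}" by (auto simp: indicator_def fun_eq_iff)
    then show "measure_pmf.expectation R (\<lambda>b. ?F (a, b)) = measure_pmf.prob R {b. P a b}"
      by (simp only: prob_eq_expectation_indicat)
  qed
  also have "measure_pmf.expectation Q \<dots> \<le> c"
    using assms by (intro expectation_le_const) auto
  finally show ?thesis .
qed

text \<open>Jensen's inequality for the power \<open>p / 2\<close> and uniform weights
  \<open>1 / n\<close>, that is, Hoelder's comparison of the Euclidean norm with the
  \<open>p\<close>-norm. This is the source of the exponent \<open>1 - 2 / p\<close>.\<close>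

lemma sum_squares_le_powr:
  fixes x :: "nat \<Rightarrow> real"
  assumes p: "2 \<le> p" and n: "0 < n" and x: "(\<Sum>i<n. \<bar>x i\<bar> powr p) \<le> 1"
  shows "(\<Sum>i<n. (x i)\<^sup>2) \<le> real n powr (1 - 2 / p)"
proof -
  let ?a = "\<Sum>i<n. (1 / n) * (x i)\<^sup>2"
  have a0: "0 \<le> ?a" by (intro sum_nonneg) simp
  have sq: "((x i)\<^sup>2) powr (p / 2) = \<bar>x i\<bar> powr p" for i
  proof (cases "x i = 0")
    case False
    then have "((x i)\<^sup>2) powr (p / 2) = (\<bar>x i\<bar> powr 2) powr (p / 2)" by (simp add: powr_numeral)
    also have "\<dots> = \<bar>x i\<bar> powr (2 * (p / 2))" by (rule powr_powr)
    finally show ?thesis by simp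
  qed (use p in simp)
  have "?a powr (p / 2) \<le> (\<Sum>i<n. (1 / n) * ((x i)\<^sup>2) powr (p / 2))"
    using n p convex_on_sum[of "{..<n}" "{0..}" "\<lambda>x. x powr (p / 2)" "\<lambda>_. 1 / n" "\<lambda>i. (x i)\<^sup>2"]
    by (simp add: convex_on_powr_nonneg lessThan_empty_iff)
  also have "\<dots> = (1 / n) * (\<Sum>i<n. \<bar>x i\<bar> powr p)" by (simp only: sq sum_distrib_left)
  also have "\<dots> \<le> 1 / n" using x n by (simp add: divide_right_mono)
  finally have "(?a powr (p / 2)) powr (2 / p) \<le> (1 / n) powr (2 / p)"
    using p by (intro powr_mono2) auto
  then have "?a \<le> real n powr - (2 / p)"
    using p n a0 by (simp add: powr_powr powr_divide powr_minus_divide)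
  then have "n * ?a \<le> n * real n powr - (2 / p)" by (intro mult_left_mono) auto
  also have "\<dots> = real n powr (1 - 2 / p)" using n powr_add[of n 1 "- (2 / p)"] by simp
  finally show ?thesis using n by (simp flip: sum_divide_distrib)
qed

section \<open>Hashing into buckets and the noise it produces\<close>

definition cell_pmf :: "nat \<Rightarrow> (bool \<times> nat) pmf" where
  "cell_pmf B = pair_pmf coin (pmf_of_set {..<B})"

definition hash_pmf :: "nat \<Rightarrow> nat \<Rightarrow> (nat \<Rightarrow> bool \<times> nat) pmf" where
  "hash_pmf n B = Pi_pmf {..<n} undefined (\<lambda>_. cell_pmf B)"

text \<open>Reducing modulo \<open>B\<close> changes nothing on the support of \<open>cell_pmf B\<close>, but makes the bucket index
  valid for every seed.\<close>

definition bucket :: "nat \<Rightarrow> bool \<times> nat \<Rightarrow> nat" where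
  "bucket B v = snd v mod B"

text \<open>The contribution of the coordinates that collide with \<open>i\<close>: the error made
  when the bucket of \<open>i\<close> is read as the signed coordinate \<open>i\<close>.\<close>

definition bucket_noise :: "nat \<Rightarrow> nat \<Rightarrow> (nat \<Rightarrow> real) \<Rightarrow> nat \<Rightarrow> (nat \<Rightarrow> bool \<times> nat) \<Rightarrow> real" where
  "bucket_noise n B v i e =
    (\<Sum>a\<in>{..<n} - {i}. if bucket B (e a) = bucket B (e i) then coin_sgn (fst (e a)) * v a else 0)"

text \<open>Given the bucket of \<open>i\<close>, each other coordinate falls into it with
  probability \<open>1 / B\<close>, independently and with a random sign. The noise is therefore
  centred with variance at most the energy divided by \<open>B\<close>, and Chebyshev's inequality
  applies.\<close>

lemma prob_bucket_noise_ge: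
  assumes B: "0 < B" and i: "i < n" and b: "0 < b"
  shows "measure_pmf.prob (hash_pmf n B) {e. b \<le> \<bar>bucket_noise n B v i e\<bar>} \<le> (\<Sum>a<n. (v a)\<^sup>2) / B / b\<^sup>2"
proof -
  let ?A = "{..<n} - {i}"
  define f where "f c a y = (if bucket B y = c then coin_sgn (fst y) * v a else 0)" for c a and y :: "bool \<times> nat"
  define M where "M = (\<Sum>a<n. \<bar>v a\<bar>)"
  have f: "\<bar>f c a y\<bar> \<le> M" if "a < n" for c a y
  proof -
    have "\<bar>v a\<bar> \<le> M" using that member_le_sum[of a "{..<n}" "\<lambda>a. \<bar>v a\<bar>"] by (simp add: M_def)
    then show ?thesis by (auto simp: f_def abs_mult)
  qed
  have noise: "bucket_noise n B v i e = (\<Sum>a\<in>?A. f (bucket B (e i)) a (e a))" for e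
    by (simp add: bucket_noise_def f_def)
  have bnd: "\<bar>bucket_noise n B v i e\<bar> \<le> card ?A * M" for e
    unfolding noise using f by (intro abs_sum_component_le) auto
  then have bnd2: "\<bar>(bucket_noise n B v i e)\<^sup>2\<bar> \<le> (card ?A * M)\<^sup>2" for e
    using bnd[of e] by (simp add: abs_le_square_iff[symmetric] order_trans[OF _ abs_ge_self])
  have Ef: "measure_pmf.expectation (cell_pmf B) (f c a) = 0" if "a < n" for c a
  proof -
    have "measure_pmf.expectation (cell_pmf B) (f c a)
        = measure_pmf.expectation coin (\<lambda>s. measure_pmf.expectation (pmf_of_set {..<B}) (\<lambda>h. f c a (s, h)))"
      unfolding cell_pmf_def using f[OF that] by (rule expectation_pair_pmf_bounded)
    also have "(\<lambda>s. measure_pmf.expectation (pmf_of_set {..<B}) (\<lambda>h. f c a (s, h)))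
        = (\<lambda>s. coin_sgn s * measure_pmf.expectation (pmf_of_set {..<B}) (\<lambda>h. if h mod B = c then v a else 0))"
    proof
      fix s
      have "(\<lambda>h. f c a (s, h)) = (\<lambda>h. coin_sgn s * (if h mod B = c then v a else 0))"
        by (auto simp: f_def bucket_def)
      then show "measure_pmf.expectation (pmf_of_set {..<B}) (\<lambda>h. f c a (s, h))
          = coin_sgn s * measure_pmf.expectation (pmf_of_set {..<B}) (\<lambda>h. if h mod B = c then v a else 0)"
        by simp
    qed
    finally show ?thesis by (simp add: coin_sgn_def)
  qed
  have Ef2: "measure_pmf.expectation (cell_pmf B) (\<lambda>y. (f c a y)\<^sup>2) \<le> (v a)\<^sup>2 / B" for c a
  proof -
    have "(f c a y)\<^sup>2 = (if snd y mod B = c then (v a)\<^sup>2 else 0)" for y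
      by (simp add: f_def bucket_def power_mult_distrib)
    then have "measure_pmf.expectation (cell_pmf B) (\<lambda>y. (f c a y)\<^sup>2)
        = measure_pmf.expectation (pmf_of_set {..<B}) (\<lambda>h. if h mod B = c then (v a)\<^sup>2 else 0)"
      unfolding cell_pmf_def
      by (simp only: expectation_pair_pmf_snd[where f = "\<lambda>h. if h mod B = c then (v a)\<^sup>2 else 0"])
    also have "\<dots> = (\<Sum>h<B. if h mod B = c then (v a)\<^sup>2 else 0) / B"
      using B by (subst integral_pmf_of_set) (auto simp: lessThan_empty_iff)
    also have "(\<Sum>h<B. if h mod B = c then (v a)\<^sup>2 else 0) \<le> (v a)\<^sup>2"
    proof -
      have "(\<Sum>h<B. if h mod B = c then (v a)\<^sup>2 else 0) = (\<Sum>h<B. if h = c then (v a)\<^sup>2 else 0)"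
        by (intro sum.cong) auto
      then show ?thesis by simp
    qed
    finally show ?thesis using B by (simp add: divide_right_mono)
  qed
  have ins: "{..<n} = insert i ?A" using i by auto
  have "measure_pmf.expectation (hash_pmf n B) (\<lambda>e. (bucket_noise n B v i e)\<^sup>2)
      = measure_pmf.expectation (cell_pmf B) (\<lambda>y. measure_pmf.expectation (Pi_pmf ?A undefined (\<lambda>_. cell_pmf B))
          (\<lambda>e. (bucket_noise n B v i (e(i := y)))\<^sup>2))"
    unfolding hash_pmf_def
    by (subst ins, rule expectation_Pi_pmf_insert_bounded[where C = "(card ?A * M)\<^sup>2"]) (use bnd2 in auto)
  also have "\<dots> = measure_pmf.expectation (cell_pmf B)
      (\<lambda>y. \<Sum>a\<in>?A. measure_pmf.expectation (cell_pmf B) (\<lambda>u. (f (bucket B y) a u)\<^sup>2))"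
  proof (rule arg_cong[where f = "measure_pmf.expectation (cell_pmf B)"], rule ext)
    fix y
    have "bucket_noise n B v i (e(i := y)) = (\<Sum>a\<in>?A. f (bucket B y) a (e a))" for e
      unfolding noise by (auto intro!: sum.cong)
    then show "measure_pmf.expectation (Pi_pmf ?A undefined (\<lambda>_. cell_pmf B))
          (\<lambda>e. (bucket_noise n B v i (e(i := y)))\<^sup>2)
        = (\<Sum>a\<in>?A. measure_pmf.expectation (cell_pmf B) (\<lambda>u. (f (bucket B y) a u)\<^sup>2))"
      using f Ef second_moment_Pi_pmf[of ?A "f (bucket B y)" M "\<lambda>_. cell_pmf B" undefined] by simp
  qed
  also have "\<dots> \<le> (\<Sum>a<n. (v a)\<^sup>2) / B"
  proof (rule expectation_le_const)
    fix y
    show "0 \<le> (\<Sum>a\<in>?A. measure_pmf.expectation (cell_pmf B) (\<lambda>u. (f (bucket B y) a u)\<^sup>2))"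
      by (intro sum_nonneg) simp
    have "(\<Sum>a\<in>?A. measure_pmf.expectation (cell_pmf B) (\<lambda>u. (f (bucket B y) a u)\<^sup>2)) \<le> (\<Sum>a\<in>?A. (v a)\<^sup>2 / B)"
      by (intro sum_mono Ef2)
    also have "\<dots> \<le> (\<Sum>a<n. (v a)\<^sup>2 / B)" by (intro sum_mono2) auto
    finally show "(\<Sum>a\<in>?A. measure_pmf.expectation (cell_pmf B) (\<lambda>u. (f (bucket B y) a u)\<^sup>2)) \<le> (\<Sum>a<n. (v a)\<^sup>2) / B"
      by (simp add: sum_divide_distrib)
  qed
  finally have E: "measure_pmf.expectation (hash_pmf n B) (\<lambda>e. (bucket_noise n B v i e)\<^sup>2) \<le> (\<Sum>a<n. (v a)\<^sup>2) / B" .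
  have "measure_pmf.prob (hash_pmf n B) {e. b \<le> \<bar>bucket_noise n B v i e\<bar>}
      \<le> measure_pmf.expectation (hash_pmf n B) (\<lambda>e. (bucket_noise n B v i e)\<^sup>2) / b\<^sup>2"
    by (rule prob_abs_ge_le[OF bnd b])
  also have "\<dots> \<le> (\<Sum>a<n. (v a)\<^sup>2) / B / b\<^sup>2" using E by (intro divide_right_mono) auto
  finally show ?thesis .
qed

text \<open>Truncation at \<open>\<tau>\<close> keeps the integrand bounded. Some coordinate reaches
  \<open>\<tau>\<close> with probability at most \<open>\<kappa> / 2\<close>, and Markov's
  inequality for the truncated energy spends the other half.\<close>

lemma prob_weighted_energy_gt:
  fixes x :: "nat \<Rightarrow> real"
  assumes p: "2 < p" and n: "0 < n" and x: "(\<Sum>i<n. \<bar>x i\<bar> powr p) \<le> 1" and \<kappa>: "0 < \<kappa>"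
  defines "W \<equiv> 2 / (1 - 2 powr (2 - p)) * real n powr (1 - 2 / p) / \<kappa>"
  shows "measure_pmf.prob (Pi_pmf {..<n} d (\<lambda>_. level_pmf p)) {y. W < (\<Sum>i<n. (2 ^ y i * x i)\<^sup>2)} \<le> \<kappa>"
proof -
  let ?Q = "Pi_pmf {..<n} d (\<lambda>_. level_pmf p)"
  have p0: "0 < p" using p by simp
  define C where "C = 1 / (1 - 2 powr (2 - p) :: real)"
  have "2 powr (2 - p) < (1 :: real)" using p by (intro powr_less_one) auto
  then have C: "0 < C" by (simp add: C_def)
  have W: "W = 2 * C * real n powr (1 - 2 / p) / \<kappa>" by (simp add: W_def C_def)
  have W0: "0 < W" using C \<kappa> n by (simp add: W)
  define \<tau> where "\<tau> = (\<kappa> / 2) powr - (1 / p)"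
  have \<tau>: "0 < \<tau>" using \<kappa> by (simp add: \<tau>_def)
  have \<tau>p: "\<tau> powr - p = \<kappa> / 2" using \<kappa> p by (simp add: \<tau>_def powr_powr)
  define h where "h i j = (if 2 ^ j * \<bar>x i\<bar> < \<tau> then (2 ^ j * x i)\<^sup>2 else 0)" for i and j :: nat
  have h: "0 \<le> h i j" "h i j \<le> \<tau>\<^sup>2" for i j
  proof -
    show "0 \<le> h i j" by (simp add: h_def)
    have "(2 ^ j * x i)\<^sup>2 \<le> \<tau>\<^sup>2" if "2 ^ j * \<bar>x i\<bar> < \<tau>"
      using that by (intro power2_le_iff_abs_le[THEN iffD2]) (use \<tau> in \<open>auto simp: abs_mult\<close>)
    then show "h i j \<le> \<tau>\<^sup>2" by (simp add: h_def)
  qed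
  have Eh: "measure_pmf.expectation (level_pmf p) (h i) \<le> C * (x i)\<^sup>2" for i
  proof (cases "x i = 0")
    case True
    then have "h i = (\<lambda>_. 0)" by (auto simp: h_def)
    then show ?thesis using True by simp
  next
    case False
    have "((2::real) ^ j)\<^sup>2 = 4 ^ j" for j by (simp add: power2_eq_square flip: power_mult_distrib)
    then have "h i = (\<lambda>j. (x i)\<^sup>2 * (if 2 ^ j < \<tau> / \<bar>x i\<bar> then 4 ^ j else 0))"
      using False by (simp add: fun_eq_iff h_def less_divide_eq power_mult_distrib)
    then have "measure_pmf.expectation (level_pmf p) (h i)
        = (x i)\<^sup>2 * measure_pmf.expectation (level_pmf p) (\<lambda>j. if 2 ^ j < \<tau> / \<bar>x i\<bar> then 4 ^ j else 0)"
      by (simp only: integral_mult_right_zero)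
    also have "\<dots> \<le> (x i)\<^sup>2 * C"
      unfolding C_def using False \<tau> p p0
      by (intro mult_left_mono level_truncated_second_moment(2)) auto
    finally show ?thesis by (simp add: mult.commute)
  qed
  define H where "H y = (\<Sum>i<n. h i (y i))" for y
  have H: "0 \<le> H y" for y unfolding H_def using h by (intro sum_nonneg) auto
  have inth: "integrable ?Q (\<lambda>y. h i (y i))" for i
    by (rule integrable_pmf_bounded[where C = "\<tau>\<^sup>2"]) (use h in simp)
  have "measure_pmf.expectation ?Q H = (\<Sum>i<n. measure_pmf.expectation (level_pmf p) (h i))"
    unfolding H_def using inth by (simp add: expectation_Pi_pmf_component)
  also have "\<dots> \<le> (\<Sum>i<n. C * (x i)\<^sup>2)" by (intro sum_mono Eh)
  also have "\<dots> = C * (\<Sum>i<n. (x i)\<^sup>2)" by (simp add: sum_distrib_left)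
  also have "\<dots> \<le> C * real n powr (1 - 2 / p)"
    using p C by (intro mult_left_mono sum_squares_le_powr n x) auto
  finally have EH: "measure_pmf.expectation ?Q H \<le> C * real n powr (1 - 2 / p)" .
  have "integrable ?Q H" unfolding H_def using inth by simp
  then have "measure_pmf.prob ?Q {y \<in> space ?Q. W \<le> H y} \<le> measure_pmf.expectation ?Q H / W"
    using H W0 by (intro integral_Markov_inequality_measure[where A = "{}"]) auto
  also have "\<dots> \<le> C * real n powr (1 - 2 / p) / W" using EH W0 by (intro divide_right_mono) auto
  also have "\<dots> = \<kappa> / 2" using C n by (simp add: W)
  finally have 1: "measure_pmf.prob ?Q {y. W \<le> H y} \<le> \<kappa> / 2" by simp
  have 2: "measure_pmf.prob ?Q {y. \<exists>i<n. \<tau> \<le> 2 ^ y i * \<bar>x i\<bar>} \<le> \<kappa> / 2"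
    using weighted_max_upper(2)[of "level_pmf p" "\<lambda>j. 2 ^ j", OF level_tail(1)[OF p0] p0 x \<tau>] \<tau>p by simp
  have "measure_pmf.prob ?Q {y. W < (\<Sum>i<n. (2 ^ y i * x i)\<^sup>2)}
      \<le> measure_pmf.prob ?Q ({y. W \<le> H y} \<union> {y. \<exists>i<n. \<tau> \<le> 2 ^ y i * \<bar>x i\<bar>})"
  proof (intro measure_pmf.finite_measure_mono subsetI)
    fix y assume y: "y \<in> {y. W < (\<Sum>i<n. (2 ^ y i * x i)\<^sup>2)}"
    show "y \<in> {y. W \<le> H y} \<union> {y. \<exists>i<n. \<tau> \<le> 2 ^ y i * \<bar>x i\<bar>}"
    proof (cases "\<exists>i<n. \<tau> \<le> 2 ^ y i * \<bar>x i\<bar>")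
      case False
      then have "H y = (\<Sum>i<n. (2 ^ y i * x i)\<^sup>2)"
        unfolding H_def by (intro sum.cong) (auto simp: h_def)
      then show ?thesis using y by simp
    qed simp
  qed simp
  also have "\<dots> \<le> measure_pmf.prob ?Q {y. W \<le> H y} + measure_pmf.prob ?Q {y. \<exists>i<n. \<tau> \<le> 2 ^ y i * \<bar>x i\<bar>}"
    by (intro measure_Un_le) auto
  finally show ?thesis using 1 2 by simp
qed

text \<open>The weights are shared by all \<open>R\<close> hash functions, because the repetitions
  have to read one and the same weighted vector.\<close>

definition count_sketch_pmf ::
    "real \<Rightarrow> nat \<Rightarrow> nat \<Rightarrow> nat \<Rightarrow> ((nat \<Rightarrow> nat) \<times> (nat \<Rightarrow> nat \<Rightarrow> bool \<times> nat)) pmf" where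
  "count_sketch_pmf p n R B =
    pair_pmf (Pi_pmf {..<n} undefined (\<lambda>_. level_pmf p)) (Pi_pmf {..<R} undefined (\<lambda>_. hash_pmf n B))"

text \<open>Row \<open>c\<close> is bucket \<open>c mod B\<close> of table \<open>c div B\<close>.
  The weights are part of the row, so the sketch is linear in the unweighted column.\<close>

definition count_sketch_row ::
    "nat \<Rightarrow> (nat \<Rightarrow> nat) \<times> (nat \<Rightarrow> nat \<Rightarrow> bool \<times> nat) \<Rightarrow> nat \<Rightarrow> nat \<Rightarrow> real" where
  "count_sketch_row B s c a = (case s of (y, e) \<Rightarrow>
    if bucket B (e (c div B) a) = c mod B then coin_sgn (fst (e (c div B) a)) * 2 ^ y a else 0)"

text \<open>The median over the tables. Absolute values replace the usual correction by the sign,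
  since only the modulus of the coordinate is wanted.\<close>

definition count_sketch_coordinate ::
    "nat \<Rightarrow> nat \<Rightarrow> (nat \<Rightarrow> nat \<Rightarrow> bool \<times> nat) \<Rightarrow> (nat \<Rightarrow> real) \<Rightarrow> nat \<Rightarrow> real" where
  "count_sketch_coordinate R B e u i = kth_largest R ((R + 1) div 2) (\<lambda>r. \<bar>u (r * B + bucket B (e r i))\<bar>)"

definition count_sketch_max ::
    "nat \<Rightarrow> nat \<Rightarrow> nat \<Rightarrow> (nat \<Rightarrow> nat) \<times> (nat \<Rightarrow> nat \<Rightarrow> bool \<times> nat) \<Rightarrow> (nat \<Rightarrow> real) \<Rightarrow> real" where
  "count_sketch_max n R B s u = Max (count_sketch_coordinate R B (snd s) u ` {..<n})"

lemma borel_measurable_count_sketch_max: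
  "count_sketch_max n R B s \<in> borel_measurable (PiM UNIV (\<lambda>_. borel))"
proof -
  have "(\<lambda>u. \<bar>u k\<bar> :: real) \<in> borel_measurable (PiM UNIV (\<lambda>_. borel))" for k :: nat
    by (intro borel_measurable_abs measurable_component_singleton) auto
  then have "(\<lambda>u. count_sketch_coordinate R B e u i) \<in> borel_measurable (PiM UNIV (\<lambda>_. borel))" for e i
    unfolding count_sketch_coordinate_def by (intro borel_measurable_kth_largest)
  then show ?thesis
    unfolding count_sketch_max_def by (intro borel_measurable_Max) auto
qed

lemma count_sketch_max_scale:
  assumes R: "0 < R" and n: "0 < n" and a: "0 \<le> a"
  shows "count_sketch_max n R B s (\<lambda>c. a * u c) = a * count_sketch_max n R B s u"
proof -
  have "count_sketch_coordinate R B e (\<lambda>c. a * u c) i = a * count_sketch_coordinate R B e u i" for e i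
    unfolding count_sketch_coordinate_def abs_mult abs_of_nonneg[OF a]
    using R a by (intro kth_largest_scale) auto
  then have "count_sketch_max n R B s (\<lambda>c. a * u c)
      = Max ((\<lambda>r. a * r) ` count_sketch_coordinate R B (snd s) u ` {..<n})"
    unfolding count_sketch_max_def image_image by simp
  also have "\<dots> = a * count_sketch_max n R B s u"
    unfolding count_sketch_max_def using n a
    by (intro mono_Max_commute[symmetric]) (auto simp: mono_def mult_left_mono)
  finally show ?thesis .
qed

lemma count_sketch_row_eq:
  assumes i: "i < n" and r: "r < R" and B: "0 < B"
  shows "apply_rows (R * B) n (count_sketch_row B (y, e)) x (r * B + bucket B (e r i))
    = coin_sgn (fst (e r i)) * (2 ^ y i * x i) + bucket_noise n B (\<lambda>a. 2 ^ y a * x a) i (e r)"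
proof -
  have b: "bucket B (e r i) < B" using B by (simp add: bucket_def)
  then have "r * B + bucket B (e r i) < R * B"
    using r mult_le_mono1[of "Suc r" R B] by simp
  moreover have "(r * B + bucket B (e r i)) div B = r" "(r * B + bucket B (e r i)) mod B = bucket B (e r i)"
    using b by auto
  ultimately have "apply_rows (R * B) n (count_sketch_row B (y, e)) x (r * B + bucket B (e r i))
      = (\<Sum>a<n. if bucket B (e r a) = bucket B (e r i) then coin_sgn (fst (e r a)) * (2 ^ y a * x a) else 0)"
    unfolding apply_rows_def count_sketch_row_def by (auto intro!: sum.cong)
  also have "\<dots> = coin_sgn (fst (e r i)) * (2 ^ y i * x i) + bucket_noise n B (\<lambda>a. 2 ^ y a * x a) i (e r)"
    using i by (subst sum.remove[of _ i]) (auto simp: bucket_noise_def)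
  finally show ?thesis .
qed

text \<open>A median can be off by \<open>b\<close> only if at least half of the readings
  are.\<close>

lemma count_sketch_coordinate_close:
  assumes i: "i < n" and R: "0 < R" and B: "0 < B"
    and few: "real (card {r. r < R \<and> b \<le> \<bar>bucket_noise n B (\<lambda>a. 2 ^ y a * x a) i (e r)\<bar>}) < R / 2"
  shows "\<bar>count_sketch_coordinate R B e (apply_rows (R * B) n (count_sketch_row B (y, e)) x) i - 2 ^ y i * \<bar>x i\<bar>\<bar> < b"
proof -
  let ?N = "\<lambda>r. bucket_noise n B (\<lambda>a. 2 ^ y a * x a) i (e r)"
  let ?u = "apply_rows (R * B) n (count_sketch_row B (y, e)) x"
  let ?z = "\<lambda>r. \<bar>?u (r * B + bucket B (e r i))\<bar>"
  let ?v = "2 ^ y i * \<bar>x i\<bar>"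
  let ?c = "(R + 1) div 2"
  have c: "1 \<le> ?c" "?c \<le> R" using R by auto
  have near: "\<bar>?z r - ?v\<bar> < b" if "r < R" "\<not> b \<le> \<bar>?N r\<bar>" for r
  proof -
    have "\<bar>coin_sgn (fst (e r i)) * (2 ^ y i * x i)\<bar> = ?v" by (simp add: abs_mult)
    then show ?thesis using count_sketch_row_eq[OF i that(1) B, of y e x] that(2) by linarith
  qed
  let ?bad = "{r. r < R \<and> b \<le> \<bar>?N r\<bar>}" and ?good = "{r. r < R \<and> \<not> b \<le> \<bar>?N r\<bar>}"
  have "card ?bad + card ?good = card (?bad \<union> ?good)"
    by (subst card_Un_disjoint) auto
  also have "?bad \<union> ?good = {..<R}" by auto
  \<comment> \<open>The rank \<open>(R + 1) div 2\<close> suits both parities of \<open>R\<close>: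
    with fewer than \<open>R / 2\<close> bad tables, the bad ones never reach it and the good ones
    always do.\<close>
  finally have good: "?c \<le> card ?good" and bad: "card ?bad < ?c" using few by auto
  have "?c \<le> card {r. r < R \<and> ?v - b < ?z r}"
    by (rule order_trans[OF good], rule card_mono) (use near in fastforce)+
  then have lo: "?v - b < count_sketch_coordinate R B e ?u i"
    unfolding count_sketch_coordinate_def using kth_largest_gt_iff[OF c] by blast
  have "card {r. r < R \<and> ?v + b \<le> ?z r} < ?c"
    by (rule le_less_trans[OF _ bad], rule card_mono) (use near in fastforce)+
  then have "\<not> ?v + b \<le> count_sketch_coordinate R B e ?u i"
    unfolding count_sketch_coordinate_def using kth_largest_ge_iff[OF c] by (simp add: not_le)
  with lo show ?thesis by linarith
qed

lemma prob_pair_pmf_fst: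
  "measure_pmf.prob (pair_pmf Q R) {z. P (fst z)} = measure_pmf.prob Q {a. P a}"
proof -
  have "Q = map_pmf fst (pair_pmf Q R)" by (simp add: map_fst_pair_pmf)
  then have "measure_pmf.prob Q {a. P a} = measure_pmf.prob (map_pmf fst (pair_pmf Q R)) {a. P a}" by simp
  then show ?thesis by (simp add: vimage_def)
qed

text \<open>The constant 1536 is \<open>16 * 2 * 48\<close>: the failure probability of \<open>prob_weighted_energy_gt\<close> is set to
  \<open>S / 48\<close>, and \<open>16 W\<close> buckets push the noise in one bucket below \<open>1 / 2 = t / 8\<close> with probability \<open>3 / 4\<close>.\<close>

lemma count_sketch_gap:
  fixes x :: "nat \<Rightarrow> real" and p :: real
  defines "S \<equiv> 5 powr - p"
  assumes p: "2 < p" and n: "0 < n" and R: "0 < R" "real n * exp (- (real R / 8)) \<le> S / 48"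
    and B: "1536 / (S * (1 - 2 powr (2 - p))) * real n powr (1 - 2 / p) \<le> real B"
  defines "Q \<equiv> count_sketch_pmf p n R B"
  defines "G \<equiv> \<lambda>s. count_sketch_max n R B s (apply_rows (R * B) n (count_sketch_row B s) x)"
  shows "(\<Sum>i<n. \<bar>x i\<bar> powr p) \<le> 1 \<Longrightarrow> measure_pmf.prob Q {s. 2 * 4 \<le> G s} \<le> 17 / 24 * S"
    and "(\<Sum>i<n. \<bar>x i\<bar> powr p) = 1 \<Longrightarrow> 19 / 24 * S \<le> measure_pmf.prob Q {s. 4 / 2 < G s}"
proof -
  have p0: "0 < p" "1 \<le> p" using p by auto
  have S0: "0 < S" by (simp add: S_def)
  have S5: "S \<le> 1 / 5" using powr_mono[of "- p" "- 1" 5] p by (simp add: S_def powr_minus_divide)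
  define W where "W = 2 / (1 - 2 powr (2 - p)) * real n powr (1 - 2 / p) / (S / 48)"
  have "2 powr (2 - p) < (1 :: real)" using p by (intro powr_less_one) auto
  then have W0: "0 < W" using S0 n by (simp add: W_def)
  have WB: "16 * W \<le> B"
    using B by (simp add: W_def mult.commute)
  then have B0: "0 < B" using W0 by (cases B) auto
  define v where "v y = (\<lambda>a. 2 ^ y a * x a)" for y :: "nat \<Rightarrow> nat"
  define E1 where "E1 = {s :: (nat \<Rightarrow> nat) \<times> (nat \<Rightarrow> nat \<Rightarrow> bool \<times> nat). W < (\<Sum>i<n. (v (fst s) i)\<^sup>2)}"
  \<comment> \<open>The energy condition is part of \<open>P2\<close> so that its probability is
    small for every fixed \<open>y\<close>, as conditioning on the weights requires.\<close>
  define P2 where "P2 y e \<longleftrightarrow> \<not> W < (\<Sum>i<n. (v y i)\<^sup>2) \<and>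
      (\<exists>i<n. real R / 2 \<le> card {r. r < R \<and> 1 / 2 \<le> \<bar>bucket_noise n B (v y) i (e r)\<bar>})"
    for y and e :: "nat \<Rightarrow> nat \<Rightarrow> bool \<times> nat"
  define E2 where "E2 = {s. P2 (fst s) (snd s)}"
  define U where "U b s \<longleftrightarrow> (\<exists>i<n. b \<le> 2 ^ fst s i * \<bar>x i\<bar>)"
    for b and s :: "(nat \<Rightarrow> nat) \<times> (nat \<Rightarrow> nat \<Rightarrow> bool \<times> nat)"
  have p1: "measure_pmf.prob Q E1 \<le> S / 48" if x: "(\<Sum>i<n. \<bar>x i\<bar> powr p) \<le> 1"
    using prob_weighted_energy_gt[OF p n x, of "S / 48" undefined] S0
    by (simp add: Q_def count_sketch_pmf_def E1_def v_def W_def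
        prob_pair_pmf_fst[where P = "\<lambda>y. _ < (\<Sum>i<n. (2 ^ y i * x i)\<^sup>2)"])
  have p2: "measure_pmf.prob Q E2 \<le> S / 48"
    unfolding Q_def count_sketch_pmf_def E2_def
  proof (rule prob_pair_pmf_le)
    fix y
    let ?H = "Pi_pmf {..<R} undefined (\<lambda>_. hash_pmf n B)"
    show "measure_pmf.prob ?H {e. P2 y e} \<le> S / 48"
    proof (cases "W < (\<Sum>i<n. (v y i)\<^sup>2)")
      case True
      then show ?thesis using S0 by (simp add: P2_def)
    next
      case False
      let ?L = "\<lambda>i. {e. 1 / 2 * real R \<le> card {r. r < R \<and> 1 / 2 \<le> \<bar>bucket_noise n B (v y) i (e r)\<bar>}}"
      have one: "measure_pmf.prob ?H (?L i) \<le> exp (- (real R / 8))" if i: "i < n" for i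
      proof -
        have "measure_pmf.prob (hash_pmf n B) {e. 1 / 2 \<le> \<bar>bucket_noise n B (v y) i e\<bar>}
            \<le> (\<Sum>a<n. (v y a)\<^sup>2) / B / (1 / 2)\<^sup>2"
          by (rule prob_bucket_noise_ge[OF B0 i]) simp
        also have "\<dots> \<le> W / B / (1 / 2)\<^sup>2" using False by (intro divide_right_mono) auto
        also have "\<dots> \<le> 1 / 4" using WB B0 by (simp add: power2_eq_square field_simps)
        finally have "measure_pmf.prob (hash_pmf n B) {e. 1 / 2 \<le> \<bar>bucket_noise n B (v y) i e\<bar>} \<le> 1 / 4" .
        \<comment> \<open>A table is bad with probability at most 1 / 4 but half of them must be, so
          the Hoeffding exponent is \<open>2 * R / 16\<close>.\<close>
        from prob_card_ge_le[OF R(1) this, of "1 / 2" undefined] show ?thesis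
          by (simp add: power2_eq_square)
      qed
      have "measure_pmf.prob ?H {e. P2 y e} \<le> measure_pmf.prob ?H (\<Union>i<n. ?L i)"
        by (intro measure_pmf.finite_measure_mono) (auto simp: P2_def)
      also have "\<dots> \<le> (\<Sum>i<n. measure_pmf.prob ?H (?L i))"
        by (intro measure_pmf.finite_measure_subadditive_finite) auto
      also have "\<dots> \<le> (\<Sum>i<n. exp (- (real R / 8)))" using one by (intro sum_mono) auto
      also have "\<dots> \<le> S / 48" using R by simp
      finally show ?thesis .
    qed
  qed
  have bad: "measure_pmf.prob Q (E1 \<union> E2) \<le> S / 24" if x: "(\<Sum>i<n. \<bar>x i\<bar> powr p) \<le> 1"
  proof -
    have "measure_pmf.prob Q (E1 \<union> E2) \<le> measure_pmf.prob Q E1 + measure_pmf.prob Q E2"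
      by (intro measure_Un_le) auto
    then show ?thesis using p1[OF x] p2 by simp
  qed
  have close: "(2 * 4 \<le> G s \<longrightarrow> U (15 / 8 * 4) s) \<and> (U (5 / 8 * 4) s \<longrightarrow> 4 / 2 < G s)"
    if s: "s \<notin> E1 \<union> E2" for s
  proof -
    obtain y e where ye: "s = (y, e)" by force
    let ?g = "\<lambda>i. count_sketch_coordinate R B e (apply_rows (R * B) n (count_sketch_row B (y, e)) x) i"
    have near: "\<bar>?g i - 2 ^ y i * \<bar>x i\<bar>\<bar> < 1 / 2" if i: "i < n" for i
      using s i by (intro count_sketch_coordinate_close[OF i R(1) B0])
        (auto simp: ye E1_def E2_def P2_def v_def not_le)
    have G: "G s = Max (?g ` {..<n})" by (simp add: G_def count_sketch_max_def ye)
    have ne: "?g ` {..<n} \<noteq> {}" using n by (simp add: lessThan_empty_iff)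
    show ?thesis
    proof (intro conjI impI)
      assume "2 * 4 \<le> G s"
      then obtain i where i: "i < n" "8 \<le> ?g i" unfolding G using ne by (subst (asm) Max_ge_iff) auto
      then have "15 / 8 * 4 \<le> 2 ^ y i * \<bar>x i\<bar>" using near[OF i(1)] by linarith
      then show "U (15 / 8 * 4) s" using i by (auto simp: U_def ye)
    next
      assume "U (5 / 8 * 4) s"
      then obtain i where i: "i < n" "5 / 8 * 4 \<le> 2 ^ y i * \<bar>x i\<bar>" by (auto simp: U_def ye)
      then have "4 / 2 < ?g i" using near[OF i(1)] by linarith
      then show "4 / 2 < G s" unfolding G using ne i(1) by (subst Max_gr_iff) auto
    qed
  qed
  \<comment> \<open>With \<open>t = 4\<close> the threshold \<open>5 / 4 * t\<close> is 5, which is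
    where \<open>5 powr - p\<close> comes from.\<close>
  have S: "S = (5 / 4 * 4) powr - p" by (simp add: S_def)
  have U: "measure_pmf.prob Q {s. U b s}
      = measure_pmf.prob (Pi_pmf {..<n} undefined (\<lambda>_. level_pmf p)) {y. \<exists>i<n. b \<le> 2 ^ y i * \<bar>x i\<bar>}" for b
    unfolding Q_def count_sketch_pmf_def U_def by (rule prob_pair_pmf_fst)
  show "measure_pmf.prob Q {s. 2 * 4 \<le> G s} \<le> 17 / 24 * S" if x: "(\<Sum>i<n. \<bar>x i\<bar> powr p) \<le> 1"
  proof (rule gap_from_max(1)[OF p0(2) _ S S5 bad[OF x], where U = U])
    show "measure_pmf.prob Q {s. U (15 / 8 * 4) s} \<le> (15 / 8 * 4) powr - p"
      unfolding U by (intro weighted_max_upper(2)[where w = "\<lambda>j. 2 ^ j", OF level_tail(1)[OF p0(1)] p0(1) x]) auto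
  qed (use close in auto)
  show "19 / 24 * S \<le> measure_pmf.prob Q {s. 4 / 2 < G s}" if x: "(\<Sum>i<n. \<bar>x i\<bar> powr p) = 1"
  proof (rule gap_from_max(2)[OF p0(2) _ S S5 bad, where U = U])
    have "S = (2 * (5 / 8 * 4)) powr - p" by (simp add: S_def)
    then show "S / (1 + S) \<le> measure_pmf.prob Q {s. U (5 / 8 * 4) s}"
      using weighted_max_lower[where w = "\<lambda>j. 2 ^ j" and V = "level_pmf p", OF level_tail(2)[OF p0(1)] p0(1) x, of "5 / 8 * 4" undefined]
      unfolding U by simp
  qed (use close x in auto)
qed

subsection \<open>The sketching families\<close>

lemma lp_norm_vec_le_1_iff:
  assumes "0 < p"
  shows "lp_norm (ereal p) (vec n x) \<le> 1 \<longleftrightarrow> (\<Sum>i<n. \<bar>x i\<bar> powr p) \<le> 1"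
  using lp_norm_finite_le_iff[OF assms, of 1 "vec n x"] by simp

lemma lp_norm_vec_eq_1D:
  assumes "0 < p" "lp_norm (ereal p) (vec n x) = 1"
  shows "(\<Sum>i<n. \<bar>x i\<bar> powr p) = 1"
proof -
  let ?s = "\<Sum>i<n. \<bar>x i\<bar> powr p"
  have s: "?s powr (1 / p) = 1" using assms by (simp add: lp_norm_finite)
  have "?s = (?s powr (1 / p)) powr p" using assms by (simp add: powr_powr sum_nonneg)
  then show ?thesis using s by simp
qed

text \<open>The number \<open>m\<close> of repetitions for a union bound over \<open>n\<close>
  events of probability \<open>exp (- m / c)\<close> each, with total at most \<open>1 / a\<close>.
  A factor \<open>a > 1\<close> keeps the logarithm positive at \<open>n = 1\<close>.\<close>

definition reps :: "real \<Rightarrow> real \<Rightarrow> nat \<Rightarrow> nat" where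
  "reps c a n = nat \<lceil>c * ln (a * real n)\<rceil>"

lemma reps:
  assumes "0 < c" "1 < a" "0 < n"
  shows "0 < reps c a n" "real n * exp (- (real (reps c a n) / c)) \<le> 1 / a"
proof -
  have "1 * 1 < a * real n" using assms by (intro mult_less_le_imp_less) auto
  then have l: "0 < c * ln (a * real n)" using assms by simp
  then show "0 < reps c a n" by (simp add: reps_def)
  have "c * ln (a * real n) \<le> real (reps c a n)" unfolding reps_def by linarith
  then have "exp (- (real (reps c a n) / c)) \<le> exp (- ln (a * real n))"
    using assms by (simp add: pos_le_divide_eq mult.commute)
  also have "\<dots> = 1 / (a * real n)" using assms by (simp add: exp_minus inverse_eq_divide)
  finally have "real n * exp (- (real (reps c a n) / c)) \<le> real n * (1 / (a * real n))"
    by (intro mult_left_mono) auto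
  then show "real n * exp (- (real (reps c a n) / c)) \<le> 1 / a" using assms by simp
qed

lemma nat_ceiling_bigo:
  fixes f :: "nat \<Rightarrow> real"
  assumes "\<And>n. 0 < n \<Longrightarrow> 0 \<le> f n" and "(\<lambda>n. f n + 1) \<in> O(g)"
  shows "(\<lambda>n. real (nat \<lceil>f n\<rceil>)) \<in> O(g)"
proof (rule landau_o.big.trans[OF _ assms(2)])
  have "\<bar>real (nat \<lceil>f n\<rceil>)\<bar> \<le> 1 * \<bar>f n + 1\<bar>" if "0 < n" for n
  proof -
    have "0 \<le> \<lceil>f n\<rceil>" using assms(1)[OF that] by linarith
    then show ?thesis using assms(1)[OF that] by simp
  qed
  then show "(\<lambda>n. real (nat \<lceil>f n\<rceil>)) \<in> O(\<lambda>n. f n + 1)"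
    by (intro bigoI[of _ 1] eventually_mono[OF eventually_gt_at_top[of 0]]) auto
qed

lemma reps_bigo:
  assumes "0 < c" "1 < a"
  shows "(\<lambda>n. real (reps c a n)) \<in> O(\<lambda>n. ln (real n))"
  unfolding reps_def
proof (rule nat_ceiling_bigo)
  show "(\<lambda>n. c * ln (a * real n) + 1) \<in> O(\<lambda>n. ln (real n))"
    using assms by real_asymp
  fix n :: nat assume "0 < n"
  then have "1 * 1 \<le> a * real n" using assms by (intro mult_mono) auto
  then show "0 \<le> c * ln (a * real n)" using assms by simp
qed

text \<open>The constants \<alpha>, \<beta> and \<open>t\<close> are fixed before \<open>n\<close>;
  this uniformity makes the number of repetitions logarithmic. Each repetition costs one row,
  \<open>K = 1\<close>.\<close>

lemma sketching_family_single_row: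
  fixes V :: "'b pmf" and w :: "'b \<Rightarrow> real" and p t :: real
  assumes p: "1 \<le> p" and t: "0 < t" and ab: "\<alpha> < \<beta>"
    and upper: "\<And>n (x :: nat \<Rightarrow> real). (\<Sum>i<n. \<bar>x i\<bar> powr p) \<le> 1 \<Longrightarrow>
      measure_pmf.prob (Pi_pmf {..<n} undefined (\<lambda>_. V)) {z. 2 * t \<le> \<bar>\<Sum>i<n. w (z i) * x i\<bar>} \<le> \<alpha>"
    and lower: "\<And>n (x :: nat \<Rightarrow> real). (\<Sum>i<n. \<bar>x i\<bar> powr p) = 1 \<Longrightarrow>
      \<beta> \<le> measure_pmf.prob (Pi_pmf {..<n} undefined (\<lambda>_. V)) {z. t / 2 < \<bar>\<Sum>i<n. w (z i) * x i\<bar>}"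
  shows "\<exists>k. (\<lambda>n. real (k n)) \<in> O(\<lambda>n. real n * ln (real n)) \<and>
    (\<forall>n\<ge>1. \<exists>S f. sketching_family n n 1 (ereal p) (k n) 2 S f)"
proof (rule exI, intro conjI allI impI)
  define c where "c = 2 / (\<beta> - \<alpha>)\<^sup>2"
  have c: "0 < c" using ab by (simp add: c_def)
  let ?k = "\<lambda>n. 2 * (n * reps c 12 n * 1)"
  have "(\<lambda>n. 2 * (real n * real (reps c 12 n))) \<in> O(\<lambda>n. real n * ln (real n))"
    using landau_o.big.mult[OF _ reps_bigo[OF c], of "\<lambda>n. 2 * real n" real 12] by (simp add: mult.assoc)
  then show "(\<lambda>n. real (?k n)) \<in> O(\<lambda>n. real n * ln (real n))" by simp
  fix n :: nat assume "1 \<le> n"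
  then have n: "0 < n" by simp
  define \<rho> where "\<rho> z c a = w (z a)" for z :: "nat \<Rightarrow> 'b" and c a :: nat
  have row: "apply_rows 1 n (\<rho> z) x 0 = (\<Sum>i<n. w (z i) * x i)" for z x
    by (simp add: apply_rows_def \<rho>_def)
  have p0: "0 < p" using p by simp
  show "\<exists>S f. sketching_family n n 1 (ereal p) (?k n) 2 S f"
  proof (rule sketching_family_amplify[where Q = "Pi_pmf {..<n} undefined (\<lambda>_. V)" and \<rho> = \<rho>
        and g = "\<lambda>z u. \<bar>u 0\<bar>" and t = t and \<alpha> = \<alpha> and \<beta> = \<beta>])
    show "(\<lambda>u :: nat \<Rightarrow> real. \<bar>u 0\<bar>) \<in> borel_measurable (PiM UNIV (\<lambda>_. borel))"
      by (intro borel_measurable_abs measurable_component_singleton) auto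
    have "real n * exp (- (real (reps c 12 n) / c)) \<le> 1 / 12" using reps(2)[OF c _ n, of 12] by simp
    then show "real n * exp (- (real (reps c 12 n) * (\<beta> - \<alpha>)\<^sup>2 / 2)) \<le> 1 / 12" by (simp add: c_def)
    show "measure_pmf.prob (Pi_pmf {..<n} undefined (\<lambda>_. V)) {z. 2 * t \<le> \<bar>apply_rows 1 n (\<rho> z) x 0\<bar>} \<le> \<alpha>"
      if "lp_norm (ereal p) (vec n x) \<le> 1" for x
      unfolding row using upper[of x n] that lp_norm_vec_le_1_iff[OF p0] by blast
    show "\<beta> \<le> measure_pmf.prob (Pi_pmf {..<n} undefined (\<lambda>_. V)) {z. t / 2 < \<bar>apply_rows 1 n (\<rho> z) x 0\<bar>}"
      if "lp_norm (ereal p) (vec n x) = 1" for x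
      unfolding row by (rule lower[OF lp_norm_vec_eq_1D[OF p0 that]])
  qed (use p t ab n reps(1)[OF c _ n, of 12] in \<open>auto simp: abs_mult\<close>)
qed

lemma sketching_family_le_2:
  assumes "1 \<le> p" "p \<le> 2"
  shows "\<exists>k. (\<lambda>n. real (k n)) \<in> O(\<lambda>n. real n * ln (real n)) \<and>
    (\<forall>n\<ge>1. \<exists>S f. sketching_family n n 1 (ereal p) (k n) 2 S f)"
proof (cases "p = 2")
  case True
  have sq: "\<bar>r\<bar> powr 2 = r\<^sup>2" for r :: real by (simp add: powr_numeral)
  show ?thesis
  proof (rule sketching_family_single_row[where V = coin and w = coin_sgn and t = 1
        and \<alpha> = "2 / 11" and \<beta> = "9 / 41"])
    show "measure_pmf.prob (Pi_pmf {..<n} undefined (\<lambda>_. coin)) {z. 2 * 1 \<le> \<bar>\<Sum>i<n. coin_sgn (z i) * x i\<bar>} \<le> 2 / 11"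
      if "(\<Sum>i<n. \<bar>x i\<bar> powr p) \<le> 1" for n and x :: "nat \<Rightarrow> real"
      using coin_sum_tails(1)[where n = n and x = x] that by (simp add: True sq)
    show "9 / 41 \<le> measure_pmf.prob (Pi_pmf {..<n} undefined (\<lambda>_. coin)) {z. 1 / 2 < \<bar>\<Sum>i<n. coin_sgn (z i) * x i\<bar>}"
      if "(\<Sum>i<n. \<bar>x i\<bar> powr p) = 1" for n and x :: "nat \<Rightarrow> real"
      using coin_sum_tails(2)[where n = n and x = x] that by (simp add: True sq)
  qed (use assms in auto)
next
  case False
  with assms have p: "1 \<le> p" "p < 2" by auto
  show ?thesis
  proof (rule single_row_gap_below_two[OF p])
    fix t S :: real
    assume tS: "0 < t" "0 < S"
      and upper: "\<And>n (x :: nat \<Rightarrow> real). (\<Sum>i<n. \<bar>x i\<bar> powr p) \<le> 1 \<Longrightarrow>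
        measure_pmf.prob (Pi_pmf {..<n} undefined (\<lambda>_. signed_level_pmf p))
          {z. 2 * t \<le> \<bar>\<Sum>i<n. signed_weight (z i) * x i\<bar>} \<le> 17 / 24 * S"
      and lower: "\<And>n (x :: nat \<Rightarrow> real). (\<Sum>i<n. \<bar>x i\<bar> powr p) = 1 \<Longrightarrow> 19 / 24 * S \<le>
        measure_pmf.prob (Pi_pmf {..<n} undefined (\<lambda>_. signed_level_pmf p))
          {z. t / 2 < \<bar>\<Sum>i<n. signed_weight (z i) * x i\<bar>}"
    show ?thesis
      by (rule sketching_family_single_row[OF p(1) tS(1) _ upper lower]) (use tS in auto)
  qed
qed

text \<open>The rows multiply: \<open>n\<close> columns, \<open>O(log n)\<close> repetitions for the
  union bound over the columns, \<open>O(log n)\<close> tables for the union bound over the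
  coordinates inside a count sketch, and \<open>O(n powr (1 - 2 / p))\<close> buckets per
  table.\<close>

lemma sketching_family_gt_2:
  fixes p :: real
  assumes p: "2 < p"
  shows "\<exists>k. (\<lambda>n. real (k n)) \<in> O(\<lambda>n. real n powr (2 - 2 / p) * (ln (real n))\<^sup>2) \<and>
    (\<forall>n\<ge>1. \<exists>S f. sketching_family n n 1 (ereal p) (k n) 2 S f)"
proof (rule exI, intro conjI allI impI)
  define S :: real where "S = 5 powr - p"
  have S: "0 < S" by (simp add: S_def)
  have S5: "S < 1" unfolding S_def using p by (intro powr_less_one) auto
  define c where "c = 2 / (19 / 24 * S - 17 / 24 * S)\<^sup>2"
  have c: "0 < c" using S by (simp add: c_def)
  define D where "D = 1536 / (S * (1 - 2 powr (2 - p)))"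
  have "2 powr (2 - p) < (1 :: real)" using p by (intro powr_less_one) auto
  then have D: "0 < D" using S by (simp add: D_def)
  define B where "B n = nat \<lceil>D * real n powr (1 - 2 / p)\<rceil>" for n
  define e where "e = 1 - 2 / p"
  have e: "0 < e" using p by (simp add: e_def)
  let ?m = "reps c 12" and ?R = "reps 8 (48 / S)"
  let ?k = "\<lambda>n. 2 * (n * ?m n * (?R n * B n))"
  have a: "1 < 48 / S" using S S5 by simp
  have Bo: "(\<lambda>n. real (B n)) \<in> O(\<lambda>n. real n powr e)"
    unfolding B_def e_def[symmetric]
  proof (rule nat_ceiling_bigo)
    show "(\<lambda>n. D * real n powr e + 1) \<in> O(\<lambda>n. real n powr e)" using D e by real_asymp
  qed (use D in simp)
  have "(\<lambda>n. 2 * real n * real (?m n) * (real (?R n) * real (B n)))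
      \<in> O(\<lambda>n. real n * ln (real n) * (ln (real n) * real n powr e))"
    by (intro landau_o.big.mult reps_bigo Bo c a) auto
  moreover have "real n * ln (real n) * (ln (real n) * real n powr e) = real n powr (2 - 2 / p) * (ln (real n))\<^sup>2" for n
  proof (cases "n = 0")
    case False
    then have "real n powr (2 - 2 / p) = real n * real n powr e"
      using powr_add[of n 1 e] by (simp add: e_def)
    then show ?thesis by (simp add: power2_eq_square)
  qed simp
  ultimately show "(\<lambda>n. real (?k n)) \<in> O(\<lambda>n. real n powr (2 - 2 / p) * (ln (real n))\<^sup>2)"
    by (simp add: mult.assoc)
  fix n :: nat assume "1 \<le> n"
  then have n: "0 < n" by simp
  have p0: "0 < p" using p by simp
  have R: "0 < ?R n" "real n * exp (- (real (?R n) / 8)) \<le> S / 48"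
    using reps[OF _ a n, of 8] by auto
  have Bn: "1536 / (S * (1 - 2 powr (2 - p))) * real n powr (1 - 2 / p) \<le> real (B n)"
    unfolding B_def D_def by linarith
  show "\<exists>S f. sketching_family n n 1 (ereal p) (?k n) 2 S f"
  proof (rule sketching_family_amplify[where Q = "count_sketch_pmf p n (?R n) (B n)"
        and \<rho> = "count_sketch_row (B n)" and g = "count_sketch_max n (?R n) (B n)"
        and t = 4 and \<alpha> = "17 / 24 * S" and \<beta> = "19 / 24 * S"])
    show "count_sketch_max n (?R n) (B n) s \<in> borel_measurable (PiM UNIV (\<lambda>_. borel))" for s
      by (rule borel_measurable_count_sketch_max)
    show "count_sketch_max n (?R n) (B n) s (\<lambda>c. a * u c) = a * count_sketch_max n (?R n) (B n) s u"
      if "0 \<le> a" for s a u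
      by (rule count_sketch_max_scale[OF R(1) n that])
    have "real n * exp (- (real (?m n) / c)) \<le> 1 / 12" using reps(2)[OF c _ n, of 12] by simp
    then show "real n * exp (- (real (?m n) * (19 / 24 * S - 17 / 24 * S)\<^sup>2 / 2)) \<le> 1 / 12"
      by (simp add: c_def)
    show "measure_pmf.prob (count_sketch_pmf p n (?R n) (B n))
        {s. 2 * 4 \<le> count_sketch_max n (?R n) (B n) s (apply_rows (?R n * B n) n (count_sketch_row (B n) s) x)}
        \<le> 17 / 24 * S" if "lp_norm (ereal p) (vec n x) \<le> 1" for x
      using that unfolding lp_norm_vec_le_1_iff[OF p0]
      by (rule count_sketch_gap(1)[OF p n, folded S_def, OF R Bn])
    show "19 / 24 * S \<le> measure_pmf.prob (count_sketch_pmf p n (?R n) (B n))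
        {s. 4 / 2 < count_sketch_max n (?R n) (B n) s (apply_rows (?R n * B n) n (count_sketch_row (B n) s) x)}"
      if "lp_norm (ereal p) (vec n x) = 1" for x
      by (rule count_sketch_gap(2)[OF p n, folded S_def, OF R Bn lp_norm_vec_eq_1D[OF p0 that]])
  qed (use p S n reps(1)[OF c _ n, of 12] in auto)
qed

text \<open>A deterministic statistic with a one-point seed reads all entries. The amplification
  runs with the trivial tails 0 and 1, and its logarithmic repetition fits into the square of the
  logarithm.\<close>

lemma sketching_family_infinity:
  "\<exists>k. (\<lambda>n. real (k n)) \<in> O(\<lambda>n. real n powr 2 * (ln (real n))\<^sup>2) \<and>
    (\<forall>n\<ge>1. \<exists>S f. sketching_family n n 1 \<infinity> (k n) 2 S f)"
proof (rule exI, intro conjI allI impI)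
  let ?m = "reps 2 12"
  let ?k = "\<lambda>n. 2 * (n * ?m n * n)"
  have "(\<lambda>n. 2 * real n * real (?m n) * real n) \<in> O(\<lambda>n. real n * ln (real n) * real n)"
    by (intro landau_o.big.mult reps_bigo) auto
  also have "(\<lambda>n. real n * ln (real n) * real n) \<in> O(\<lambda>n. real n powr 2 * (ln (real n))\<^sup>2)"
    by real_asymp
  finally show "(\<lambda>n. real (?k n)) \<in> O(\<lambda>n. real n powr 2 * (ln (real n))\<^sup>2)" by (simp add: mult.assoc)
  fix n :: nat assume "1 \<le> n"
  then have n: "0 < n" by simp
  then have ne: "{..<n} \<noteq> {}" by auto
  define \<rho> :: "unit \<Rightarrow> nat \<Rightarrow> nat \<Rightarrow> real" where "\<rho> s c a = (if c = a then 1 else 0)" for s c a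
  define g :: "unit \<Rightarrow> (nat \<Rightarrow> real) \<Rightarrow> real" where "g s u = Max ((\<lambda>i. \<bar>u i\<bar>) ` {..<n})" for s u
  have row: "apply_rows n n (\<rho> s) x i = x i" if "i < n" for s x i
  proof -
    have "(\<Sum>a<n. (if i = a then 1 else 0) * x a) = (\<Sum>a<n. if i = a then x a else 0)"
      by (intro sum.cong) auto
    then show ?thesis using that by (simp add: apply_rows_def \<rho>_def)
  qed
  have g: "g s (apply_rows n n (\<rho> s) x) = lp_norm \<infinity> (vec n x)" for s x
  proof -
    have "(\<lambda>i. \<bar>vec n x $ i\<bar>) ` {..<n} = (\<lambda>i. \<bar>x i\<bar>) ` {..<n}" by (intro image_cong) auto
    then have "lp_norm \<infinity> (vec n x) = max 0 (Max ((\<lambda>i. \<bar>x i\<bar>) ` {..<n}))"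
      using ne by (simp add: lp_norm_infinity)
    moreover have "0 \<le> Max ((\<lambda>i. \<bar>x i\<bar>) ` {..<n})"
      using n by (subst Max_ge_iff) auto
    moreover have "(\<lambda>i. \<bar>apply_rows n n (\<rho> s) x i\<bar>) ` {..<n} = (\<lambda>i. \<bar>x i\<bar>) ` {..<n}"
      by (intro image_cong) (auto simp: row)
    ultimately show ?thesis by (simp add: g_def)
  qed
  show "\<exists>S f. sketching_family n n 1 \<infinity> (?k n) 2 S f"
  proof (rule sketching_family_amplify[where Q = "return_pmf ()" and \<rho> = \<rho> and g = g
        and t = 1 and \<alpha> = 0 and \<beta> = 1])
    show "g s \<in> borel_measurable (PiM UNIV (\<lambda>_. borel))" for s
      unfolding g_def
      by (intro borel_measurable_Max borel_measurable_abs measurable_component_singleton) auto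
    show "g s (\<lambda>c. a * u c) = a * g s u" if "0 \<le> a" for s a u
    proof -
      have "g s (\<lambda>c. a * u c) = Max ((\<lambda>r. a * r) ` (\<lambda>i. \<bar>u i\<bar>) ` {..<n})"
        using that by (simp add: g_def image_image abs_mult)
      also have "\<dots> = a * g s u"
        unfolding g_def using ne that
        by (intro mono_Max_commute[symmetric]) (auto simp: mono_def mult_left_mono)
      finally show ?thesis .
    qed
    show "real n * exp (- (real (?m n) * (1 - 0)\<^sup>2 / 2)) \<le> 1 / 12"
      using reps(2)[of 2 12 n] n by simp
  qed (use n reps(1)[of 2 12 n] g in auto)
qed

theorem theorem3p4:
  shows "(\<forall>p::ereal. 1 \<le> p \<and> p \<le> 2 \<longrightarrow>
           (\<exists>k :: nat \<Rightarrow> nat.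
             (\<lambda>n. real (k n)) \<in> O(\<lambda>n. real n * ln (real n)) \<and>
             (\<forall>n\<ge>1. \<exists>S f. sketching_family n n 1 p (k n) 2 S f))) \<and>
         (\<forall>p::ereal. 2 < p \<longrightarrow>
           (\<exists>k :: nat \<Rightarrow> nat.
             (\<lambda>n. real (k n)) \<in>
               O(\<lambda>n. real n powr real_of_ereal (2 - 2 / p) * (ln (real n))\<^sup>2) \<and>
             (\<forall>n\<ge>1. \<exists>S f. sketching_family n n 1 p (k n) 2 S f)))"
proof (intro conjI allI impI)
  fix p :: ereal
  assume p: "1 \<le> p \<and> p \<le> 2"
  then obtain r where r: "p = ereal r" by (cases p) auto
  with p have "1 \<le> r" "r \<le> 2" by (auto simp: one_ereal_def numeral_eq_ereal)
  then show "\<exists>k :: nat \<Rightarrow> nat. (\<lambda>n. real (k n)) \<in> O(\<lambda>n. real n * ln (real n)) \<and>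
      (\<forall>n\<ge>1. \<exists>S f. sketching_family n n 1 p (k n) 2 S f)"
    unfolding r by (rule sketching_family_le_2)
next
  fix p :: ereal
  assume p: "2 < p"
  show "\<exists>k :: nat \<Rightarrow> nat.
      (\<lambda>n. real (k n)) \<in> O(\<lambda>n. real n powr real_of_ereal (2 - 2 / p) * (ln (real n))\<^sup>2) \<and>
      (\<forall>n\<ge>1. \<exists>S f. sketching_family n n 1 p (k n) 2 S f)"
  proof (cases p)
    case (real r)
    with p have r: "2 < r" by (simp add: numeral_eq_ereal)
    then have "real_of_ereal (2 - 2 / p) = 2 - 2 / r" by (simp add: real numeral_eq_ereal)
    then show ?thesis using sketching_family_gt_2[OF r] by (simp only: real)
  next
    case PInf
    have "real_of_ereal (2 - 2 / p) = 2" by (simp add: PInf)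
    then show ?thesis using sketching_family_infinity by (simp only: PInf)
  qed (use p in simp)
qed

end
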